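(* Let $(M,\Pi)\stackrel{\phi}{\to}(B,\pi)$ be an NCI system of rank $r$, with associated foliation $\mathfrak F$ of $M$ by the fibers of $\phi$. Let $m\in M$ and $b:=\phi(m)\in B$. (1) For every $\alpha,\alpha'\in E_b$, the action vector fields $X_\alpha$ and $X_{\alpha'}$ (vector fields on $\phi^{-1}(b)$) commute. (2) For every basis $\alpha_1,\dots,\alpha_r$ of $E_b$, the vector fields $X_{\alpha_1},\dots,X_{\alpha_r}$, evaluated at $m$, form a basis of $T_m\mathfrak F$. In particular, $X_\alpha$ is nowhere vanishing when $\alpha\neq0$.
   Context: All manifolds and objects are smooth and real. For a Poisson manifold $(M,\Pi)$ write $\{f,g\}=\Pi(df,dg)$; the Hamiltonian vector field $X_h$ is given by $X_h(g)=\{g,h\}$, and $\Pi^\sharp:T^*M\to TM$ is the induced bundle map, with $\Pi^\sharp(dh)=-X_h$. A (local) first integral of a foliation is a (locally defined) function constant on its leaves. An abstract NCI system of rank $r$ on $(M,\Pi)$ is an $r$-dimensional foliation $\mathfrak F$ of $M$ whose tangent bundle is spanned by Hamiltonian vector fields of local first integrals: each $m\in M$ has a neighborhood on which there are first integrals $f_1,\dots,f_r$ of $\mathfrak F$ such that $X_{f_1},\dots,X_{f_r}$ span $T\mathfrak F$ at every point. An NCI system $(M,\Pi)\stackrel{\phi}{\to}(B,\pi)$ of rank $r$ is such an abstract NCI system whose leaf space $B$ is a smooth Hausdorff manifold; $\phi:M\to B$ is the quotient map, a surjective submersion whose fibers are the (connected) leaves of $\mathfrak F$, and $\pi$ is the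 unique Poisson structure on $B$ making $\phi$ a Poisson map. The action bundle $E\to B$ is the rank $r$ vector bundle whose sheaf of sections is $\operatorname{Ker}\pi^\sharp/\operatorname{Ker}(\Pi^\sharp\circ\phi^* )$ (quotient of sheaves of 1-forms $\omega$ on open subsets of $B$ with $\pi^\sharp\omega=0$, respectively $\Pi^\sharp(\phi^*\omega)=0$). Its fiber at $b$ is $E_b=\operatorname{Ker}(\pi_b^\sharp)/\{\xi\in T_b^*B\mid \Pi_m^\sharp(\phi^*\xi)=0\}$, where $m$ is any point of $\phi^{-1}(b)$ and $\phi^*\xi=\xi\circ d_m\phi$; the denominator does not depend on $m\in\phi^{-1}(b)$. For $\alpha\in E_b$ the action vector field $X_\alpha$ is the vector field on $\phi^{-1}(b)$ given by $X_\alpha(m)=\Pi_m^\sharp(\phi^*\alpha)$ for $m\in\phi^{-1}(b)$. *)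

theory Defs
  imports "HOL-Analysis.Analysis"
begin

section \<open>Smooth manifolds\<close>

text \<open>
  The underlying space of a manifold is a whole type (sorts \<open>t2_space\<close> and
  \<open>second_countable_topology\<close> are imposed in \<open>nci_system\<close> below); the smooth structure is an
  atlas with values in a Euclidean space \<open>'e\<close>, so the dimension is \<open>DIM('e) \<ge> 1\<close>.
\<close>

primrec Ck_on :: "nat \<Rightarrow> ('a::real_normed_vector \<Rightarrow> 'b::real_normed_vector) \<Rightarrow> 'a set \<Rightarrow> bool" where
  "Ck_on 0 f S \<longleftrightarrow> continuous_on S f"
| "Ck_on (Suc k) f S \<longleftrightarrow>
     (\<forall>x\<in>S. f differentiable (at x)) \<and> (\<forall>v. Ck_on k (\<lambda>x. frechet_derivative f (at x) v) S)"

text \<open>Only used for open \<open>S\<close>.\<close>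
definition smooth_on :: "('a::real_normed_vector \<Rightarrow> 'b::real_normed_vector) \<Rightarrow> 'a set \<Rightarrow> bool" where
  "smooth_on f S \<longleftrightarrow> (\<forall>k. Ck_on k f S)"

type_synonym ('m, 'e) chart = "'m set \<times> ('m \<Rightarrow> 'e)"

definition is_chart :: "('m::topological_space, 'e::euclidean_space) chart \<Rightarrow> bool" where
  "is_chart c \<longleftrightarrow> (case c of (U, \<psi>) \<Rightarrow>
     open U \<and> open (\<psi> ` U) \<and> homeomorphism U (\<psi> ` U) \<psi> (inv_into U \<psi>))"

definition compatible :: "('m, 'e::euclidean_space) chart \<Rightarrow> ('m, 'e) chart \<Rightarrow> bool" where
  "compatible c d \<longleftrightarrow> (case (c, d) of ((U, \<psi>), (V, \<theta>)) \<Rightarrow>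
     smooth_on (\<theta> \<circ> inv_into U \<psi>) (\<psi> ` (U \<inter> V)) \<and>
     smooth_on (\<psi> \<circ> inv_into V \<theta>) (\<theta> ` (U \<inter> V)))"

definition smooth_atlas :: "('m::topological_space, 'e::euclidean_space) chart set \<Rightarrow> bool" where
  "smooth_atlas A \<longleftrightarrow>
     (\<forall>c\<in>A. is_chart c) \<and> (\<forall>c\<in>A. \<forall>d\<in>A. compatible c d) \<and> \<Union> (fst ` A) = UNIV"

text \<open>The charts of the maximal atlas containing \<open>A\<close>.\<close>
definition smooth_chart ::
  "('m::topological_space, 'e::euclidean_space) chart set \<Rightarrow> ('m, 'e) chart \<Rightarrow> bool" where
  "smooth_chart A c \<longleftrightarrow> is_chart c \<and> (\<forall>d\<in>A. compatible c d)"

definition smooth_fun_on ::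
  "('m::topological_space, 'e::euclidean_space) chart set \<Rightarrow> 'm set \<Rightarrow> ('m \<Rightarrow> real) \<Rightarrow> bool" where
  "smooth_fun_on A W f \<longleftrightarrow> open W \<and>
     (\<forall>(U, \<psi>)\<in>A. smooth_on (f \<circ> inv_into U \<psi>) (\<psi> ` (U \<inter> W)))"

definition smooth_at ::
  "('m::topological_space, 'e::euclidean_space) chart set \<Rightarrow> 'm \<Rightarrow> ('m \<Rightarrow> real) \<Rightarrow> bool" where
  "smooth_at A p f \<longleftrightarrow> (\<exists>W. p \<in> W \<and> smooth_fun_on A W f)"

definition smooth_map ::
  "('m::topological_space, 'e::euclidean_space) chart set \<Rightarrow>
   ('n::topological_space, 'd::euclidean_space) chart set \<Rightarrow> ('m \<Rightarrow> 'n) \<Rightarrow> bool" where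
  "smooth_map A B \<phi> \<longleftrightarrow> continuous_on UNIV \<phi> \<and>
     (\<forall>(U, \<psi>)\<in>A. \<forall>(V, \<theta>)\<in>B.
        smooth_on (\<theta> \<circ> \<phi> \<circ> inv_into U \<psi>) (\<psi> ` (U \<inter> \<phi> -` V)))"

section \<open>Tangent and cotangent vectors\<close>

text \<open>
  A tangent vector is the velocity at \<open>0\<close> of a smooth curve, represented by its action
  \<open>f \<mapsto> (f \<circ> \<gamma>)'(0)\<close> on the functions that are smooth near \<open>\<gamma> 0\<close> (and by \<open>0\<close> on all other
  functions). Vector space operations are pointwise.
\<close>

type_synonym 'm tvec = "('m \<Rightarrow> real) \<Rightarrow> real"
type_synonym 'm covec = "'m tvec \<Rightarrow> real"

definition smooth_curve ::
  "('m::topological_space, 'e::euclidean_space) chart set \<Rightarrow> (real \<Rightarrow> 'm) \<Rightarrow> bool" where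
  "smooth_curve A \<gamma> \<longleftrightarrow> (\<exists>e>0. continuous_on {-e<..<e} \<gamma> \<and>
     (\<forall>(U, \<psi>)\<in>A. smooth_on (\<psi> \<circ> \<gamma>) ({-e<..<e} \<inter> \<gamma> -` U)))"

definition velocity ::
  "('m::topological_space, 'e::euclidean_space) chart set \<Rightarrow> (real \<Rightarrow> 'm) \<Rightarrow> 'm tvec" where
  "velocity A \<gamma> = (\<lambda>f. if smooth_at A (\<gamma> 0) f then deriv (f \<circ> \<gamma>) 0 else 0)"

text \<open>
  Velocities of smooth curves of the manifold that stay in \<open>N\<close>. This is \<open>T\<^sub>p N\<close> when \<open>N\<close> is an
  embedded submanifold or a leaf of a foliation: in a foliated chart such a curve stays in one plaque.
\<close>
definition tangent_in ::
  "('m::topological_space, 'e::euclidean_space) chart set \<Rightarrow> 'm set \<Rightarrow> 'm \<Rightarrow> 'm tvec set" where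
  "tangent_in A N p =
     {velocity A \<gamma> | \<gamma>. smooth_curve A \<gamma> \<and> \<gamma> 0 = p \<and> (\<forall>\<^sub>F t in nhds 0. \<gamma> t \<in> N)}"

definition tangent_space ::
  "('m::topological_space, 'e::euclidean_space) chart set \<Rightarrow> 'm \<Rightarrow> 'm tvec set" where
  "tangent_space A p = tangent_in A UNIV p"

definition lin_comb :: "nat \<Rightarrow> (nat \<Rightarrow> real) \<Rightarrow> (nat \<Rightarrow> 'x \<Rightarrow> real) \<Rightarrow> 'x \<Rightarrow> real" where
  "lin_comb k c v = (\<lambda>f. \<Sum>i<k. c i * v i f)"

text \<open>Linear functionals on the tangent space, extended by \<open>0\<close> to non-tangent arguments.\<close>
definition cotangent_space ::
  "('m::topological_space, 'e::euclidean_space) chart set \<Rightarrow> 'm \<Rightarrow> 'm covec set" where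
  "cotangent_space A p = {\<xi>.
     (\<forall>v\<in>tangent_space A p. \<forall>w\<in>tangent_space A p. \<forall>a b.
        \<xi> (\<lambda>f. a * v f + b * w f) = a * \<xi> v + b * \<xi> w) \<and>
     (\<forall>v. v \<notin> tangent_space A p \<longrightarrow> \<xi> v = 0)}"

definition differential ::
  "('m::topological_space, 'e::euclidean_space) chart set \<Rightarrow> 'm \<Rightarrow> ('m \<Rightarrow> real) \<Rightarrow> 'm covec" where
  "differential A p f = (\<lambda>v. if v \<in> tangent_space A p then v f else 0)"

definition tangent_map ::
  "('n::topological_space, 'd::euclidean_space) chart set \<Rightarrow> ('m \<Rightarrow> 'n) \<Rightarrow> 'm \<Rightarrow> 'm tvec \<Rightarrow> 'n tvec" where
  "tangent_map B \<phi> p v = (\<lambda>g. if smooth_at B (\<phi> p) g then v (g \<circ> \<phi>) else 0)"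

definition pullback ::
  "('m::topological_space, 'e::euclidean_space) chart set \<Rightarrow>
   ('n::topological_space, 'd::euclidean_space) chart set \<Rightarrow>
   ('m \<Rightarrow> 'n) \<Rightarrow> 'm \<Rightarrow> 'n covec \<Rightarrow> 'm covec" where
  "pullback A B \<phi> p \<xi> = (\<lambda>v. if v \<in> tangent_space A p then \<xi> (tangent_map B \<phi> p v) else 0)"

definition submersion ::
  "('m::topological_space, 'e::euclidean_space) chart set \<Rightarrow>
   ('n::topological_space, 'd::euclidean_space) chart set \<Rightarrow> ('m \<Rightarrow> 'n) \<Rightarrow> bool" where
  "submersion A B \<phi> \<longleftrightarrow> smooth_map A B \<phi> \<and>
     (\<forall>p. tangent_map B \<phi> p ` tangent_space A p = tangent_space B (\<phi> p))"

section \<open>Poisson structures\<close>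

text \<open>A bivector field: \<open>P p \<xi> \<eta>\<close> is relevant only for \<open>\<xi>\<close>, \<open>\<eta>\<close> in the cotangent space at \<open>p\<close>.\<close>
type_synonym 'm bivec = "'m \<Rightarrow> 'm covec \<Rightarrow> 'm covec \<Rightarrow> real"

definition bracket ::
  "('m::topological_space, 'e::euclidean_space) chart set \<Rightarrow> 'm bivec \<Rightarrow>
   ('m \<Rightarrow> real) \<Rightarrow> ('m \<Rightarrow> real) \<Rightarrow> 'm \<Rightarrow> real" where
  "bracket A P f g = (\<lambda>p. P p (differential A p f) (differential A p g))"

definition poisson ::
  "('m::topological_space, 'e::euclidean_space) chart set \<Rightarrow> 'm bivec \<Rightarrow> bool" where
  "poisson A P \<longleftrightarrow>
     (\<forall>p. \<forall>\<xi>\<in>cotangent_space A p. \<forall>\<eta>\<in>cotangent_space A p. P p \<xi> \<eta> = - P p \<eta> \<xi>) \<and>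
     (\<forall>p. \<forall>\<xi>\<in>cotangent_space A p. \<forall>\<eta>\<in>cotangent_space A p. \<forall>\<zeta>\<in>cotangent_space A p. \<forall>a b.
        P p (\<lambda>v. a * \<xi> v + b * \<eta> v) \<zeta> = a * P p \<xi> \<zeta> + b * P p \<eta> \<zeta>) \<and>
     (\<forall>W f g. smooth_fun_on A W f \<longrightarrow> smooth_fun_on A W g \<longrightarrow> smooth_fun_on A W (bracket A P f g)) \<and>
     (\<forall>W f g h. smooth_fun_on A W f \<longrightarrow> smooth_fun_on A W g \<longrightarrow> smooth_fun_on A W h \<longrightarrow>
        (\<forall>p\<in>W. bracket A P f (bracket A P g h) p + bracket A P g (bracket A P h f) p
               + bracket A P h (bracket A P f g) p = 0))"

text \<open>
  The vector \<open>P\<^sup>\<sharp> \<xi>\<close> with \<open>df (P\<^sup>\<sharp> \<xi>) = P(\<xi>, df)\<close>, and \<open>X\<^sub>h(g) = {g, h}\<close>; with these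
  conventions \<open>P\<^sup>\<sharp>(dh) = -X\<^sub>h\<close>.
\<close>
definition sharp ::
  "('m::topological_space, 'e::euclidean_space) chart set \<Rightarrow> 'm bivec \<Rightarrow> 'm \<Rightarrow> 'm covec \<Rightarrow> 'm tvec" where
  "sharp A P p \<xi> = (\<lambda>f. if smooth_at A p f then P p \<xi> (differential A p f) else 0)"

definition hamiltonian ::
  "('m::topological_space, 'e::euclidean_space) chart set \<Rightarrow> 'm bivec \<Rightarrow> ('m \<Rightarrow> real) \<Rightarrow> 'm \<Rightarrow> 'm tvec" where
  "hamiltonian A P h p = (\<lambda>g. if smooth_at A p g then bracket A P g h p else 0)"

definition poisson_map ::
  "('m::topological_space, 'e::euclidean_space) chart set \<Rightarrow> 'm bivec \<Rightarrow>
   ('n::topological_space, 'd::euclidean_space) chart set \<Rightarrow> 'n bivec \<Rightarrow> ('m \<Rightarrow> 'n) \<Rightarrow> bool" where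
  "poisson_map A P B \<pi> \<phi> \<longleftrightarrow>
     (\<forall>W f g. smooth_fun_on B W f \<longrightarrow> smooth_fun_on B W g \<longrightarrow>
        (\<forall>p. \<phi> p \<in> W \<longrightarrow> bracket A P (f \<circ> \<phi>) (g \<circ> \<phi>) p = bracket B \<pi> f g (\<phi> p)))"

section \<open>Foliations and NCI systems\<close>

text \<open>
  A foliation is given by its set of leaves: near every point there are local coordinates \<open>\<psi>\<close> in
  which the connected components of the traces of the leaves are slices parallel to an
  \<open>r\<close>-dimensional subspace. Leaves are connected as immersed manifolds, which for such a
  decomposition amounts to path connectedness in the topology of the ambient manifold.
  (Connectedness in that topology would be too weak: a union of two dense leaves has it.)
\<close>
definition foliation ::
  "('m::topological_space, 'e::euclidean_space) chart set \<Rightarrow> nat \<Rightarrow> 'm set set \<Rightarrow> bool" where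
  "foliation A r F \<longleftrightarrow>
     \<Union> F = UNIV \<and> disjoint F \<and> (\<forall>L\<in>F. L \<noteq> {} \<and> path_connected L) \<and>
     (\<forall>p. \<exists>U \<psi> V. smooth_chart A (U, \<psi>) \<and> p \<in> U \<and> subspace V \<and> dim V = r \<and>
        (\<forall>L\<in>F. \<forall>C\<in>components (U \<inter> L). \<exists>c. C = {q \<in> U. \<psi> q - c \<in> V}))"

definition foliation_tangent ::
  "('m::topological_space, 'e::euclidean_space) chart set \<Rightarrow> 'm set set \<Rightarrow> 'm \<Rightarrow> 'm tvec set" where
  "foliation_tangent A F p = {v. \<exists>L\<in>F. p \<in> L \<and> v \<in> tangent_in A L p}"

text \<open>
  First integrals on \<open>U\<close>: constant on the leaves of the foliation restricted to \<open>U\<close>. A leaf may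
  meet \<open>U\<close> in many components, on which the values are allowed to differ.
\<close>
definition first_integral ::
  "('m::topological_space, 'e::euclidean_space) chart set \<Rightarrow> 'm set set \<Rightarrow> 'm set \<Rightarrow>
   ('m \<Rightarrow> real) \<Rightarrow> bool" where
  "first_integral A F U f \<longleftrightarrow> smooth_fun_on A U f \<and>
     (\<forall>L\<in>F. \<forall>C\<in>components (U \<inter> L). f constant_on C)"

definition abstract_nci ::
  "nat \<Rightarrow> ('m::topological_space, 'e::euclidean_space) chart set \<Rightarrow> 'm bivec \<Rightarrow> 'm set set \<Rightarrow> bool" where
  "abstract_nci r A P F \<longleftrightarrow> foliation A r F \<and>
     (\<forall>m. \<exists>U f. open U \<and> m \<in> U \<and> (\<forall>i<r. first_integral A F U (f i)) \<and>
        (\<forall>p\<in>U. foliation_tangent A F p = {lin_comb r c (\<lambda>i. hamiltonian A P (f i) p) | c. True}))"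

definition nci_system ::
  "nat \<Rightarrow> ('m::{t2_space,second_countable_topology}, 'e::euclidean_space) chart set \<Rightarrow> 'm bivec \<Rightarrow>
   ('n::{t2_space,second_countable_topology}, 'd::euclidean_space) chart set \<Rightarrow> 'n bivec \<Rightarrow>
   ('m \<Rightarrow> 'n) \<Rightarrow> 'm set set \<Rightarrow> bool" where
  "nci_system r A P B \<pi> \<phi> F \<longleftrightarrow>
     smooth_atlas A \<and> poisson A P \<and> smooth_atlas B \<and> poisson B \<pi> \<and>
     abstract_nci r A P F \<and>
     surj \<phi> \<and> submersion A B \<phi> \<and> F = range (\<lambda>b. \<phi> -` {b}) \<and>
     poisson_map A P B \<pi> \<phi>"

section \<open>The action bundle and action vector fields\<close>

definition action_ker ::
  "('n::topological_space, 'd::euclidean_space) chart set \<Rightarrow> 'n bivec \<Rightarrow> 'n \<Rightarrow> 'n covec set" where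
  "action_ker B \<pi> b = {\<xi> \<in> cotangent_space B b. sharp B \<pi> b \<xi> = (\<lambda>_. 0)}"

text \<open>
  The condition \<open>P\<^sup>\<sharp>(\<phi>\<^sup>*\<xi>) = 0\<close> is imposed at all points of the fibre over \<open>b\<close>, so that no point has to be
  chosen; for an NCI system it holds at all of these points as soon as it holds at one.
\<close>
definition action_null ::
  "('m::topological_space, 'e::euclidean_space) chart set \<Rightarrow> 'm bivec \<Rightarrow>
   ('n::topological_space, 'd::euclidean_space) chart set \<Rightarrow> ('m \<Rightarrow> 'n) \<Rightarrow> 'n \<Rightarrow> 'n covec set" where
  "action_null A P B \<phi> b = {\<xi> \<in> cotangent_space B b.
     \<forall>m\<in>\<phi> -` {b}. sharp A P m (pullback A B \<phi> m \<xi>) = (\<lambda>_. 0)}"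

definition action_rel ::
  "('m::topological_space, 'e::euclidean_space) chart set \<Rightarrow> 'm bivec \<Rightarrow>
   ('n::topological_space, 'd::euclidean_space) chart set \<Rightarrow> 'n bivec \<Rightarrow> ('m \<Rightarrow> 'n) \<Rightarrow> 'n \<Rightarrow>
   ('n covec \<times> 'n covec) set" where
  "action_rel A P B \<pi> \<phi> b = {(\<xi>, \<eta>). \<xi> \<in> action_ker B \<pi> b \<and> \<eta> \<in> action_ker B \<pi> b \<and>
     (\<lambda>v. \<eta> v - \<xi> v) \<in> action_null A P B \<phi> b}"

text \<open>The fibre \<open>E\<^sub>b\<close>; its elements are cosets, with \<open>action_zero\<close> and \<open>action_comb\<close> as linear structure.\<close>
definition action_fiber ::
  "('m::topological_space, 'e::euclidean_space) chart set \<Rightarrow> 'm bivec \<Rightarrow>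
   ('n::topological_space, 'd::euclidean_space) chart set \<Rightarrow> 'n bivec \<Rightarrow> ('m \<Rightarrow> 'n) \<Rightarrow> 'n \<Rightarrow>
   'n covec set set" where
  "action_fiber A P B \<pi> \<phi> b = action_ker B \<pi> b // action_rel A P B \<pi> \<phi> b"

definition action_zero ::
  "('m::topological_space, 'e::euclidean_space) chart set \<Rightarrow> 'm bivec \<Rightarrow>
   ('n::topological_space, 'd::euclidean_space) chart set \<Rightarrow> 'n bivec \<Rightarrow> ('m \<Rightarrow> 'n) \<Rightarrow> 'n \<Rightarrow>
   'n covec set" where
  "action_zero A P B \<pi> \<phi> b = action_rel A P B \<pi> \<phi> b `` {\<lambda>_. 0}"

definition action_comb ::
  "('m::topological_space, 'e::euclidean_space) chart set \<Rightarrow> 'm bivec \<Rightarrow>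
   ('n::topological_space, 'd::euclidean_space) chart set \<Rightarrow> 'n bivec \<Rightarrow> ('m \<Rightarrow> 'n) \<Rightarrow> 'n \<Rightarrow>
   nat \<Rightarrow> (nat \<Rightarrow> real) \<Rightarrow> (nat \<Rightarrow> 'n covec set) \<Rightarrow> 'n covec set" where
  "action_comb A P B \<pi> \<phi> b k c \<alpha> =
     action_rel A P B \<pi> \<phi> b `` {lin_comb k c \<xi> | \<xi>. \<forall>i<k. \<xi> i \<in> \<alpha> i}"

text \<open>Bases \<open>v 0, \<dots>, v (k-1)\<close> of a vector space \<open>S\<close> with zero \<open>z\<close> and linear combinations \<open>comb k c v\<close>.\<close>
definition is_basis ::
  "'v set \<Rightarrow> 'v \<Rightarrow> (nat \<Rightarrow> (nat \<Rightarrow> real) \<Rightarrow> (nat \<Rightarrow> 'v) \<Rightarrow> 'v) \<Rightarrow> nat \<Rightarrow> (nat \<Rightarrow> 'v) \<Rightarrow> bool" where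
  "is_basis S z comb k v \<longleftrightarrow> (\<forall>i<k. v i \<in> S) \<and>
     (\<forall>c. comb k c v = z \<longrightarrow> (\<forall>i<k. c i = 0)) \<and>
     (\<forall>x\<in>S. \<exists>c. x = comb k c v)"

text \<open>\<open>X\<^sub>\<alpha>\<close>; the value on the fibre over \<open>b\<close> does not depend on the representative of \<open>\<alpha>\<close>.\<close>
definition action_field ::
  "('m::topological_space, 'e::euclidean_space) chart set \<Rightarrow> 'm bivec \<Rightarrow>
   ('n::topological_space, 'd::euclidean_space) chart set \<Rightarrow> ('m \<Rightarrow> 'n) \<Rightarrow> 'n covec set \<Rightarrow>
   'm \<Rightarrow> 'm tvec" where
  "action_field A P B \<phi> \<alpha> m = sharp A P m (pullback A B \<phi> m (SOME \<xi>. \<xi> \<in> \<alpha>))"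

section \<open>Vector fields on embedded submanifolds\<close>

text \<open>
  For an embedded submanifold \<open>N\<close>, a function on \<open>N\<close> is smooth iff it extends locally to smooth
  functions on the ambient manifold, and a vector tangent to \<open>N\<close> acts on it through any such extension.
\<close>
definition extends_at ::
  "('m::topological_space, 'e::euclidean_space) chart set \<Rightarrow> 'm set \<Rightarrow> 'm \<Rightarrow>
   ('m \<Rightarrow> real) \<Rightarrow> ('m \<Rightarrow> real) \<Rightarrow> bool" where
  "extends_at A N p f g \<longleftrightarrow> smooth_at A p g \<and> (\<exists>U. open U \<and> p \<in> U \<and> (\<forall>q\<in>U \<inter> N. g q = f q))"

definition smooth_on_submanifold ::
  "('m::topological_space, 'e::euclidean_space) chart set \<Rightarrow> 'm set \<Rightarrow> ('m \<Rightarrow> real) \<Rightarrow> bool" where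
  "smooth_on_submanifold A N f \<longleftrightarrow> (\<forall>p\<in>N. \<exists>g. extends_at A N p f g)"

definition field_apply ::
  "('m::topological_space, 'e::euclidean_space) chart set \<Rightarrow> 'm set \<Rightarrow> ('m \<Rightarrow> 'm tvec) \<Rightarrow>
   ('m \<Rightarrow> real) \<Rightarrow> 'm \<Rightarrow> real" where
  "field_apply A N X f = (\<lambda>p. X p (SOME g. extends_at A N p f g))"

definition vector_field_on ::
  "('m::topological_space, 'e::euclidean_space) chart set \<Rightarrow> 'm set \<Rightarrow> ('m \<Rightarrow> 'm tvec) \<Rightarrow> bool" where
  "vector_field_on A N X \<longleftrightarrow> (\<forall>p\<in>N. X p \<in> tangent_in A N p) \<and>
     (\<forall>f. smooth_on_submanifold A N f \<longrightarrow> smooth_on_submanifold A N (field_apply A N X f))"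

definition lie_bracket ::
  "('m::topological_space, 'e::euclidean_space) chart set \<Rightarrow> 'm set \<Rightarrow> ('m \<Rightarrow> 'm tvec) \<Rightarrow>
   ('m \<Rightarrow> 'm tvec) \<Rightarrow> ('m \<Rightarrow> real) \<Rightarrow> 'm \<Rightarrow> real" where
  "lie_bracket A N X Y f = (\<lambda>p. field_apply A N X (field_apply A N Y f) p
                              - field_apply A N Y (field_apply A N X f) p)"

definition commuting_fields ::
  "('m::topological_space, 'e::euclidean_space) chart set \<Rightarrow> 'm set \<Rightarrow> ('m \<Rightarrow> 'm tvec) \<Rightarrow>
   ('m \<Rightarrow> 'm tvec) \<Rightarrow> bool" where
  "commuting_fields A N X Y \<longleftrightarrow> vector_field_on A N X \<and> vector_field_on A N Y \<and>
     (\<forall>f. smooth_on_submanifold A N f \<longrightarrow> (\<forall>p\<in>N. lie_bracket A N X Y f p = 0))"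

end

theory Submission
  imports Defs
begin

text \<open>
  Write \<open>N\<close> for the fibre of \<open>\<phi>\<close> over \<open>b\<close>. A covector \<open>\<xi>\<close> in \<open>Ker \<pi>\<^sup>\<sharp>\<close> at \<open>b\<close> defines the vector field
  \<open>X\<^sub>\<xi> = P\<^sup>\<sharp>(\<phi>\<^sup>*\<xi>)\<close> along \<open>N\<close>. The proof rests on three facts.

  First, \<open>T\<^sub>pN\<close>, the tangent space of the leaf through \<open>p\<close>, is the whole kernel of the differential of
  \<open>\<phi>\<close> (\<open>tangent_in_fibre_iff_kernel\<close>). This is where \<open>\<phi>\<close> has to be a submersion: the inverse function
  theorem gives a curve in \<open>N\<close> in every direction of the kernel, and in a foliated chart a curve in \<open>N\<close>
  cannot leave its slice. Consequently \<open>X\<^sub>\<xi>\<close> is tangent to \<open>N\<close>, because \<open>d\<phi>(X\<^sub>\<xi>) = \<pi>\<^sup>\<sharp>\<xi> = 0\<close>, and the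
  covectors annihilating \<open>T\<^sub>pN\<close> are the pullbacks \<open>\<phi>\<^sup>*\<zeta>\<close>. The differentials of the local first
  integrals \<open>f\<^sub>1, \<dots>, f\<^sub>r\<close> annihilate \<open>T\<^sub>pN\<close>, so that the vectors \<open>X\<^bsub>f\<^sub>i\<^esub>(p)\<close>, which span \<open>T\<^sub>pN\<close>, are all of
  the form \<open>X\<^sub>\<xi>(p)\<close>: the map \<open>\<xi> \<mapsto> X\<^sub>\<xi>(p)\<close> is onto \<open>T\<^sub>pN\<close> (\<open>covector_field_surj\<close>).

  Second, near \<open>p\<close> one has \<open>X\<^sub>\<xi> = \<Sum> c\<^sub>i X\<^bsub>f\<^sub>i\<^esub>\<close> along the slice through \<open>p\<close>, with constant \<open>c\<^sub>i\<close>
  (\<open>covector_field_constant_coefficients\<close>). Choose \<open>h\<close> with \<open>dh = \<xi>\<close> at \<open>b\<close> and \<open>c\<close> such that the identity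
  holds at \<open>p\<close>, and put \<open>u = h \<circ> \<phi> + \<Sum> c\<^sub>i f\<^sub>i\<close>. Then \<open>{u, f\<^sub>j} = 0\<close> near \<open>p\<close>, and by the Jacobi identity the
  brackets of \<open>u\<close> with the coordinates solve a homogeneous linear system along the slice; they vanish
  at \<open>p\<close>, hence on the slice near \<open>p\<close> (\<open>propagate_zero\<close>, \<open>vanish_along_subspace\<close>).

  Third, if \<open>X\<^sub>\<xi>\<close> vanishes at one point of \<open>N\<close>, it vanishes on \<open>N\<close>: by the second fact its zero set,
  which is closed, is open in \<open>N\<close>, and \<open>N\<close> is path connected (\<open>covector_field_zero_on_fibre\<close>). Therefore an element of \<open>E\<^sub>b\<close>
  is determined by the value of its action field at any single point, \<open>\<alpha> \<mapsto> X\<^sub>\<alpha>(m)\<close> is an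
  isomorphism from \<open>E\<^sub>b\<close> onto \<open>T\<^sub>mN\<close>, and \<open>X\<^sub>\<alpha>\<close> has no zero unless \<open>\<alpha> = 0\<close>. Commutation is now local: by
  the second fact the commutator of two action fields is a combination with constant coefficients of
  the commutators of the \<open>X\<^bsub>f\<^sub>i\<^esub>\<close>, which vanish because \<open>{f\<^sub>i, f\<^sub>j} = 0\<close>.
\<close>

section \<open>Smooth maps between normed spaces\<close>

lemma Ck_on_cong:
  assumes "open S" "\<And>x. x \<in> S \<Longrightarrow> f x = g x" "Ck_on k f S"
  shows "Ck_on k g S"
  using assms
proof (induction k arbitrary: f g)
  case 0
  then show ?case by (auto cong: continuous_on_cong)
next
  case (Suc k)
  have dg: "g differentiable (at x)" if "x \<in> S" for x
    using Suc.prems that unfolding Ck_on.simps differentiable_def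
    by (meson has_derivative_transform_within_open)
  have "frechet_derivative f (at x) v = frechet_derivative g (at x) v" if "x \<in> S" for x v
    using Suc.prems that by (simp add: frechet_derivative_transform_within_open[of f x S g])
  moreover have "Ck_on k (\<lambda>x. frechet_derivative f (at x) v) S" for v
    using Suc.prems by auto
  ultimately have "Ck_on k (\<lambda>x. frechet_derivative g (at x) v) S" for v
    by (rule Suc.IH[OF Suc.prems(1)])
  then show ?case using dg by simp
qed

lemma Ck_on_subset: "Ck_on k f S \<Longrightarrow> T \<subseteq> S \<Longrightarrow> Ck_on k f T"
  by (induction k arbitrary: f) (auto intro: continuous_on_subset)

lemma Ck_on_locally:
  assumes "\<And>x. x \<in> S \<Longrightarrow> \<exists>T. open T \<and> x \<in> T \<and> Ck_on k f T"
  shows "Ck_on k f S"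
  using assms
proof (induction k arbitrary: f)
  case 0
  then show ?case
    by (metis Ck_on.simps(1) continuous_at_imp_continuous_on continuous_on_eq_continuous_at)
next
  case (Suc k)
  have "\<exists>T. open T \<and> x \<in> T \<and> Ck_on k (\<lambda>x. frechet_derivative f (at x) v) T" if "x \<in> S" for x v
    using Suc.prems[OF that] by auto
  moreover have "f differentiable (at x)" if "x \<in> S" for x
    using Suc.prems[OF that] by auto
  ultimately show ?case using Suc.IH by auto
qed

lemma Ck_on_Suc_imp: "Ck_on (Suc k) f S \<Longrightarrow> Ck_on k f S"
proof (induction k arbitrary: f)
  case 0
  then show ?case
    by (auto intro!: continuous_at_imp_continuous_on differentiable_imp_continuous_within)
next
  case (Suc k)
  then show ?case by (auto simp del: Ck_on.simps simp add: Ck_on.simps(2)[of _ _ S])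
qed

lemma Ck_on_const: "Ck_on k (\<lambda>x. c) S"
  by (induction k arbitrary: c) auto

lemma Ck_on_add:
  assumes "open S" "Ck_on k f S" "Ck_on k g S"
  shows "Ck_on k (\<lambda>x. f x + g x) S"
  using assms(2,3)
proof (induction k arbitrary: f g)
  case 0
  then show ?case by (simp add: continuous_on_add continuous_on_scaleR)
next
  case (Suc k)
  have D: "((\<lambda>x. f x + g x) has_derivative
      (\<lambda>v. frechet_derivative f (at x) v + frechet_derivative g (at x) v)) (at x)" if "x \<in> S" for x
    using Suc.prems that by (auto intro!: has_derivative_add simp: frechet_derivative_works[symmetric])
  have df: "Ck_on k (\<lambda>x. frechet_derivative f (at x) v) S"
    and dg: "Ck_on k (\<lambda>x. frechet_derivative g (at x) v) S" for v
    using Suc.prems by auto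
  have "Ck_on k (\<lambda>x. frechet_derivative (\<lambda>x. f x + g x) (at x) v) S" for v
    by (rule Ck_on_cong[OF assms(1) _ Suc.IH[OF df[of v] dg[of v]]])
       (simp add: frechet_derivative_at[OF D, symmetric])
  then show ?case using D by (auto simp: differentiable_def)
qed

lemma Ck_on_bounded_linear:
  assumes "open S" "bounded_linear L" "Ck_on k f S"
  shows "Ck_on k (\<lambda>x. L (f x)) S"
  using assms(3)
proof (induction k arbitrary: f)
  case 0
  then show ?case using assms(2) by (auto intro: bounded_linear.continuous_on)
next
  case (Suc k)
  have D: "((\<lambda>x. L (f x)) has_derivative (\<lambda>v. L (frechet_derivative f (at x) v))) (at x)"
    if "x \<in> S" for x
    using Suc.prems that
    by (intro bounded_linear.has_derivative[OF assms(2)]) (simp add: frechet_derivative_works[symmetric])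
  have df: "Ck_on k (\<lambda>x. frechet_derivative f (at x) v) S" for v
    using Suc.prems by auto
  have "Ck_on k (\<lambda>x. frechet_derivative (\<lambda>x. L (f x)) (at x) v) S" for v
    by (rule Ck_on_cong[OF assms(1) _ Suc.IH[OF df[of v]]])
       (simp add: frechet_derivative_at[OF D, symmetric])
  then show ?case using D by (auto simp: differentiable_def)
qed

lemma Ck_on_scaleR:
  assumes "open S" "Ck_on k a S" "Ck_on k f S"
  shows "Ck_on k (\<lambda>x. a x *\<^sub>R f x) S"
  using assms(2,3)
proof (induction k arbitrary: a f)
  case 0
  then show ?case by (simp add: continuous_on_add continuous_on_scaleR)
next
  case (Suc k)
  have D: "((\<lambda>x. a x *\<^sub>R f x) has_derivative
      (\<lambda>v. a x *\<^sub>R frechet_derivative f (at x) v + frechet_derivative a (at x) v *\<^sub>R f x)) (at x)"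
    if "x \<in> S" for x
    using Suc.prems that by (auto intro!: has_derivative_scaleR simp: frechet_derivative_works[symmetric])
  have df: "Ck_on k (\<lambda>x. frechet_derivative f (at x) v) S" and da: "Ck_on k (\<lambda>x. frechet_derivative a (at x) v) S"
    and a: "Ck_on k a S" and f: "Ck_on k f S" for v
    using Suc.prems Suc.prems[THEN Ck_on_Suc_imp] by auto
  have "Ck_on k (\<lambda>x. frechet_derivative (\<lambda>x. a x *\<^sub>R f x) (at x) v) S" for v
    by (rule Ck_on_cong[OF assms(1) _ Ck_on_add[OF assms(1) Suc.IH[OF a df[of v]] Suc.IH[OF da[of v] f]]])
       (simp add: frechet_derivative_at[OF D, symmetric])
  then show ?case using D by (auto simp: differentiable_def)
qed

lemma Ck_on_sum:
  assumes "open S" "\<And>i. i \<in> I \<Longrightarrow> Ck_on k (f i) S"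
  shows "Ck_on k (\<lambda>x. \<Sum>i\<in>I. f i x) S"
  using assms(2)
  by (induction I rule: infinite_finite_induct) (auto intro: Ck_on_const Ck_on_add[OF assms(1)])

text \<open>
  The chain rule has to be expanded over a basis of the middle space, since \<open>Ck_on\<close> speaks of the
  derivatives in fixed directions only.
\<close>
lemma Ck_on_compose:
  fixes f :: "'a::real_normed_vector \<Rightarrow> 'b::euclidean_space" and g :: "'b \<Rightarrow> 'c::real_normed_vector"
  assumes "open S" "Ck_on k f S" "Ck_on k g T" "f ` S \<subseteq> T"
  shows "Ck_on k (g \<circ> f) S"
  using assms(2,3)
proof (induction k arbitrary: g)
  case 0
  then show ?case using assms(4) by (simp add: continuous_on_compose2 o_def)
next
  case (Suc k)
  have f: "f differentiable (at x)" and g: "g differentiable (at (f x))" if "x \<in> S" for x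
    using Suc.prems assms(4) that by auto
  have D: "((g \<circ> f) has_derivative
      (\<lambda>v. frechet_derivative g (at (f x)) (frechet_derivative f (at x) v))) (at x)"
    if "x \<in> S" for x
    using diff_chain_at[of f _ x g] f[OF that] g[OF that]
    by (simp add: frechet_derivative_works o_def)
  let ?h = "\<lambda>v x. \<Sum>i\<in>Basis. (frechet_derivative f (at x) v \<bullet> i) *\<^sub>R
              ((\<lambda>y. frechet_derivative g (at y) i) \<circ> f) x"
  have eq: "?h v x = frechet_derivative (g \<circ> f) (at x) v" if "x \<in> S" for x v
  proof -
    interpret linear "frechet_derivative g (at (f x))"
      using g[OF that] by (rule linear_frechet_derivative)
    have "frechet_derivative (g \<circ> f) (at x) v = frechet_derivative g (at (f x))
       (\<Sum>i\<in>Basis. (frechet_derivative f (at x) v \<bullet> i) *\<^sub>R i)"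
      by (simp only: frechet_derivative_at[OF D[OF that], symmetric] euclidean_representation)
    then show ?thesis by (simp add: sum scale)
  qed
  have df: "Ck_on k (\<lambda>x. frechet_derivative f (at x) v) S" 
    and dg: "Ck_on k (\<lambda>y. frechet_derivative g (at y) w) T" and f: "Ck_on k f S" for v w
    using Suc.prems Suc.prems(1)[THEN Ck_on_Suc_imp] by auto
  have "Ck_on k (\<lambda>x. frechet_derivative f (at x) v \<bullet> i) S" for v i
    by (rule Ck_on_bounded_linear[OF assms(1) bounded_linear_inner_left df])
  then have "Ck_on k (?h v) S" for v
    by (intro Ck_on_sum[OF assms(1)] Ck_on_scaleR[OF assms(1)] Suc.IH[OF f dg])
  then have "Ck_on k (\<lambda>x. frechet_derivative (g \<circ> f) (at x) v) S" for v
    by (rule Ck_on_cong[OF assms(1), rotated]) (rule eq)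
  then show ?case using D unfolding Ck_on.simps differentiable_def by blast
qed

lemma smooth_on_cong: "open S \<Longrightarrow> (\<And>x. x \<in> S \<Longrightarrow> f x = g x) \<Longrightarrow> smooth_on f S \<Longrightarrow> smooth_on g S"
  unfolding smooth_on_def using Ck_on_cong[of S f g] by blast

lemma smooth_on_subset: "smooth_on f S \<Longrightarrow> T \<subseteq> S \<Longrightarrow> smooth_on f T"
  unfolding smooth_on_def by (auto intro: Ck_on_subset)

lemma smooth_on_locally:
  assumes "\<And>x. x \<in> S \<Longrightarrow> \<exists>T. open T \<and> x \<in> T \<and> smooth_on f T"
  shows "smooth_on f S"
  unfolding smooth_on_def
proof
  fix k show "Ck_on k f S"
    by (rule Ck_on_locally) (use assms in \<open>auto simp: smooth_on_def\<close>)
qed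

lemma smooth_on_const: "smooth_on (\<lambda>x. c) S"
  by (simp add: smooth_on_def Ck_on_const)

lemma smooth_on_add: "open S \<Longrightarrow> smooth_on f S \<Longrightarrow> smooth_on g S \<Longrightarrow> smooth_on (\<lambda>x. f x + g x) S"
  by (simp add: smooth_on_def Ck_on_add)

lemma smooth_on_bounded_linear:
  "open S \<Longrightarrow> bounded_linear L \<Longrightarrow> smooth_on f S \<Longrightarrow> smooth_on (\<lambda>x. L (f x)) S"
  by (simp add: smooth_on_def Ck_on_bounded_linear)

lemma smooth_on_sum:
  "open S \<Longrightarrow> (\<And>i. i \<in> I \<Longrightarrow> smooth_on (f i) S) \<Longrightarrow> smooth_on (\<lambda>x. \<Sum>i\<in>I. f i x) S"
  by (simp add: smooth_on_def Ck_on_sum)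

lemma smooth_on_compose:
  fixes f :: "'a::real_normed_vector \<Rightarrow> 'b::euclidean_space" and g :: "'b \<Rightarrow> 'c::real_normed_vector"
  shows "open S \<Longrightarrow> smooth_on f S \<Longrightarrow> smooth_on g T \<Longrightarrow> f ` S \<subseteq> T \<Longrightarrow> smooth_on (g \<circ> f) S"
  unfolding smooth_on_def using Ck_on_compose by blast

lemma smooth_on_imp_differentiable: "smooth_on f S \<Longrightarrow> x \<in> S \<Longrightarrow> f differentiable (at x)"
  unfolding smooth_on_def by (metis Ck_on.simps(2))

lemma smooth_on_derivative: "smooth_on f S \<Longrightarrow> smooth_on (\<lambda>x. frechet_derivative f (at x) v) S"
  unfolding smooth_on_def by (metis Ck_on.simps(2))

lemma smooth_on_imp_continuous_on: "smooth_on f S \<Longrightarrow> continuous_on S f"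
  unfolding smooth_on_def by (metis Ck_on.simps(1))

lemma smooth_on_id: "open S \<Longrightarrow> smooth_on (\<lambda>x. x) S"
  unfolding smooth_on_def
proof
  fix k :: nat assume "open S"
  then show "Ck_on k (\<lambda>x. x) S"
    by (cases k) (auto intro: continuous_intros Ck_on_const simp: frechet_derivative_ident)
qed

section \<open>Calculus in Euclidean spaces\<close>

lemma derivative_in_subspace:
  fixes \<gamma> :: "real \<Rightarrow> 'a::euclidean_space"
  assumes "subspace V" "(\<gamma> has_vector_derivative w) (at 0)" "d > 0"
    and V: "\<And>t. t \<in> {-d<..<d} \<Longrightarrow> \<gamma> t - \<gamma> 0 \<in> V"
  shows "w \<in> V"
proof -
  \<comment> \<open>\<open>V\<close> is its double orthogonal complement.\<close>
  have "y \<bullet> w = 0" if y: "y \<in> orthogonal_comp V" for y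
  proof -
    have eq: "y \<bullet> \<gamma> t = y \<bullet> \<gamma> 0" if "t \<in> {-d<..<d}" for t
    proof -
      have "y \<bullet> (\<gamma> t - \<gamma> 0) = 0"
        using y V[OF that] by (auto simp: orthogonal_comp_def orthogonal_def inner_commute)
      then show ?thesis by (simp only: inner_diff_right right_minus_eq)
    qed
    have "((\<lambda>t. y \<bullet> \<gamma> t) has_derivative (\<lambda>h. y \<bullet> (h *\<^sub>R w))) (at 0)"
      using assms(2) unfolding has_vector_derivative_def by (rule has_derivative_inner_right)
    moreover have "((\<lambda>t. y \<bullet> \<gamma> t) has_derivative (\<lambda>h. 0)) (at 0)"
      by (rule has_derivative_transform_within_open[of "\<lambda>_. y \<bullet> \<gamma> 0" _ _ _ "{-d<..<d}"])
        (use assms(3) in \<open>auto intro!: eq[symmetric]\<close>)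
    ultimately have "(\<lambda>h. y \<bullet> (h *\<^sub>R w)) = (\<lambda>h. 0)" by (rule has_derivative_unique)
    then show ?thesis by (metis scaleR_one)
  qed
  then have "w \<in> orthogonal_comp (orthogonal_comp V)"
    by (simp add: orthogonal_comp_def orthogonal_def)
  then show ?thesis by (simp add: orthogonal_comp_self[OF assms(1)])
qed

lemma isCont_eventually_in:
  assumes "isCont f x" "open S" "f x \<in> S"
  shows "\<forall>\<^sub>F t in nhds x. f t \<in> S"
  using assms topological_tendstoD unfolding isCont_def tendsto_at_iff_tendsto_nhds by blast

text \<open>
  A smooth map that is a submersion at \<open>x0\<close> equals its linear part \<open>D\<close> after a local change of
  coordinates with derivative the identity at \<open>x0\<close>. The coordinate change is \<open>x + R (f x - D x)\<close>,
  where \<open>R\<close> is a right inverse of \<open>D\<close>; its inverse maps the line through \<open>x0\<close> in a direction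
  \<open>w \<in> ker D\<close> to a curve in the fibre.
\<close>
lemma curve_in_fibre_of_submersion:
  fixes f :: "'a::euclidean_space \<Rightarrow> 'b::euclidean_space"
  assumes "open S" "x0 \<in> S" "smooth_on f S"
    and surj: "surj (frechet_derivative f (at x0))"
    and ker: "frechet_derivative f (at x0) w = 0"
  obtains d \<gamma> where "d > 0" "\<gamma> 0 = x0" "continuous_on {-d<..<d} \<gamma>" "(\<gamma> has_vector_derivative w) (at 0)"
    "\<And>t. t \<in> {-d<..<d} \<Longrightarrow> \<gamma> t \<in> S \<and> f (\<gamma> t) = f x0"
proof -
  define D where "D = frechet_derivative f (at x0)"
  have linD: "linear D"
    unfolding D_def by (intro linear_frechet_derivative smooth_on_imp_differentiable[OF assms(3,2)])
  obtain R where R: "linear R" "D \<circ> R = id"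
    using linear_surjective_right_inverse[OF linD] surj D_def by auto
  define G where "G x = x + R (f x - D x)" for x
  \<comment> \<open>In the coordinates \<open>G\<close> the map \<open>f\<close> is linear.\<close>
  have DG: "D (G x) = f x" for x
    using R(2) linD by (simp add: G_def linear_add linear_diff fun_eq_iff)
  define G' where "G' x v = v + R (frechet_derivative f (at x) v - D v)" for x v
  have bl: "bounded_linear D" "bounded_linear R"
    using linD R by (auto simp: linear_conv_bounded_linear)
  have der: "(G has_derivative G' x) (at x)" if "x \<in> S" for x
    unfolding G_def G'_def using smooth_on_imp_differentiable[OF assms(3) that]
    by (auto intro!: derivative_eq_intros bounded_linear.has_derivative[OF bl(1)]
          bounded_linear.has_derivative[OF bl(2)] simp: frechet_derivative_works)
  have blG: "bounded_linear (G' x)" if "x \<in> S" for x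
    using der[OF that] by (rule has_derivative_bounded_linear)
  have cont: "continuous_on S (\<lambda>x. Blinfun (G' x))"
  proof (rule continuous_on_blinfun_componentwise)
    fix i :: 'a assume "i \<in> Basis"
    have "continuous_on S (\<lambda>x. G' x i)"
      unfolding G'_def
      by (intro continuous_intros bounded_linear.continuous_on[OF bl(2)]
          smooth_on_imp_continuous_on[OF smooth_on_derivative[OF assms(3)]])
    then show "continuous_on S (\<lambda>x. blinfun_apply (Blinfun (G' x)) i)"
      by (rule continuous_on_eq) (simp add: bounded_linear_Blinfun_apply blG)
  qed
  have G'0: "G' x0 = (\<lambda>v. v)"
    by (simp add: fun_eq_iff G'_def D_def[symmetric] linear_0[OF R(1)])
  have inv: "id_blinfun o\<^sub>L Blinfun (G' x0) = id_blinfun"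
    by (rule blinfun_eqI) (simp add: bounded_linear_Blinfun_apply blG assms(2) G'0)
  obtain U V g g' where UV: "open U" "U \<subseteq> S" "x0 \<in> U" "open V" "G x0 \<in> V" "homeomorphism U V G g"
    "\<And>y. y \<in> V \<Longrightarrow> (g has_derivative g' y) (at y)"
    "\<And>y. y \<in> V \<Longrightarrow> g' y = Hilbert_Choice.inv (blinfun_apply (Blinfun (G' (g y))))"
    by (rule inverse_function_theorem[OF assms(1) _ cont assms(2) inv, of G])
       (use der blG in \<open>auto simp: bounded_linear_Blinfun_apply\<close>)
  have g0: "g (G x0) = x0" using UV by (simp add: homeomorphism_def)
  have "blinfun_apply (Blinfun (G' x0)) = (\<lambda>v. v)"
    using bounded_linear_Blinfun_apply[OF blG[OF assms(2)]] G'0 by simp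
  then have "g' (G x0) = (\<lambda>v. v)"
    using UV(8)[OF UV(5)] by (simp add: g0 inv_equality)
  then have dg: "(g has_derivative (\<lambda>v. v)) (at (G x0))" using UV(7)[OF UV(5)] by simp
  define l where "l t = G x0 + t *\<^sub>R w" for t
  have "open (l -` V)"
    unfolding l_def by (intro open_vimage UV continuous_intros)
  moreover have "0 \<in> l -` V" using UV by (simp add: l_def)
  ultimately obtain d where d: "d > 0" "ball 0 d \<subseteq> l -` V"
    by (meson openE)
  have d': "l t \<in> V" if "t \<in> {-d<..<d}" for t
    using d that by (auto simp: subset_iff dist_real_def)
  show ?thesis
  proof
    show "d > 0" by fact
    show "(g \<circ> l) 0 = x0" by (simp add: l_def g0)
    show "continuous_on {-d<..<d} (g \<circ> l)"
    proof (rule continuous_on_compose)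
      show "continuous_on {-d<..<d} l" unfolding l_def by (intro continuous_intros)
      show "continuous_on (l ` {-d<..<d}) g"
        using UV(6) d' by (auto simp: homeomorphism_def intro: continuous_on_subset)
    qed
    have "(l has_vector_derivative w) (at 0)"
      unfolding l_def by (auto intro!: derivative_eq_intros)
    then show "((g \<circ> l) has_vector_derivative w) (at 0)"
      using vector_derivative_diff_chain_within[of l w 0 UNIV g "\<lambda>v. v"] dg
      by (auto simp: l_def has_derivative_at_withinI)
    fix t assume t: "t \<in> {-d<..<d}"
    have "G (g (l t)) = l t" "g (l t) \<in> U"
      using d'[OF t] UV(6) by (auto simp: homeomorphism_def)
    moreover have "D (l t) = f x0"
      using ker by (simp add: l_def linear_add[OF linD] linear_scale[OF linD] DG D_def[symmetric])
    ultimately show "(g \<circ> l) t \<in> S \<and> f ((g \<circ> l) t) = f x0"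
      using UV(2) by (auto simp: DG[symmetric])
  qed
qed

text \<open>
  A homogeneous linear system of total differential equations along the directions of \<open>V\<close>, with
  zero initial value, has only the zero solution. The equations are given along fields \<open>Y j\<close>
  that span \<open>V\<close> at \<open>x0\<close> and hence, by continuity, near \<open>x0\<close>.
\<close>
lemma vanish_along_subspace:
  fixes u :: "'a::euclidean_space \<Rightarrow> 'b::real_normed_vector" and Y :: "nat \<Rightarrow> 'a \<Rightarrow> 'a"
  assumes "open S" "x0 \<in> S" "subspace V"
    and u: "\<And>x. x \<in> S \<Longrightarrow> (u has_derivative u' x) (at x)"
    and Y: "\<And>j. j < r \<Longrightarrow> continuous_on S (Y j)" "\<And>j x. j < r \<Longrightarrow> x \<in> S \<Longrightarrow> Y j x \<in> V"
    and span: "\<And>w. w \<in> V \<Longrightarrow> \<exists>c. w = (\<Sum>j<r. c j *\<^sub>R Y j x0)"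
    and bound: "\<And>j x. j < r \<Longrightarrow> x \<in> S \<Longrightarrow> norm (u' x (Y j x)) \<le> C j x * norm (u x)"
      "\<And>j. j < r \<Longrightarrow> continuous_on S (C j)"
    and u0: "u x0 = 0"
  obtains d where "d > 0" "ball x0 d \<subseteq> S" "\<And>x. x \<in> ball x0 d \<Longrightarrow> x - x0 \<in> V \<Longrightarrow> u x = 0"
proof -
  obtain E where E: "E \<subseteq> V" "pairwise orthogonal E" "\<And>e. e \<in> E \<Longrightarrow> norm e = 1"
      "independent E" "span E = V"
    using orthonormal_basis_subspace[OF assms(3)] by metis
  have finE: "finite E" using E(4) by (rule independent_imp_finite)
  have "\<forall>e\<in>E. \<exists>c. e = (\<Sum>j<r. c j *\<^sub>R Y j x0)" using span E(1) by blast
  then obtain R where R: "\<And>e. e \<in> E \<Longrightarrow> e = (\<Sum>j<r. R e j *\<^sub>R Y j x0)" by metis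
  \<comment> \<open>Combinations of the \<open>Y j\<close> that equal the basis vector \<open>e\<close> at \<open>x0\<close>; their deviation from \<open>e\<close> is \<open>\<epsilon>\<close>.\<close>
  define Z where "Z e x = (\<Sum>j<r. R e j *\<^sub>R Y j x)" for e x
  define k where "k e x = (\<Sum>j<r. \<bar>R e j\<bar> * C j x)" for e x
  define K where "K x = (\<Sum>e\<in>E. k e x)" for x
  define \<epsilon> where "\<epsilon> x = (\<Sum>e\<in>E. norm (e - Z e x))" for x
  define s where "s x = (\<Sum>e\<in>E. norm (u' x e))" for x
  have lin: "linear (u' x)" if "x \<in> S" for x using u[OF that] by (rule has_derivative_linear)
  have Zu: "norm (u' x (Z e x)) \<le> k e x * norm (u x)" if "x \<in> S" for e x
  proof -
    have "norm (u' x (Z e x)) = norm (\<Sum>j<r. R e j *\<^sub>R u' x (Y j x))"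
      unfolding Z_def by (simp add: linear_sum[OF lin[OF that]] linear_scale[OF lin[OF that]])
    also have "\<dots> \<le> (\<Sum>j<r. \<bar>R e j\<bar> * (C j x * norm (u x)))"
      by (intro sum_norm_le) (auto intro!: mult_left_mono bound that)
    finally show ?thesis by (simp add: k_def sum_distrib_right mult.assoc)
  qed
  have ZV: "Z e x \<in> V" if "x \<in> S" for e x
    unfolding Z_def using Y(2)[OF _ that] by (intro subspace_sum subspace_scale assms(3)) auto
  have dirV: "norm (u' x w) \<le> norm w * s x" if "x \<in> S" "w \<in> V" for x w
  proof -
    have "w = (\<Sum>e\<in>E. (w \<bullet> e) *\<^sub>R e)"
      using orthonormal_basis_expand[OF E(2,3) _ finE, of w] E(5) that(2) by simp
    then have "norm (u' x w) = norm (\<Sum>e\<in>E. (w \<bullet> e) *\<^sub>R u' x e)"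
      by (metis (no_types, lifting) linear_scale[OF lin[OF that(1)]] linear_sum[OF lin[OF that(1)]] sum.cong)
    also have "\<dots> \<le> (\<Sum>e\<in>E. norm w * norm (u' x e))"
    proof (intro sum_norm_le)
      fix e assume "e \<in> E"
      then show "norm ((w \<bullet> e) *\<^sub>R u' x e) \<le> norm w * norm (u' x e)"
        using Cauchy_Schwarz_ineq2[of w e] E(3) by (auto intro: mult_right_mono)
    qed
    finally show ?thesis by (simp add: s_def sum_distrib_left)
  qed
  have s_le: "s x \<le> K x * norm (u x) + \<epsilon> x * s x" if "x \<in> S" for x
  proof -
    have "norm (u' x e) \<le> k e x * norm (u x) + norm (e - Z e x) * s x" if "e \<in> E" for e
    proof -
      have "u' x e = u' x (Z e x) + u' x (e - Z e x)"
        using linear_add[OF lin[OF \<open>x \<in> S\<close>], of "Z e x" "e - Z e x"] by simp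
      then have "norm (u' x e) \<le> norm (u' x (Z e x)) + norm (u' x (e - Z e x))"
        by (simp add: norm_triangle_ineq)
      moreover have "e - Z e x \<in> V"
        using that E(1) ZV[OF \<open>x \<in> S\<close>] by (intro subspace_diff assms(3)) auto
      ultimately show ?thesis
        using Zu[OF \<open>x \<in> S\<close>, of e] dirV[OF \<open>x \<in> S\<close>, of "e - Z e x"] by linarith
    qed
    then have "s x \<le> (\<Sum>e\<in>E. k e x * norm (u x) + norm (e - Z e x) * s x)"
      unfolding s_def[of x] by (rule sum_mono)
    then show ?thesis by (simp add: K_def \<epsilon>_def sum.distrib sum_distrib_right)
  qed
  have contE: "continuous_on S \<epsilon>" and contK: "continuous_on S K"
    unfolding \<epsilon>_def K_def Z_def k_def using Y(1) bound(2) by (auto intro!: continuous_intros)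
  have "\<epsilon> x0 = 0" unfolding \<epsilon>_def Z_def using R by simp
  have tnd: "(f \<longlongrightarrow> f x0) (nhds x0)" if "continuous_on S f" for f :: "'a \<Rightarrow> real"
    using that assms(1,2) by (metis continuous_at continuous_on_eq_continuous_at tendsto_at_iff_tendsto_nhds)
  have "\<forall>\<^sub>F x in nhds x0. \<epsilon> x < 1/2" and "\<forall>\<^sub>F x in nhds x0. K x < \<bar>K x0\<bar> + 1"
    using order_tendstoD(2)[OF tnd[OF contE], of "1/2"] order_tendstoD(2)[OF tnd[OF contK], of "\<bar>K x0\<bar> + 1"]
    by (auto simp: \<open>\<epsilon> x0 = 0\<close>)
  moreover have "\<forall>\<^sub>F x in nhds x0. x \<in> S" using assms(1,2) by (rule eventually_nhds_in_open)
  ultimately have "\<forall>\<^sub>F x in nhds x0. \<epsilon> x < 1/2 \<and> K x < \<bar>K x0\<bar> + 1 \<and> x \<in> S"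
    by eventually_elim auto
  then obtain d1 where d1: "d1 > 0" "\<And>x. dist x x0 < d1 \<Longrightarrow> \<epsilon> x < 1/2 \<and> K x < \<bar>K x0\<bar> + 1 \<and> x \<in> S"
    unfolding eventually_nhds_metric by blast
  define L where "L = 2 * (\<bar>K x0\<bar> + 1)"
  have "L > 0" by (simp add: L_def)
  \<comment> \<open>As \<open>\<epsilon> x < 1/2\<close>, the term \<open>\<epsilon> x * s x\<close> can be absorbed into the left-hand side of \<open>s_le\<close>.\<close>
  have s_bound: "s x \<le> L * norm (u x)" if "dist x x0 < d1" for x
  proof -
    have "0 \<le> s x" by (simp add: s_def sum_nonneg)
    then have "\<epsilon> x * s x \<le> 1/2 * s x" using d1(2)[OF that] by (intro mult_right_mono) auto
    moreover have "K x * norm (u x) \<le> (\<bar>K x0\<bar> + 1) * norm (u x)"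
      using d1(2)[OF that] by (intro mult_right_mono) auto
    moreover have "L * norm (u x) = 2 * ((\<bar>K x0\<bar> + 1) * norm (u x))" by (simp add: L_def)
    moreover have "s x \<le> K x * norm (u x) + \<epsilon> x * s x" using s_le d1(2)[OF that] by blast
    ultimately show ?thesis by linarith
  qed
  define d where "d = min d1 (1 / (2 * L))"
  show ?thesis
  proof
    show "d > 0" using d1(1) \<open>L > 0\<close> by (simp add: d_def)
    show "ball x0 d \<subseteq> S" using d1(2) by (auto simp: d_def dist_commute)
    fix x assume x: "x \<in> ball x0 d" "x - x0 \<in> V"
    define w where "w = x - x0"
    define f where "f t = u (x0 + t *\<^sub>R w)" for t :: real
    have w: "norm w < d1" "norm w * L \<le> 1/2"
    proof -
      have "norm w < 1 / (2 * L)" "norm w < d1" using x(1) by (auto simp: w_def d_def dist_norm norm_minus_commute)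
      then show "norm w < d1" "norm w * L \<le> 1/2" using \<open>L > 0\<close> by (auto simp: field_simps)
    qed
    have near: "dist (x0 + t *\<^sub>R w) x0 < d1" if "t \<in> {0..1}" for t
      using that w(1) mult_left_le_one_le[of "norm w" t] by (auto simp: dist_norm)
    have f': "(f has_derivative (\<lambda>h. h *\<^sub>R u' (x0 + t *\<^sub>R w) w)) (at t within {0..1})" if "t \<in> {0..1}" for t
    proof -
      have S: "x0 + t *\<^sub>R w \<in> S" using near[OF that] d1(2) by blast
      have "((\<lambda>t. x0 + t *\<^sub>R w) has_derivative (\<lambda>h. h *\<^sub>R w)) (at t within {0..1})"
        by (auto intro!: derivative_eq_intros)
      from diff_chain_within[OF this has_derivative_at_withinI[OF u[OF S]]]
      show ?thesis by (simp add: f_def[abs_def] o_def linear_scale[OF lin[OF S]])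
    qed
    have "continuous_on {0..1} f"
      using has_derivative_continuous[OF f'] by (simp add: continuous_on_eq_continuous_within)
    then have "continuous_on {0..1} (\<lambda>t. norm (f t))" by (rule continuous_on_norm)
    \<comment> \<open>At a maximum of the norm the mean value inequality gives \<open>norm (f T) \<le> norm (f T) / 2\<close>.\<close>
    then obtain T where T: "T \<in> {0..1}" "\<And>t. t \<in> {0..1} \<Longrightarrow> norm (f t) \<le> norm (f T)"
      using continuous_attains_sup[of "{0..1::real}" "\<lambda>t. norm (f t)"] by auto
    have "norm (f T - f 0) \<le> (1/2 * norm (f T)) * norm (T - 0)"
    proof (rule differentiable_bound[of "{0..1}", OF _ f'])
      fix t :: real assume t: "t \<in> {0..1}"
      have S: "x0 + t *\<^sub>R w \<in> S" using near[OF t] d1(2) by blast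
      have "norm (u' (x0 + t *\<^sub>R w) w) \<le> norm w * s (x0 + t *\<^sub>R w)"
        using x(2) by (intro dirV S) (simp add: w_def)
      also have "\<dots> \<le> norm w * (L * norm (f t))"
        using s_bound[OF near[OF t]] by (intro mult_left_mono) (auto simp: f_def)
      also have "\<dots> = norm w * L * norm (f t)" by simp
      also have "\<dots> \<le> 1/2 * norm (f T)"
        using w(2) T(2)[OF t] by (intro mult_mono) auto
      finally have "norm (u' (x0 + t *\<^sub>R w) w) \<le> 1/2 * norm (f T)" .
      then show "onorm (\<lambda>h. h *\<^sub>R u' (x0 + t *\<^sub>R w) w) \<le> 1/2 * norm (f T)"
        by (intro onorm_le) (metis abs_ge_zero mult.commute mult_left_mono norm_scaleR real_norm_def)
    qed (use T in auto)
    also have "\<dots> \<le> 1/2 * norm (f T) * 1"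
      using T(1) by (intro mult_left_mono) auto
    finally have "norm (f T) \<le> 0" using u0 by (simp add: f_def)
    with T(2)[of 1] have "f 1 = 0" by simp
    then show "u x = 0" by (simp add: f_def w_def)
  qed
qed

section \<open>Tangent and cotangent vectors in a chart\<close>

text \<open>A manifold with its atlas.\<close>
locale smooth_manifold =
  fixes A :: "('m::topological_space, 'e::euclidean_space) chart set"
  assumes atlas: "smooth_atlas A"
begin

lemma smooth_chart_atlas: "c \<in> A \<Longrightarrow> smooth_chart A c"
  using atlas by (auto simp: smooth_atlas_def smooth_chart_def)

lemma obtain_chart:
  obtains U \<psi> where "(U, \<psi>) \<in> A" "p \<in> U"
proof -
  have "p \<in> \<Union> (fst ` A)" using atlas by (simp add: smooth_atlas_def)
  then show ?thesis using that by force
qed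

lemma smooth_fun_on_subset:
  assumes "smooth_fun_on A W f" "open W'" "W' \<subseteq> W"
  shows "smooth_fun_on A W' f"
  unfolding smooth_fun_on_def
proof (intro conjI ballI assms(2), clarify)
  fix U \<psi> assume "(U, \<psi>) \<in> A"
  then have "smooth_on (f \<circ> inv_into U \<psi>) (\<psi> ` (U \<inter> W))" using assms(1) by (auto simp: smooth_fun_on_def)
  then show "smooth_on (f \<circ> inv_into U \<psi>) (\<psi> ` (U \<inter> W'))"
    by (rule smooth_on_subset) (use assms(3) in auto)
qed

lemma smooth_fun_on_open: "smooth_fun_on A W f \<Longrightarrow> open W"
  by (simp add: smooth_fun_on_def)

lemma smooth_atI: "smooth_fun_on A W f \<Longrightarrow> p \<in> W \<Longrightarrow> smooth_at A p f"
  by (auto simp: smooth_at_def)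

end

text \<open>
  A chart of the maximal atlas. Such charts need not belong to \<open>A\<close>; the foliated charts of a foliation,
  in particular, do not.
\<close>
locale manifold_chart = smooth_manifold A
  for A :: "('m::topological_space, 'e::euclidean_space) chart set" +
  fixes U :: "'m set" and \<psi> :: "'m \<Rightarrow> 'e"
  assumes chart: "smooth_chart A (U, \<psi>)"
begin

abbreviation inv_chart where "inv_chart \<equiv> inv_into U \<psi>"

lemma open_domain: "open U" and open_range: "open (\<psi> ` U)"
  and chart_homeomorphism: "homeomorphism U (\<psi> ` U) \<psi> inv_chart"
  using chart by (auto simp: smooth_chart_def is_chart_def)

lemma inv_chart_chart [simp]: "q \<in> U \<Longrightarrow> inv_chart (\<psi> q) = q"
  using chart_homeomorphism by (simp add: homeomorphism_def)

lemma chart_inv_chart [simp]: "x \<in> \<psi> ` U \<Longrightarrow> \<psi> (inv_chart x) = x"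
  by (rule f_inv_into_f)

lemma inv_chart_in [simp]: "x \<in> \<psi> ` U \<Longrightarrow> inv_chart x \<in> U"
  by (rule inv_into_into)

lemma continuous_chart: "continuous_on U \<psi>"
  and continuous_inv_chart: "continuous_on (\<psi> ` U) inv_chart"
  using chart_homeomorphism by (auto simp: homeomorphism_def)

lemma chart_image_eq: "\<psi> ` (U \<inter> W) = \<psi> ` U \<inter> inv_chart -` W"
  by force

lemma open_chart_image: "open W \<Longrightarrow> open (\<psi> ` (U \<inter> W))"
  unfolding chart_image_eq using continuous_inv_chart open_range by (rule continuous_open_preimage)

lemma open_chart_vimage: "open S \<Longrightarrow> open (U \<inter> \<psi> -` S)"
  using continuous_chart open_domain by (rule continuous_open_preimage)

lemma transition_smooth:
  assumes "(V, \<theta>) \<in> A"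
  shows "smooth_on (\<theta> \<circ> inv_chart) (\<psi> ` (U \<inter> V))" "smooth_on (\<psi> \<circ> inv_into V \<theta>) (\<theta> ` (U \<inter> V))"
  using chart assms by (auto simp: smooth_chart_def compatible_def)

text \<open>Smoothness, defined by the charts of the atlas, may be tested in every chart of the maximal atlas.\<close>
lemma smooth_fun_in_chart:
  assumes "smooth_fun_on A W f"
  shows "smooth_on (f \<circ> inv_chart) (\<psi> ` (U \<inter> W))"
proof (rule smooth_on_locally)
  fix x assume "x \<in> \<psi> ` (U \<inter> W)"
  then obtain q where q: "q \<in> U" "q \<in> W" "x = \<psi> q" by auto
  obtain V \<theta> where V: "(V, \<theta>) \<in> A" "q \<in> V" by (rule obtain_chart)
  interpret V: manifold_chart A V \<theta> by standard (rule smooth_chart_atlas[OF V(1)])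
  let ?T = "\<psi> ` (U \<inter> (V \<inter> W))"
  have T: "open ?T"
    using V.open_domain smooth_fun_on_open[OF assms] by (intro open_chart_image) auto
  have "smooth_on ((f \<circ> V.inv_chart) \<circ> (\<theta> \<circ> inv_chart)) ?T"
  proof (rule smooth_on_compose[OF T])
    show "smooth_on (\<theta> \<circ> inv_chart) ?T"
      by (rule smooth_on_subset[OF transition_smooth(1)[OF V(1)]]) auto
    show "smooth_on (f \<circ> V.inv_chart) (\<theta> ` (V \<inter> W))"
      using assms V(1) by (auto simp: smooth_fun_on_def)
  qed auto
  then have "smooth_on (f \<circ> inv_chart) ?T" by (rule smooth_on_cong[OF T, rotated]) auto
  then show "\<exists>T. open T \<and> x \<in> T \<and> smooth_on (f \<circ> inv_chart) T"
    using T q V(2) by blast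
qed

lemma smooth_fun_from_chart:
  assumes "open S" "smooth_on F S"
  shows "smooth_fun_on A (U \<inter> \<psi> -` S) (F \<circ> \<psi>)"
  unfolding smooth_fun_on_def
proof (intro conjI open_chart_vimage assms(1) ballI, clarify)
  fix V \<theta> assume V: "(V, \<theta>) \<in> A"
  interpret V: manifold_chart A V \<theta> by standard (rule smooth_chart_atlas[OF V(1)])
  let ?T = "\<theta> ` (V \<inter> (U \<inter> \<psi> -` S))"
  have T: "open ?T" by (intro V.open_chart_image open_chart_vimage assms(1))
  have "smooth_on (F \<circ> (\<psi> \<circ> V.inv_chart)) ?T"
    by (rule smooth_on_compose[OF T smooth_on_subset[OF transition_smooth(2)[OF V(1)]] assms(2)]) auto
  then show "smooth_on (F \<circ> \<psi> \<circ> V.inv_chart) ?T" by (simp add: o_assoc)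
qed

lemma smooth_at_in_chart:
  assumes "smooth_at A p f" "p \<in> U"
  obtains S where "open S" "\<psi> p \<in> S" "S \<subseteq> \<psi> ` U" "smooth_on (f \<circ> inv_chart) S"
proof -
  obtain W where W: "p \<in> W" "smooth_fun_on A W f" using assms(1) by (auto simp: smooth_at_def)
  show ?thesis
    by (rule that[of "\<psi> ` (U \<inter> W)"])
      (use W assms(2) open_chart_image smooth_fun_on_open smooth_fun_in_chart in auto)
qed

lemma differentiable_in_chart:
  assumes "smooth_at A p f" "p \<in> U"
  shows "(f \<circ> inv_chart) differentiable (at (\<psi> p))"
  using smooth_at_in_chart[OF assms] smooth_on_imp_differentiable by metis

lemma has_derivative_in_chart:
  assumes "smooth_at A p f" "p \<in> U"
  shows "((f \<circ> inv_chart) has_derivative frechet_derivative (f \<circ> inv_chart) (at (\<psi> p))) (at (\<psi> p))"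
  using differentiable_in_chart[OF assms] by (simp add: frechet_derivative_works)

text \<open>The tangent vector at \<open>p\<close> with coordinates \<open>w\<close>.\<close>
definition chart_vec :: "'m \<Rightarrow> 'e \<Rightarrow> 'm tvec" where
  "chart_vec p w = (\<lambda>f. if smooth_at A p f then frechet_derivative (f \<circ> inv_chart) (at (\<psi> p)) w else 0)"

lemma linear_chart_deriv:
  "smooth_at A p f \<Longrightarrow> p \<in> U \<Longrightarrow> linear (frechet_derivative (f \<circ> inv_chart) (at (\<psi> p)))"
  using differentiable_in_chart by (rule linear_frechet_derivative)

lemma chart_vec_comb:
  assumes "p \<in> U"
  shows "chart_vec p (a *\<^sub>R v + b *\<^sub>R w) = (\<lambda>f. a * chart_vec p v f + b * chart_vec p w f)"
  using linear_chart_deriv[OF _ assms]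
  by (auto simp: chart_vec_def linear_add linear_scale fun_eq_iff)

lemma chart_vec_sum:
  assumes "p \<in> U"
  shows "chart_vec p (\<Sum>i\<in>I. c i *\<^sub>R v i) = (\<lambda>f. \<Sum>i\<in>I. c i * chart_vec p (v i) f)"
  using linear_chart_deriv[OF _ assms]
  by (auto simp: chart_vec_def linear_sum linear_scale fun_eq_iff)

lemma smooth_coordinate: "smooth_fun_on A U (\<lambda>q. \<psi> q \<bullet> i)"
proof -
  have "smooth_fun_on A (U \<inter> \<psi> -` (\<psi> ` U)) ((\<lambda>x. x \<bullet> i) \<circ> \<psi>)"
    by (intro smooth_fun_from_chart open_range
        smooth_on_bounded_linear[OF _ bounded_linear_inner_left smooth_on_id])
  moreover have "U \<inter> \<psi> -` (\<psi> ` U) = U" by auto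
  ultimately show ?thesis by (simp add: o_def)
qed

text \<open>The coordinate functions recover \<open>w\<close>, so \<open>chart_vec p\<close> is injective.\<close>
lemma chart_vec_coordinate [simp]:
  assumes "p \<in> U" shows "chart_vec p w (\<lambda>q. \<psi> q \<bullet> i) = w \<bullet> i"
proof -
  have "((\<lambda>q. \<psi> q \<bullet> i) \<circ> inv_chart has_derivative (\<lambda>w. w \<bullet> i)) (at (\<psi> p))"
    by (rule has_derivative_transform_within_open[of "\<lambda>x. x \<bullet> i" _ _ _ "\<psi> ` U"])
      (use assms open_range in \<open>auto intro!: derivative_eq_intros\<close>)
  from frechet_derivative_at[OF this, symmetric] show ?thesis
    using smooth_atI[OF smooth_coordinate assms] by (simp add: chart_vec_def)
qed

lemma chart_vec_eq_iff [simp]: "p \<in> U \<Longrightarrow> chart_vec p v = chart_vec p w \<longleftrightarrow> v = w"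
  by (metis chart_vec_coordinate euclidean_eqI)

text \<open>The chain rule for \<open>f \<circ> \<gamma>\<close>, computed through the chart.\<close>
lemma curve_chart_deriv:
  assumes "((\<psi> \<circ> \<gamma>) has_vector_derivative w) (at 0)" "isCont \<gamma> 0" "\<gamma> 0 \<in> U" "smooth_at A (\<gamma> 0) f"
  shows "((f \<circ> \<gamma>) has_field_derivative chart_vec (\<gamma> 0) w f) (at 0)"
proof -
  have "(((f \<circ> inv_chart) \<circ> (\<psi> \<circ> \<gamma>)) has_vector_derivative chart_vec (\<gamma> 0) w f) (at 0)"
    using vector_derivative_diff_chain_within[OF assms(1)[unfolded o_def],
        of "f \<circ> inv_chart" "frechet_derivative (f \<circ> inv_chart) (at (\<psi> (\<gamma> 0)))"]
      has_derivative_in_chart[OF assms(4,3)] assms(4)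
    by (simp add: chart_vec_def o_def has_derivative_at_withinI)
  moreover have "\<forall>\<^sub>F t in nhds 0. \<gamma> t \<in> U"
    using topological_tendstoD[OF assms(2)[unfolded isCont_def tendsto_at_iff_tendsto_nhds] open_domain assms(3)] .
  then have "\<forall>\<^sub>F t in nhds 0. ((f \<circ> inv_chart) \<circ> (\<psi> \<circ> \<gamma>)) t = (f \<circ> \<gamma>) t"
    by eventually_elim simp
  ultimately show ?thesis
    using DERIV_cong_ev[of 0 0 "(f \<circ> inv_chart) \<circ> (\<psi> \<circ> \<gamma>)" "f \<circ> \<gamma>"]
    by (simp add: has_real_derivative_iff_has_vector_derivative)
qed

lemma velocity_eq_chart_vec:
  assumes "((\<psi> \<circ> \<gamma>) has_vector_derivative w) (at 0)" "isCont \<gamma> 0" "\<gamma> 0 \<in> U"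
  shows "velocity A \<gamma> = chart_vec (\<gamma> 0) w"
  using curve_chart_deriv[OF assms] by (auto simp: velocity_def chart_vec_def fun_eq_iff intro!: DERIV_imp_deriv)

end

lemma smooth_curve_isCont: "smooth_curve A \<gamma> \<Longrightarrow> isCont \<gamma> 0"
  unfolding smooth_curve_def
  by (metis continuous_on_eq_continuous_at greaterThanLessThan_iff neg_less_0_iff_less open_greaterThanLessThan)

context manifold_chart
begin

lemma smooth_curve_chart_differentiable:
  assumes "smooth_curve A \<gamma>" "\<gamma> 0 \<in> U"
  obtains w where "((\<psi> \<circ> \<gamma>) has_vector_derivative w) (at 0)"
proof -
  obtain e where e: "e > 0" "continuous_on {-e<..<e} \<gamma>"
    "\<And>V \<theta>. (V, \<theta>) \<in> A \<Longrightarrow> smooth_on (\<theta> \<circ> \<gamma>) ({-e<..<e} \<inter> \<gamma> -` V)"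
    using assms(1) by (auto simp: smooth_curve_def)
  obtain V \<theta> where V: "(V, \<theta>) \<in> A" "\<gamma> 0 \<in> V" by (rule obtain_chart)
  interpret V: manifold_chart A V \<theta> by standard (rule smooth_chart_atlas[OF V(1)])
  let ?S = "{-e<..<e} \<inter> \<gamma> -` (U \<inter> V)"
  have S: "open ?S"
    using e(2) open_domain V.open_domain by (intro continuous_open_preimage) auto
  have "smooth_on ((\<psi> \<circ> V.inv_chart) \<circ> (\<theta> \<circ> \<gamma>)) ?S"
    by (rule smooth_on_compose[OF S smooth_on_subset[OF e(3)[OF V(1)]] transition_smooth(2)[OF V(1)]]) auto
  then have "smooth_on (\<psi> \<circ> \<gamma>) ?S" by (rule smooth_on_cong[OF S, rotated]) auto
  then have "(\<psi> \<circ> \<gamma>) differentiable (at 0)"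
    by (rule smooth_on_imp_differentiable) (use e(1) V(2) assms(2) in auto)
  then show ?thesis using that by (auto simp: vector_derivative_works)
qed

lemma line_in_chart:
  fixes w :: 'e
  assumes "p \<in> U"
  defines "\<gamma> \<equiv> \<lambda>t. inv_chart (\<psi> p + t *\<^sub>R w)"
  shows "smooth_curve A \<gamma>" "\<gamma> 0 = p" "velocity A \<gamma> = chart_vec p w"
    "\<forall>\<^sub>F t in nhds 0. \<psi> p + t *\<^sub>R w \<in> \<psi> ` U"
proof -
  define l where "l t = \<psi> p + t *\<^sub>R w" for t
  have l: "open (l -` (\<psi> ` U))" unfolding l_def by (intro open_vimage open_range continuous_intros)
  have "0 \<in> l -` (\<psi> ` U)" using assms(1) by (simp add: l_def)
  with l show ev: "\<forall>\<^sub>F t in nhds 0. \<psi> p + t *\<^sub>R w \<in> \<psi> ` U"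
    using eventually_nhds_in_open[of "l -` (\<psi> ` U)" 0] by (simp add: l_def)
  obtain e where e: "e > 0" "ball 0 e \<subseteq> l -` (\<psi> ` U)"
    using l \<open>0 \<in> _\<close> by (meson openE)
  have le: "l t \<in> \<psi> ` U" if "t \<in> {-e<..<e}" for t
    using e that by (auto simp: subset_iff dist_real_def)
  have cont: "continuous_on {-e<..<e} \<gamma>"
    unfolding \<gamma>_def
    by (rule continuous_on_compose2[OF continuous_inv_chart, of _ l, unfolded l_def])
      (use le in \<open>auto simp: l_def intro!: continuous_intros\<close>)
  have sm: "smooth_on l S" if "open S" for S
    unfolding l_def
    by (intro smooth_on_add smooth_on_const that
        smooth_on_bounded_linear[OF _ bounded_linear_scaleR_left smooth_on_id])
  show "smooth_curve A \<gamma>"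
    unfolding smooth_curve_def
  proof (intro exI[of _ e] conjI e(1) cont ballI, clarify)
    fix V \<theta> assume V: "(V, \<theta>) \<in> A"
    interpret V: manifold_chart A V \<theta> by standard (rule smooth_chart_atlas[OF V(1)])
    let ?S = "{-e<..<e} \<inter> \<gamma> -` V"
    have S: "open ?S" using cont V.open_domain by (intro continuous_open_preimage) auto
    have "l ` ?S \<subseteq> \<psi> ` (U \<inter> V)"
      using le by (auto simp: \<gamma>_def l_def chart_image_eq)
    then have "smooth_on ((\<theta> \<circ> inv_chart) \<circ> l) ?S"
      by (rule smooth_on_compose[OF S sm[OF S] transition_smooth(1)[OF V]])
    then show "smooth_on (\<theta> \<circ> \<gamma>) ?S" by (simp add: \<gamma>_def l_def o_def)
  qed
  then have "isCont \<gamma> 0" by (rule smooth_curve_isCont)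
  show g0: "\<gamma> 0 = p" using assms(1) by (simp add: \<gamma>_def)
  have "((\<psi> \<circ> \<gamma>) has_vector_derivative w) (at 0)"
  proof -
    have "(l has_vector_derivative w) (at 0)" unfolding l_def by (auto intro!: derivative_eq_intros)
    then show ?thesis
      unfolding has_vector_derivative_def
      by (rule has_derivative_transform_within_open[OF _ l \<open>0 \<in> _\<close>]) (auto simp: \<gamma>_def l_def)
  qed
  from velocity_eq_chart_vec[OF this \<open>isCont \<gamma> 0\<close>] show "velocity A \<gamma> = chart_vec p w"
    using assms(1) g0 by simp
qed

lemma tangent_space_eq: "p \<in> U \<Longrightarrow> tangent_space A p = range (chart_vec p)"
proof (intro equalityI subsetI)
  fix v assume p: "p \<in> U" and "v \<in> tangent_space A p"
  then obtain \<gamma> where g: "v = velocity A \<gamma>" "smooth_curve A \<gamma>" "\<gamma> 0 = p"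
    by (auto simp: tangent_space_def tangent_in_def)
  then obtain w where w: "((\<psi> \<circ> \<gamma>) has_vector_derivative w) (at 0)"
    using smooth_curve_chart_differentiable p by metis
  show "v \<in> range (chart_vec p)"
    using velocity_eq_chart_vec[OF w smooth_curve_isCont[OF g(2)]] g p by auto
next
  fix v assume p: "p \<in> U" and "v \<in> range (chart_vec p)"
  then obtain w where "v = chart_vec p w" by auto
  then show "v \<in> tangent_space A p"
    unfolding tangent_space_def tangent_in_def using line_in_chart(1-3)[OF p, of w]
    by (intro CollectI exI[of _ "\<lambda>t. inv_chart (\<psi> p + t *\<^sub>R w)"]) auto
qed

lemma chart_vec_tangent [simp]: "p \<in> U \<Longrightarrow> chart_vec p w \<in> tangent_space A p"
  by (simp add: tangent_space_eq)

lemma differential_chart_vec [simp]: "p \<in> U \<Longrightarrow> differential A p f (chart_vec p w) = chart_vec p w f"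
  by (simp add: differential_def)

lemma chart_vec_local:
  assumes "p \<in> U" "open W" "p \<in> W" "\<And>q. q \<in> W \<Longrightarrow> f q = g q" "smooth_at A p f" "smooth_at A p g"
  shows "chart_vec p w f = chart_vec p w g"
proof -
  have "frechet_derivative (f \<circ> inv_chart) (at (\<psi> p)) = frechet_derivative (g \<circ> inv_chart) (at (\<psi> p))"
    by (rule frechet_derivative_transform_within_open[OF differentiable_in_chart open_chart_image[OF assms(2)]])
      (use assms in auto)
  then show ?thesis using assms by (simp add: chart_vec_def)
qed

text \<open>
  Every covector at \<open>p\<close> is the differential of a smooth function, namely of a linear function of the
  coordinates.
\<close>
lemma covector_eq_differential:
  assumes "p \<in> U" "\<xi> \<in> cotangent_space A p"
  shows "\<xi> = differential A p (\<lambda>q. \<psi> q \<bullet> (\<Sum>i\<in>Basis. \<xi> (chart_vec p i) *\<^sub>R i))" (is "_ = ?d")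
proof
  have lin: "linear (\<lambda>w. \<xi> (chart_vec p w))"
  proof (rule linearI)
    fix v w :: 'e and r :: real
    have c: "\<xi> (chart_vec p (a *\<^sub>R v + b *\<^sub>R w)) = a * \<xi> (chart_vec p v) + b * \<xi> (chart_vec p w)" for a b
      unfolding chart_vec_comb[OF assms(1)] using assms by (simp add: cotangent_space_def)
    show "\<xi> (chart_vec p (v + w)) = \<xi> (chart_vec p v) + \<xi> (chart_vec p w)" using c[of 1 1] by simp
    show "\<xi> (chart_vec p (r *\<^sub>R v)) = r *\<^sub>R \<xi> (chart_vec p v)" using c[of r 0] by simp
  qed
  fix v show "\<xi> v = ?d v"
  proof (cases "v \<in> tangent_space A p")
    case True
    then obtain w where w: "v = chart_vec p w" using assms(1) by (auto simp: tangent_space_eq)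
    have "\<xi> v = \<xi> (chart_vec p (\<Sum>i\<in>Basis. (w \<bullet> i) *\<^sub>R i))" by (simp add: w euclidean_representation)
    also have "\<dots> = (\<Sum>i\<in>Basis. (w \<bullet> i) * \<xi> (chart_vec p i))"
      by (simp add: linear_sum[OF lin] linear_scale[OF lin])
    also have "\<dots> = w \<bullet> (\<Sum>i\<in>Basis. \<xi> (chart_vec p i) *\<^sub>R i)"
      by (simp add: inner_sum_right mult.commute)
    also have "\<dots> = ?d v" by (simp only: w differential_chart_vec[OF assms(1)] chart_vec_coordinate[OF assms(1)])
    finally show ?thesis .
  next
    case False
    then show ?thesis using assms by (simp add: cotangent_space_def differential_def)
  qed
qed

lemma differential_expand:
  assumes "p \<in> U" "smooth_at A p f"
  shows "differential A p f =
    (\<lambda>v. \<Sum>i\<in>Basis. chart_vec p i f * differential A p (\<lambda>q. \<psi> q \<bullet> i) v)"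
proof
  fix v show "differential A p f v = (\<Sum>i\<in>Basis. chart_vec p i f * differential A p (\<lambda>q. \<psi> q \<bullet> i) v)"
  proof (cases "v \<in> tangent_space A p")
    case True
    then obtain w where w: "v = chart_vec p w" using assms(1) by (auto simp: tangent_space_eq)
    have "chart_vec p w f = chart_vec p (\<Sum>i\<in>Basis. (w \<bullet> i) *\<^sub>R i) f" by (simp add: euclidean_representation)
    then show ?thesis using assms(1) by (simp add: w chart_vec_sum mult.commute)
  qed (simp add: differential_def)
qed

end

context smooth_manifold
begin

lemma obtain_manifold_chart:
  obtains U \<psi> where "manifold_chart A U \<psi>" "p \<in> U"
proof -
  obtain U \<psi> where "(U, \<psi>) \<in> A" "p \<in> U" by (rule obtain_chart)
  then show ?thesis
    by (intro that) (auto intro!: manifold_chart.intro manifold_chart_axioms.intro smooth_chart_atlas smooth_manifold_axioms)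
qed

lemma tangent_space_comb:
  assumes "v \<in> tangent_space A p" "w \<in> tangent_space A p"
  shows "(\<lambda>f. a * v f + b * w f) \<in> tangent_space A p"
proof -
  obtain U \<psi> where U: "manifold_chart A U \<psi>" "p \<in> U" by (rule obtain_manifold_chart)
  interpret manifold_chart A U \<psi> by fact
  show ?thesis using assms U(2) by (auto simp: tangent_space_eq chart_vec_comb[symmetric])
qed

lemma tangent_in_subset: "tangent_in A N p \<subseteq> tangent_space A p"
  by (auto simp: tangent_in_def tangent_space_def)

lemma differential_cotangent: "differential A p f \<in> cotangent_space A p"
  by (auto simp: cotangent_space_def differential_def tangent_space_comb)

lemma smooth_at_cong:
  assumes "open W" "p \<in> W" "\<And>q. q \<in> W \<Longrightarrow> f q = g q" "smooth_at A p f"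
  shows "smooth_at A p g"
proof -
  obtain V where V: "p \<in> V" "smooth_fun_on A V f" using assms(4) by (auto simp: smooth_at_def)
  have o: "open (V \<inter> W)" using assms(1) smooth_fun_on_open[OF V(2)] by auto
  have "smooth_fun_on A (V \<inter> W) g"
    unfolding smooth_fun_on_def
  proof (intro conjI ballI o, clarify)
    fix U \<psi> assume U: "(U, \<psi>) \<in> A"
    interpret manifold_chart A U \<psi> by standard (rule smooth_chart_atlas[OF U])
    show "smooth_on (g \<circ> inv_chart) (\<psi> ` (U \<inter> (V \<inter> W)))"
      by (rule smooth_on_cong[OF open_chart_image[OF o] _ smooth_on_subset[OF smooth_fun_in_chart[OF V(2)]]])
        (use assms(3) in auto)
  qed
  then show ?thesis using V(1) assms(2) by (auto simp: smooth_at_def)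
qed

lemma tangent_local:
  assumes "v \<in> tangent_space A p" "open W" "p \<in> W" "\<And>q. q \<in> W \<Longrightarrow> f q = g q"
  shows "v f = v g"
proof -
  obtain U \<psi> where U: "manifold_chart A U \<psi>" "p \<in> U" by (rule obtain_manifold_chart)
  interpret manifold_chart A U \<psi> by fact
  obtain w where w: "v = chart_vec p w" using assms(1) U(2) by (auto simp: tangent_space_eq)
  have "smooth_at A p f \<longleftrightarrow> smooth_at A p g"
    using smooth_at_cong[OF assms(2,3)] assms(4) by metis
  then show ?thesis
    using chart_vec_local[OF U(2) assms(2,3), of f g w] assms(4) by (auto simp: w chart_vec_def)
qed

lemma differential_local:
  assumes "open W" "p \<in> W" "\<And>q. q \<in> W \<Longrightarrow> f q = g q"
  shows "differential A p f = differential A p g"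
  using tangent_local[OF _ assms] by (auto simp: differential_def fun_eq_iff)

lemma tangent_const: "v \<in> tangent_space A p \<Longrightarrow> v (\<lambda>q. c) = 0"
proof -
  assume v: "v \<in> tangent_space A p"
  obtain U \<psi> where U: "manifold_chart A U \<psi>" "p \<in> U" by (rule obtain_manifold_chart)
  interpret manifold_chart A U \<psi> by fact
  show ?thesis using v U(2) by (auto simp: tangent_space_eq chart_vec_def o_def)
qed

lemma smooth_fun_on_sum:
  assumes "open W" "\<And>j. j \<in> J \<Longrightarrow> smooth_fun_on A W (f j)"
  shows "smooth_fun_on A W (\<lambda>q. \<Sum>j\<in>J. c j * f j q)"
  unfolding smooth_fun_on_def
proof (intro conjI ballI assms(1), clarify)
  fix U \<psi> assume U: "(U, \<psi>) \<in> A"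
  interpret manifold_chart A U \<psi> by standard (rule smooth_chart_atlas[OF U])
  have o: "open (\<psi> ` (U \<inter> W))" by (rule open_chart_image[OF assms(1)])
  have "smooth_on (\<lambda>x. \<Sum>j\<in>J. c j * (f j \<circ> inv_chart) x) (\<psi> ` (U \<inter> W))"
    by (intro smooth_on_sum[OF o] smooth_on_bounded_linear[OF o bounded_linear_mult_right]
        smooth_fun_in_chart[OF assms(2)])
  then show "smooth_on ((\<lambda>q. \<Sum>j\<in>J. c j * f j q) \<circ> inv_chart) (\<psi> ` (U \<inter> W))"
    by (simp add: o_def)
qed

lemma smooth_fun_on_add:
  assumes "smooth_fun_on A W f" "smooth_fun_on A W g"
  shows "smooth_fun_on A W (\<lambda>q. f q + g q)"
  unfolding smooth_fun_on_def
proof (intro conjI ballI smooth_fun_on_open[OF assms(1)], clarify)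
  fix U \<psi> assume U: "(U, \<psi>) \<in> A"
  interpret manifold_chart A U \<psi> by standard (rule smooth_chart_atlas[OF U])
  show "smooth_on ((\<lambda>q. f q + g q) \<circ> inv_chart) (\<psi> ` (U \<inter> W))"
    using smooth_on_add[OF open_chart_image[OF smooth_fun_on_open[OF assms(1)]]
        smooth_fun_in_chart[OF assms(1)] smooth_fun_in_chart[OF assms(2)]]
    by (simp add: o_def)
qed

lemma tangent_sum:
  assumes "v \<in> tangent_space A p" "finite J" "\<And>j. j \<in> J \<Longrightarrow> smooth_at A p (f j)"
  shows "v (\<lambda>q. \<Sum>j\<in>J. c j * f j q) = (\<Sum>j\<in>J. c j * v (f j))"
proof -
  obtain U \<psi> where U: "manifold_chart A U \<psi>" "p \<in> U" by (rule obtain_manifold_chart)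
  interpret manifold_chart A U \<psi> by fact
  obtain w where w: "v = chart_vec p w" using assms(1) U(2) by (auto simp: tangent_space_eq)
  have "((\<lambda>q. \<Sum>j\<in>J. c j * f j q) \<circ> inv_chart has_derivative
      (\<lambda>w. \<Sum>j\<in>J. c j * frechet_derivative (f j \<circ> inv_chart) (at (\<psi> p)) w)) (at (\<psi> p))"
    unfolding o_def
    by (intro has_derivative_sum has_derivative_mult_right)
      (use has_derivative_in_chart[OF assms(3) U(2)] in \<open>simp add: o_def\<close>)
  from frechet_derivative_at[OF this, symmetric]
  have *: "frechet_derivative ((\<lambda>q. \<Sum>j\<in>J. c j * f j q) \<circ> inv_chart) (at (\<psi> p)) w =
     (\<Sum>j\<in>J. c j * chart_vec p w (f j))"
    using assms(3) by (simp add: chart_vec_def)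
  have "\<forall>j\<in>J. \<exists>W. p \<in> W \<and> smooth_fun_on A W (f j)" using assms(3) by (simp add: smooth_at_def)
  then obtain W where W: "\<And>j. j \<in> J \<Longrightarrow> p \<in> W j \<and> smooth_fun_on A (W j) (f j)" by metis
  have "open (\<Inter>j\<in>J. W j)" using assms(2) W smooth_fun_on_open by blast
  then have "smooth_fun_on A (\<Inter>j\<in>J. W j) (\<lambda>q. \<Sum>j\<in>J. c j * f j q)"
    using W by (intro smooth_fun_on_sum) (auto intro: smooth_fun_on_subset)
  then have "smooth_at A p (\<lambda>q. \<Sum>j\<in>J. c j * f j q)"
    by (rule smooth_atI) (use W in blast)
  then show ?thesis using * by (simp add: w chart_vec_def)
qed

lemma tangent_add:
  assumes "v \<in> tangent_space A p" "smooth_at A p f" "smooth_at A p g"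
  shows "v (\<lambda>q. f q + g q) = v f + v g"
  using tangent_sum[OF assms(1), of "UNIV :: bool set" "\<lambda>b. if b then f else g" "\<lambda>_. 1"] assms(2,3)
  by (simp add: UNIV_bool add.commute)

end

section \<open>Poisson brackets in a chart\<close>

text \<open>A manifold with a Poisson bivector.\<close>
locale poisson_manifold = smooth_manifold A
  for A :: "('m::topological_space, 'e::euclidean_space) chart set" +
  fixes P :: "'m bivec"
  assumes poisson: "poisson A P"
begin

lemma bivec_skew:
  "\<xi> \<in> cotangent_space A p \<Longrightarrow> \<eta> \<in> cotangent_space A p \<Longrightarrow> P p \<xi> \<eta> = - P p \<eta> \<xi>"
  using poisson[unfolded poisson_def, THEN conjunct1, rule_format] .

lemma bivec_comb:
  "\<xi> \<in> cotangent_space A p \<Longrightarrow> \<eta> \<in> cotangent_space A p \<Longrightarrow> \<zeta> \<in> cotangent_space A p \<Longrightarrow>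
   P p (\<lambda>v. a * \<xi> v + b * \<eta> v) \<zeta> = a * P p \<xi> \<zeta> + b * P p \<eta> \<zeta>"
  using poisson[unfolded poisson_def, THEN conjunct2, THEN conjunct1, rule_format] .

lemma bracket_smooth:
  "smooth_fun_on A W f \<Longrightarrow> smooth_fun_on A W g \<Longrightarrow> smooth_fun_on A W (bracket A P f g)"
  using poisson[unfolded poisson_def, THEN conjunct2, THEN conjunct2, THEN conjunct1, rule_format] .

lemma jacobi:
  "smooth_fun_on A W f \<Longrightarrow> smooth_fun_on A W g \<Longrightarrow> smooth_fun_on A W h \<Longrightarrow> p \<in> W \<Longrightarrow>
   bracket A P f (bracket A P g h) p + bracket A P g (bracket A P h f) p + bracket A P h (bracket A P f g) p = 0"
  using poisson[unfolded poisson_def, THEN conjunct2, THEN conjunct2, THEN conjunct2, rule_format] .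

lemma bracket_skew: "bracket A P f g p = - bracket A P g f p"
  unfolding bracket_def by (intro bivec_skew differential_cotangent)

lemma cotangent_comb:
  assumes "\<xi> \<in> cotangent_space A p" "\<eta> \<in> cotangent_space A p"
  shows "(\<lambda>v. a * \<xi> v + b * \<eta> v) \<in> cotangent_space A p"
  using assms by (auto simp: cotangent_space_def algebra_simps)

lemma cotangent_zero: "(\<lambda>v. 0) \<in> cotangent_space A p"
  by (simp add: cotangent_space_def)

lemma cotangent_sum:
  assumes "finite I" "\<And>i. i \<in> I \<Longrightarrow> \<xi> i \<in> cotangent_space A p"
  shows "(\<lambda>v. \<Sum>i\<in>I. c i * \<xi> i v) \<in> cotangent_space A p"
  using assms
proof (induction I)
  case (insert i I)
  then show ?case using cotangent_comb[of "\<xi> i" p "\<lambda>v. \<Sum>i\<in>I. c i * \<xi> i v" "c i" 1] by simp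
qed (simp add: cotangent_zero)

lemma bivec_zero: "\<zeta> \<in> cotangent_space A p \<Longrightarrow> P p (\<lambda>v. 0) \<zeta> = 0"
  using bivec_comb[of "\<lambda>v. 0" p "\<lambda>v. 0" \<zeta> 0 0] by (simp add: cotangent_zero)

lemma bivec_sum:
  assumes "finite I" "\<And>i. i \<in> I \<Longrightarrow> \<xi> i \<in> cotangent_space A p" "\<zeta> \<in> cotangent_space A p"
  shows "P p (\<lambda>v. \<Sum>i\<in>I. c i * \<xi> i v) \<zeta> = (\<Sum>i\<in>I. c i * P p (\<xi> i) \<zeta>)"
  using assms
proof (induction I)
  case (insert i I)
  then show ?case
    using bivec_comb[of "\<xi> i" p "\<lambda>v. \<Sum>i\<in>I. c i * \<xi> i v" \<zeta> "c i" 1] cotangent_sum[of I \<xi> p c]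
    by simp
qed (simp add: bivec_zero)

lemma bivec_sum_right:
  assumes "finite I" "\<And>i. i \<in> I \<Longrightarrow> \<xi> i \<in> cotangent_space A p" "\<zeta> \<in> cotangent_space A p"
  shows "P p \<zeta> (\<lambda>v. \<Sum>i\<in>I. c i * \<xi> i v) = (\<Sum>i\<in>I. c i * P p \<zeta> (\<xi> i))"
proof -
  have "P p \<zeta> (\<xi> i) = - P p (\<xi> i) \<zeta>" if "i \<in> I" for i using bivec_skew assms that by blast
  then show ?thesis
    using bivec_skew[OF assms(3) cotangent_sum[OF assms(1,2)]] bivec_sum[OF assms]
    by (simp add: sum_negf)
qed

lemma bracket_local:
  assumes "open W" "p \<in> W" "\<And>q. q \<in> W \<Longrightarrow> f q = g q"
  shows "bracket A P f h p = bracket A P g h p" "bracket A P h f p = bracket A P h g p"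
  using differential_local[OF assms] by (simp_all add: bracket_def)

text \<open>A bracket vanishes where its first argument vanishes in a neighbourhood.\<close>
lemma bracket_zero:
  assumes "open W" "p \<in> W" "\<And>q. q \<in> W \<Longrightarrow> f q = 0"
  shows "bracket A P f h p = 0"
proof -
  have "differential A p (\<lambda>q. 0) = (\<lambda>v. 0)" by (auto simp: differential_def tangent_const)
  then have "bracket A P (\<lambda>q. 0) h p = 0" by (simp add: bracket_def bivec_zero differential_cotangent)
  then show ?thesis using bracket_local(1)[OF assms(1,2), of f "\<lambda>q. 0"] assms(3) by simp
qed

text \<open>In a chart, \<open>P\<^sup>\<sharp> \<xi>\<close> has the coordinates \<open>P(\<xi>, dx\<^sub>i)\<close>.\<close>
lemma sharp_in_chart:
  assumes "manifold_chart A U \<psi>" "p \<in> U" "\<xi> \<in> cotangent_space A p"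
  shows "sharp A P p \<xi> = manifold_chart.chart_vec A U \<psi> p
     (\<Sum>i\<in>Basis. P p \<xi> (differential A p (\<lambda>q. \<psi> q \<bullet> i)) *\<^sub>R i)"
proof
  interpret manifold_chart A U \<psi> by fact
  fix f
  show "sharp A P p \<xi> f = chart_vec p (\<Sum>i\<in>Basis. P p \<xi> (differential A p (\<lambda>q. \<psi> q \<bullet> i)) *\<^sub>R i) f"
  proof (cases "smooth_at A p f")
    case True
    show ?thesis
      using bivec_sum_right[OF finite_Basis differential_cotangent assms(3),
          of "\<lambda>i. chart_vec p i f" "\<lambda>i q. \<psi> q \<bullet> i"] True
      by (simp add: sharp_def differential_expand[OF assms(2) True] chart_vec_sum[OF assms(2)] mult.commute)
  qed (simp add: sharp_def chart_vec_def)
qed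

lemma sharp_tangent:
  assumes "\<xi> \<in> cotangent_space A p" shows "sharp A P p \<xi> \<in> tangent_space A p"
proof -
  obtain U \<psi> where U: "manifold_chart A U \<psi>" "p \<in> U" by (rule obtain_manifold_chart)
  show ?thesis
    unfolding sharp_in_chart[OF U assms] by (rule manifold_chart.chart_vec_tangent[OF U])
qed

lemma hamiltonian_eq_sharp: "hamiltonian A P f p = (\<lambda>g. - sharp A P p (differential A p f) g)"
proof
  fix g
  show "hamiltonian A P f p g = - sharp A P p (differential A p f) g"
    using bracket_skew[of g f p] by (simp add: hamiltonian_def sharp_def bracket_def)
qed

lemma hamiltonian_in_chart:
  assumes "manifold_chart A U \<psi>" "p \<in> U"
  shows "hamiltonian A P f p = manifold_chart.chart_vec A U \<psi> p
     (\<Sum>i\<in>Basis. bracket A P (\<lambda>q. \<psi> q \<bullet> i) f p *\<^sub>R i)"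
proof -
  interpret manifold_chart A U \<psi> by fact
  let ?w = "\<Sum>i\<in>Basis. P p (differential A p f) (differential A p (\<lambda>q. \<psi> q \<bullet> i)) *\<^sub>R i"
  have "hamiltonian A P f p = (\<lambda>g. - chart_vec p ?w g)"
    by (simp only: hamiltonian_eq_sharp sharp_in_chart[OF assms differential_cotangent])
  also have "\<dots> = chart_vec p (- ?w)"
    using chart_vec_comb[OF assms(2), of "-1" ?w 0 0] by simp
  also have "- ?w = (\<Sum>i\<in>Basis. bracket A P (\<lambda>q. \<psi> q \<bullet> i) f p *\<^sub>R i)"
    unfolding bracket_def sum_negf[symmetric]
    by (intro sum.cong refl) (simp add: bivec_skew[OF differential_cotangent differential_cotangent, of p f])
  finally show ?thesis .
qed

lemma hamiltonian_tangent: "hamiltonian A P f p \<in> tangent_space A p"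
proof -
  obtain U \<psi> where U: "manifold_chart A U \<psi>" "p \<in> U" by (rule obtain_manifold_chart)
  show ?thesis
    unfolding hamiltonian_in_chart[OF U] by (rule manifold_chart.chart_vec_tangent[OF U])
qed

lemma hamiltonian_apply: "smooth_at A p g \<Longrightarrow> hamiltonian A P f p g = bracket A P g f p"
  by (simp add: hamiltonian_def)

lemma bracket_uminus:
  assumes "smooth_at A p u" shows "bracket A P (\<lambda>q. - u q) g p = - bracket A P u g p"
proof -
  have "smooth_at A p (\<lambda>q. - u q)"
  proof -
    obtain W where W: "p \<in> W" "smooth_fun_on A W u" using assms by (auto simp: smooth_at_def)
    show ?thesis
      using smooth_fun_on_sum[OF smooth_fun_on_open[OF W(2)], of "{0::nat}" "\<lambda>_. u" "\<lambda>_. -1"] W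
      by (auto simp: smooth_at_def)
  qed
  moreover have "hamiltonian A P g p (\<lambda>q. - u q) = - hamiltonian A P g p u"
    using tangent_sum[OF hamiltonian_tangent[of g p], of "{0::nat}" "\<lambda>_. u" "\<lambda>_. -1"] assms
    by simp
  ultimately show ?thesis
    using assms by (simp only: hamiltonian_apply)
qed

end

section \<open>The fibres of an NCI system\<close>

text \<open>An NCI system; the facts on the base \<open>(B, \<pi>)\<close> carry the prefix \<open>base\<close>.\<close>
locale nci =
  fixes r :: nat
    and M :: "('m::{t2_space,second_countable_topology}, 'e::euclidean_space) chart set" and P :: "'m bivec"
    and B :: "('n::{t2_space,second_countable_topology}, 'd::euclidean_space) chart set" and \<pi> :: "'n bivec"
    and \<phi> :: "'m \<Rightarrow> 'n" and F :: "'m set set"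
  assumes nci: "nci_system r M P B \<pi> \<phi> F"
begin

sublocale poisson_manifold M P
  by standard (use nci in \<open>auto simp: nci_system_def\<close>)

sublocale base: poisson_manifold B \<pi>
  by standard (use nci in \<open>auto simp: nci_system_def\<close>)

lemma leaves_eq: "F = range (\<lambda>b. \<phi> -` {b})"
  using nci by (simp add: nci_system_def)

lemma smooth_map: "smooth_map M B \<phi>"
  and tangent_map_image: "tangent_map B \<phi> p ` tangent_space M p = tangent_space B (\<phi> p)"
  using nci by (auto simp: nci_system_def submersion_def)

lemma continuous_projection: "continuous_on S \<phi>"
  using smooth_map by (auto simp: smooth_map_def intro: continuous_on_subset)

lemma poisson_map:
  "smooth_fun_on B W f \<Longrightarrow> smooth_fun_on B W g \<Longrightarrow> \<phi> p \<in> W \<Longrightarrow>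
   bracket M P (f \<circ> \<phi>) (g \<circ> \<phi>) p = bracket B \<pi> f g (\<phi> p)"
  using nci by (auto simp: nci_system_def poisson_map_def)

lemma smooth_pullback:
  assumes "smooth_fun_on B W g"
  shows "smooth_fun_on M (\<phi> -` W) (g \<circ> \<phi>)"
proof -
  have opn: "open (\<phi> -` Y)" if "open Y" for Y
    using that continuous_projection[of UNIV] by (rule open_vimage)
  have o: "open (\<phi> -` W)" by (intro opn base.smooth_fun_on_open[OF assms])
  show ?thesis
    unfolding smooth_fun_on_def
  proof (intro conjI o ballI, clarify)
    fix U \<psi> assume U: "(U, \<psi>) \<in> M"
    interpret U: manifold_chart M U \<psi> by standard (rule smooth_chart_atlas[OF U])
    show "smooth_on (g \<circ> \<phi> \<circ> U.inv_chart) (\<psi> ` (U \<inter> \<phi> -` W))"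
    proof (rule smooth_on_locally)
      fix x assume "x \<in> \<psi> ` (U \<inter> \<phi> -` W)"
      then obtain q where q: "q \<in> U" "\<phi> q \<in> W" "x = \<psi> q" by auto
      obtain V \<theta> where V: "(V, \<theta>) \<in> B" "\<phi> q \<in> V" by (rule base.obtain_chart)
      interpret V: manifold_chart B V \<theta> by standard (rule base.smooth_chart_atlas[OF V(1)])
      let ?T = "\<psi> ` (U \<inter> \<phi> -` (V \<inter> W))"
      have T: "open ?T"
        by (intro U.open_chart_image opn open_Int V.open_domain base.smooth_fun_on_open[OF assms])
      have "smooth_on ((g \<circ> V.inv_chart) \<circ> (\<theta> \<circ> \<phi> \<circ> U.inv_chart)) ?T"
      proof (rule smooth_on_compose[OF T])
        have "smooth_on (\<theta> \<circ> \<phi> \<circ> U.inv_chart) (\<psi> ` (U \<inter> \<phi> -` V))"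
          using smooth_map U V(1) by (fastforce simp: smooth_map_def)
        then show "smooth_on (\<theta> \<circ> \<phi> \<circ> U.inv_chart) ?T" by (rule smooth_on_subset) auto
        show "smooth_on (g \<circ> V.inv_chart) (\<theta> ` (V \<inter> W))" by (rule V.smooth_fun_in_chart[OF assms])
      qed auto
      then have "smooth_on (g \<circ> \<phi> \<circ> U.inv_chart) ?T" by (rule smooth_on_cong[OF T, rotated]) auto
      then show "\<exists>T. open T \<and> x \<in> T \<and> smooth_on (g \<circ> \<phi> \<circ> U.inv_chart) T"
        using T q V(2) by (intro exI[of _ ?T]) auto
    qed
  qed
qed

lemma tangent_map_tangent: "v \<in> tangent_space M p \<Longrightarrow> tangent_map B \<phi> p v \<in> tangent_space B (\<phi> p)"
  using tangent_map_image by blast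

lemma tangent_map_comb:
  "tangent_map B \<phi> p (\<lambda>f. a * v f + b * w f) = (\<lambda>g. a * tangent_map B \<phi> p v g + b * tangent_map B \<phi> p w g)"
  by (auto simp: tangent_map_def)

lemma pullback_cotangent:
  assumes "\<xi> \<in> cotangent_space B (\<phi> p)"
  shows "pullback M B \<phi> p \<xi> \<in> cotangent_space M p"
  using assms tangent_map_tangent
  by (auto simp: cotangent_space_def pullback_def tangent_map_comb tangent_space_comb)

lemma pullback_differential:
  assumes "smooth_at B (\<phi> p) h"
  shows "pullback M B \<phi> p (differential B (\<phi> p) h) = differential M p (h \<circ> \<phi>)"
proof
  fix v show "pullback M B \<phi> p (differential B (\<phi> p) h) v = differential M p (h \<circ> \<phi>) v"
  proof (cases "v \<in> tangent_space M p")
    case True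
    then show ?thesis
      using tangent_map_tangent[OF True] assms by (simp add: pullback_def differential_def) (simp add: tangent_map_def)
  qed (simp add: pullback_def differential_def)
qed

text \<open>Differentials of functions on an open part of the base exhaust the covectors.\<close>
lemma covector_is_differential:
  assumes "\<xi> \<in> cotangent_space B b"
  obtains W h where "b \<in> W" "smooth_fun_on B W h" "\<xi> = differential B b h"
proof -
  obtain V \<theta> where V: "manifold_chart B V \<theta>" "b \<in> V" by (rule base.obtain_manifold_chart)
  interpret V: manifold_chart B V \<theta> by fact
  show ?thesis using that[OF V(2) V.smooth_coordinate V.covector_eq_differential[OF V(2) assms]] .
qed

text \<open>The Poisson map condition, stated for functions, in its pointwise form for covectors.\<close>
lemma bivec_pullback:
  assumes "\<xi> \<in> cotangent_space B (\<phi> p)" "\<eta> \<in> cotangent_space B (\<phi> p)"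
  shows "P p (pullback M B \<phi> p \<xi>) (pullback M B \<phi> p \<eta>) = \<pi> (\<phi> p) \<xi> \<eta>"
proof -
  obtain W h where h: "\<phi> p \<in> W" "smooth_fun_on B W h" "\<xi> = differential B (\<phi> p) h"
    using covector_is_differential[OF assms(1)] .
  obtain W' g where g: "\<phi> p \<in> W'" "smooth_fun_on B W' g" "\<eta> = differential B (\<phi> p) g"
    using covector_is_differential[OF assms(2)] .
  have o: "open (W \<inter> W')" using base.smooth_fun_on_open h(2) g(2) by blast
  have "bracket M P (h \<circ> \<phi>) (g \<circ> \<phi>) p = bracket B \<pi> h g (\<phi> p)"
    by (rule poisson_map[OF base.smooth_fun_on_subset[OF h(2) o] base.smooth_fun_on_subset[OF g(2) o]])
      (use h(1) g(1) in auto)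
  then show ?thesis
    unfolding bracket_def h(3) g(3)
    by (simp add: pullback_differential base.smooth_atI[OF h(2,1)] base.smooth_atI[OF g(2,1)])
qed

text \<open>The fibre through a point, which is the leaf through that point.\<close>
abbreviation fibre :: "'m \<Rightarrow> 'm set" where "fibre p \<equiv> \<phi> -` {\<phi> p}"

lemma foliation_tangent_eq: "foliation_tangent M F p = tangent_in M (fibre p) p"
  by (auto simp: foliation_tangent_def leaves_eq)

lemma fibre_leaf: "fibre p \<in> F"
  by (auto simp: leaves_eq)

lemma path_connected_fibre: "path_connected (fibre p)"
  using nci fibre_leaf by (auto simp: nci_system_def abstract_nci_def foliation_def)

lemma tangent_in_fibre_kernel:
  assumes "v \<in> tangent_in M (fibre p) p"
  shows "tangent_map B \<phi> p v = (\<lambda>_. 0)"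
proof
  fix g :: "'n \<Rightarrow> real"
  obtain \<gamma> where g: "v = velocity M \<gamma>" "\<gamma> 0 = p" "\<forall>\<^sub>F t in nhds 0. \<gamma> t \<in> fibre p"
    using assms by (auto simp: tangent_in_def)
  have "\<forall>\<^sub>F t in nhds 0. (g \<circ> \<phi> \<circ> \<gamma>) t = g (\<phi> p)"
    using g(3) by eventually_elim auto
  then have "deriv (g \<circ> \<phi> \<circ> \<gamma>) 0 = deriv (\<lambda>_. g (\<phi> p)) 0" by (rule deriv_cong_ev) simp
  then show "tangent_map B \<phi> p v g = 0" by (simp add: tangent_map_def g(1) velocity_def)
qed

text \<open>
  A first integral is constant on the components of the trace of a leaf; a short piece of a smooth
  curve in the leaf is connected and stays in one component.
\<close>
lemma first_integral_tangent:
  assumes "first_integral M F W f" "p \<in> W" "v \<in> tangent_in M (fibre p) p"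
  shows "v f = 0"
proof -
  obtain \<gamma> where g: "v = velocity M \<gamma>" "smooth_curve M \<gamma>" "\<gamma> 0 = p" "\<forall>\<^sub>F t in nhds 0. \<gamma> t \<in> fibre p"
    using assms(3) by (auto simp: tangent_in_def)
  have "open W" using assms(1) smooth_fun_on_open by (auto simp: first_integral_def)
  obtain e where e: "e > 0" "continuous_on {-e<..<e} \<gamma>" using g(2) by (auto simp: smooth_curve_def)
  have "\<forall>\<^sub>F t in nhds 0. \<gamma> t \<in> W"
    using isCont_eventually_in[OF smooth_curve_isCont[OF g(2)] \<open>open W\<close>] g(3) assms(2) by simp
  with g(4) have "\<forall>\<^sub>F t in nhds 0. \<gamma> t \<in> W \<inter> fibre p" by eventually_elim auto
  then obtain d where d: "d > 0" "\<And>t. dist t 0 < d \<Longrightarrow> \<gamma> t \<in> W \<inter> fibre p"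
    by (auto simp: eventually_nhds_metric)
  define I where "I = ball (0::real) (min d e)"
  have "0 \<in> I" "open I" using d e by (auto simp: I_def)
  have "continuous_on I \<gamma>" using e(2) by (rule continuous_on_subset) (auto simp: I_def dist_real_def)
  then have "connected (\<gamma> ` I)" by (intro connected_continuous_image) (auto simp: I_def)
  moreover have "\<gamma> ` I \<subseteq> W \<inter> fibre p" using d(2) by (auto simp: I_def dist_commute)
  ultimately have "\<gamma> ` I \<subseteq> connected_component_set (W \<inter> fibre p) p"
    using \<open>0 \<in> I\<close> g(3) by (intro connected_component_maximal) auto
  moreover have "f constant_on connected_component_set (W \<inter> fibre p) p"
    using assms(1) fibre_leaf[of p] componentsI[of p "W \<inter> fibre p"] assms(2)
    by (auto simp: first_integral_def)
  ultimately obtain c where "\<And>t. t \<in> I \<Longrightarrow> (f \<circ> \<gamma>) t = c"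
    by (auto simp: constant_on_def subset_iff)
  then have "\<forall>\<^sub>F t in nhds 0. (f \<circ> \<gamma>) t = c"
    using eventually_nhds_in_open[OF \<open>open I\<close> \<open>0 \<in> I\<close>] by (auto elim: eventually_mono)
  then have "deriv (f \<circ> \<gamma>) 0 = deriv (\<lambda>_. c) 0" by (rule deriv_cong_ev) simp
  then show ?thesis by (simp add: g(1) velocity_def)
qed

lemma smooth_fun_continuous_on:
  assumes "smooth_fun_on M W f" shows "continuous_on W f"
proof (rule continuous_at_imp_continuous_on, rule ballI)
  fix q assume q: "q \<in> W"
  obtain U \<psi> where U: "manifold_chart M U \<psi>" "q \<in> U" by (rule obtain_manifold_chart)
  interpret manifold_chart M U \<psi> by fact
  have "continuous_on (U \<inter> W) (\<lambda>x. (f \<circ> inv_chart) (\<psi> x))"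
    by (rule continuous_on_compose2[OF smooth_on_imp_continuous_on[OF smooth_fun_in_chart[OF assms]]])
      (use continuous_chart in \<open>auto intro: continuous_on_subset\<close>)
  then have "continuous_on (U \<inter> W) f" by (rule continuous_on_eq) simp
  moreover have "open (U \<inter> W)" using open_domain smooth_fun_on_open[OF assms] by blast
  ultimately show "isCont f q" using q U(2) by (auto simp: continuous_on_eq_continuous_at)
qed

end

text \<open>A chart around each point in which the fibres are unions of slices parallel to \<open>V\<close>.\<close>
locale foliated_chart = nci r M P B \<pi> \<phi> F + manifold_chart M U \<psi>
  for r and M :: "('m::{t2_space,second_countable_topology}, 'e::euclidean_space) chart set" and P
    and B :: "('n::{t2_space,second_countable_topology}, 'd::euclidean_space) chart set" and \<pi> \<phi> F
    and U :: "'m set" and \<psi> :: "'m \<Rightarrow> 'e" +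
  fixes V :: "'e set"
  assumes subspace: "subspace V"
    and slices: "\<And>L C. L \<in> F \<Longrightarrow> C \<in> components (U \<inter> L) \<Longrightarrow> \<exists>c. C = {q \<in> U. \<psi> q - c \<in> V}"
begin

text \<open>
  The foliation gives the slice through \<open>q\<close> by some base point \<open>c\<close>; as it contains \<open>q\<close>, the base point
  may be \<open>\<psi> q\<close>.
\<close>
lemma component_eq_slice:
  assumes "q \<in> U"
  shows "connected_component_set (U \<inter> fibre q) q = {q' \<in> U. \<psi> q' - \<psi> q \<in> V}"
proof -
  have "connected_component_set (U \<inter> fibre q) q \<in> components (U \<inter> fibre q)"
    using assms by (intro componentsI) auto
  then obtain c where c: "connected_component_set (U \<inter> fibre q) q = {q' \<in> U. \<psi> q' - c \<in> V}"
    using slices[OF fibre_leaf] by blast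
  have "q \<in> connected_component_set (U \<inter> fibre q) q" using assms by simp
  with c have "\<psi> q - c \<in> V" by auto
  then have "\<psi> q' - c \<in> V \<longleftrightarrow> \<psi> q' - \<psi> q \<in> V" for q'
    using subspace_add[OF subspace, of "\<psi> q' - \<psi> q" "\<psi> q - c"] subspace_diff[OF subspace, of "\<psi> q' - c" "\<psi> q - c"]
    by auto
  then show ?thesis using c by auto
qed

lemma slice_in_fibre: "q \<in> U \<Longrightarrow> q' \<in> U \<Longrightarrow> \<psi> q' - \<psi> q \<in> V \<Longrightarrow> \<phi> q' = \<phi> q"
  using component_eq_slice connected_component_subset[of "U \<inter> fibre q" q] by auto

lemma connected_in_slice:
  assumes "connected S" "S \<subseteq> U" "q \<in> S" "q' \<in> S" "\<And>x. x \<in> S \<Longrightarrow> \<phi> x = \<phi> q"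
  shows "\<psi> q' - \<psi> q \<in> V"
proof -
  have "S \<subseteq> connected_component_set (U \<inter> fibre q) q"
    by (rule connected_component_maximal[OF assms(3,1)]) (use assms(2,5) in blast)
  then show ?thesis using component_eq_slice[of q] assms(2-4) by blast
qed

lemma slice_tangent:
  assumes "q \<in> U" "w \<in> V"
  shows "chart_vec q w \<in> tangent_in M (fibre q) q"
proof -
  let ?l = "\<lambda>t. inv_chart (\<psi> q + t *\<^sub>R w)"
  have "\<forall>\<^sub>F t in nhds 0. ?l t \<in> fibre q"
    using line_in_chart(4)[OF assms(1), of w]
  proof eventually_elim
    case (elim t)
    then have "\<psi> (?l t) - \<psi> q \<in> V" using subspace_scale[OF subspace assms(2)] by simp
    then show ?case using slice_in_fibre[OF assms(1)] elim by auto
  qed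
  then show ?thesis
    using line_in_chart(1-3)[OF assms(1), of w] unfolding tangent_in_def by (intro CollectI exI[of _ ?l]) auto
qed

text \<open>
  The kernel of the tangent map is not larger than the tangent space of the slices, because \<open>\<phi>\<close> is a
  submersion: a direction in the kernel is the velocity of a curve in the fibre, and such a curve
  stays in one slice.
\<close>
lemma kernel_in_slice:
  assumes q: "q \<in> U" and ker: "tangent_map B \<phi> q (chart_vec q w) = (\<lambda>_. 0)"
  shows "w \<in> V"
proof -
  obtain Y \<theta> where Y: "manifold_chart B Y \<theta>" "\<phi> q \<in> Y" by (rule base.obtain_manifold_chart)
  interpret Y: manifold_chart B Y \<theta> by fact
  \<comment> \<open>The components of \<open>\<phi>\<close>, and \<open>\<phi>\<close> itself read in the two charts.\<close>
  define y where "y i = (\<lambda>c. \<theta> c \<bullet> i) \<circ> \<phi>" for i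
  have y: "smooth_fun_on M (\<phi> -` Y) (y i)" for i
    unfolding y_def by (intro smooth_pullback Y.smooth_coordinate)
  define S where "S = \<psi> ` (U \<inter> \<phi> -` Y)"
  have S: "open S"
    unfolding S_def using smooth_fun_on_open[OF y] by (rule open_chart_image)
  define f where "f x = (\<Sum>i\<in>Basis. (y i \<circ> inv_chart) x *\<^sub>R i)" for x
  have f: "f x = \<theta> (\<phi> (inv_chart x))" for x
    by (simp add: f_def y_def euclidean_representation)
  have smf: "smooth_on f S"
    unfolding f_def S_def
    by (intro smooth_on_sum S[unfolded S_def] smooth_fun_in_chart[OF y]
        smooth_on_bounded_linear[OF S[unfolded S_def] bounded_linear_scaleR_left])
  have qS: "\<psi> q \<in> S" using q Y(2) by (auto simp: S_def)
  define D where "D = frechet_derivative f (at (\<psi> q))"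
  have ys: "smooth_at M q (y i)" for i using smooth_atI[OF y] Y(2) by simp
  have "(y i \<circ> inv_chart has_derivative (\<lambda>v. chart_vec q v (y i))) (at (\<psi> q))" for i
    using has_derivative_in_chart[OF ys q] ys by (simp add: chart_vec_def)
  then have "(f has_derivative (\<lambda>v. \<Sum>i\<in>Basis. chart_vec q v (y i) *\<^sub>R i)) (at (\<psi> q))"
    unfolding f_def by (intro has_derivative_sum has_derivative_scaleR_left)
  from frechet_derivative_at[OF this, symmetric] have D: "D v = (\<Sum>i\<in>Basis. chart_vec q v (y i) *\<^sub>R i)" for v
    by (simp add: D_def)
  \<comment> \<open>\<open>D\<close> is the tangent map in coordinates.\<close>
  have Dmap: "D v = v'" if "tangent_map B \<phi> q (chart_vec q v) = Y.chart_vec (\<phi> q) v'" for v v'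
  proof (rule euclidean_eqI)
    fix i :: 'd assume i: "i \<in> Basis"
    have "tangent_map B \<phi> q (chart_vec q v) (\<lambda>c. \<theta> c \<bullet> i) = chart_vec q v (y i)"
      using base.smooth_atI[OF Y.smooth_coordinate Y(2)] by (simp add: tangent_map_def y_def)
    then show "D v \<bullet> i = v' \<bullet> i" using i that Y(2) by (simp add: D)
  qed
  have "Y.chart_vec (\<phi> q) 0 = (\<lambda>_. 0)"
    using Y.chart_vec_comb[OF Y(2), of 0 0 0 0] by simp
  then have "D w = 0" using Dmap ker by simp
  moreover have "surj D"
    unfolding surj_def
  proof
    fix v'
    have "Y.chart_vec (\<phi> q) v' \<in> tangent_map B \<phi> q ` tangent_space M q"
      using tangent_map_image Y(2) by auto
    then obtain v where "tangent_map B \<phi> q (chart_vec q v) = Y.chart_vec (\<phi> q) v'"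
      using q by (auto simp: tangent_space_eq)
    then show "\<exists>v. v' = D v" using Dmap by blast
  qed
  ultimately obtain d \<gamma> where g: "d > 0" "\<gamma> 0 = \<psi> q" "continuous_on {-d<..<d} \<gamma>"
    "(\<gamma> has_vector_derivative w) (at 0)" "\<And>t. t \<in> {-d<..<d} \<Longrightarrow> \<gamma> t \<in> S \<and> f (\<gamma> t) = f (\<psi> q)"
    using curve_in_fibre_of_submersion[OF S qS smf, folded D_def] by metis
  have gU: "\<gamma> t \<in> \<psi> ` U" and gY: "\<phi> (inv_chart (\<gamma> t)) \<in> Y" if "t \<in> {-d<..<d}" for t
    using g(5)[OF that] by (auto simp: S_def)
  have gphi: "\<phi> (inv_chart (\<gamma> t)) = \<phi> q" if "t \<in> {-d<..<d}" for t
    using g(5)[OF that] q Y(2) gY[OF that] Y.inv_chart_chart by (metis f inv_chart_chart)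
  have "continuous_on {-d<..<d} (\<lambda>t. inv_chart (\<gamma> t))"
    by (rule continuous_on_compose2[OF continuous_inv_chart g(3)]) (use gU in auto)
  then have conn: "connected ((\<lambda>t. inv_chart (\<gamma> t)) ` {-d<..<d})"
    by (intro connected_continuous_image) auto
  have "\<gamma> t - \<gamma> 0 \<in> V" if t: "t \<in> {-d<..<d}" for t
  proof -
    have "0 \<in> {-d<..<d}" using g(1) by simp
    then have "\<psi> (inv_chart (\<gamma> t)) - \<psi> (inv_chart (\<gamma> 0)) \<in> V"
      using t gU gphi by (intro connected_in_slice[OF conn]) auto
    then show ?thesis using gU t \<open>0 \<in> _\<close> by simp
  qed
  then show ?thesis by (rule derivative_in_subspace[OF subspace g(4,1)])
qed

lemma tangent_in_fibre_iff:
  assumes "q \<in> U"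
  shows "chart_vec q w \<in> tangent_in M (fibre q) q \<longleftrightarrow> w \<in> V"
  using assms kernel_in_slice tangent_in_fibre_kernel slice_tangent by blast

lemma tangent_in_fibreI:
  assumes "q \<in> U" "v \<in> tangent_space M q" "tangent_map B \<phi> q v = (\<lambda>_. 0)"
  shows "v \<in> tangent_in M (fibre q) q"
  using assms kernel_in_slice slice_tangent by (auto simp: tangent_space_eq)

text \<open>Vectors tangent to the fibre only see the values of a function on the slice.\<close>
lemma tangent_slice_cong:
  assumes "q \<in> U" "v \<in> tangent_in M (fibre q) q" "open S" "q \<in> S" "smooth_at M q f" "smooth_at M q g"
    and eq: "\<And>q'. q' \<in> S \<Longrightarrow> q' \<in> U \<Longrightarrow> \<psi> q' - \<psi> q \<in> V \<Longrightarrow> f q' = g q'"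
  shows "v f = v g"
proof -
  obtain w where w: "v = chart_vec q w"
    using assms(1,2) tangent_in_subset tangent_space_eq by blast
  have "w \<in> V" using assms(1,2) tangent_in_fibre_iff w by simp
  let ?l = "\<lambda>t. inv_chart (\<psi> q + t *\<^sub>R w)"
  note l = line_in_chart[OF assms(1), of w]
  have "\<forall>\<^sub>F t in nhds 0. ?l t \<in> S"
    using isCont_eventually_in[OF smooth_curve_isCont[OF l(1)] assms(3)] l(2) assms(4) by simp
  with l(4) have "\<forall>\<^sub>F t in nhds 0. (f \<circ> ?l) t = (g \<circ> ?l) t"
  proof eventually_elim
    case (elim t)
    then have "\<psi> (?l t) - \<psi> q \<in> V" using subspace_scale[OF subspace \<open>w \<in> V\<close>] by simp
    then show ?case using eq elim by simp
  qed
  then have "deriv (f \<circ> ?l) 0 = deriv (g \<circ> ?l) 0" by (rule deriv_cong_ev) simp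
  then show ?thesis
    using assms(5,6) l(2) unfolding w l(3)[symmetric] velocity_def by simp
qed

end

context nci
begin

lemma obtain_foliated_chart:
  obtains U \<psi> V where "foliated_chart r M P B \<pi> \<phi> F U \<psi> V" "p \<in> U"
proof -
  have "foliation M r F" using nci unfolding nci_system_def abstract_nci_def by blast
  then have "\<exists>U \<psi> V. smooth_chart M (U, \<psi>) \<and> p \<in> U \<and> subspace V \<and> dim V = r \<and>
      (\<forall>L\<in>F. \<forall>C\<in>components (U \<inter> L). \<exists>c. C = {q \<in> U. \<psi> q - c \<in> V})"
    unfolding foliation_def by blast
  then obtain U \<psi> V where U: "smooth_chart M (U, \<psi>)" "p \<in> U" "subspace V"
      "\<forall>L\<in>F. \<forall>C\<in>components (U \<inter> L). \<exists>c. C = {q \<in> U. \<psi> q - c \<in> V}"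
    by blast
  have "foliated_chart r M P B \<pi> \<phi> F U \<psi> V"
    by unfold_locales (use U in auto)
  then show ?thesis using that U(2) by blast
qed

text \<open>The tangent space of the fibre is the kernel of the differential of \<open>\<phi>\<close>.\<close>
lemma tangent_in_fibre_iff_kernel:
  "v \<in> tangent_in M (fibre p) p \<longleftrightarrow> v \<in> tangent_space M p \<and> tangent_map B \<phi> p v = (\<lambda>_. 0)"
proof -
  obtain U \<psi> V where U: "foliated_chart r M P B \<pi> \<phi> F U \<psi> V" "p \<in> U" by (rule obtain_foliated_chart)
  interpret U: foliated_chart r M P B \<pi> \<phi> F U \<psi> V by fact
  show ?thesis using U.tangent_in_fibreI[OF U(2)] tangent_in_fibre_kernel tangent_in_subset by blast
qed

end

section \<open>Propagation along the fibres\<close>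

text \<open>
  A foliated chart \<open>(U, \<psi>)\<close> together with first integrals \<open>f 0, \<dots>, f (r-1)\<close> on an open set \<open>W\<close> whose
  Hamiltonian vector fields span the tangent spaces of the fibres.
\<close>
locale foliated_integrals = foliated_chart r M P B \<pi> \<phi> F U \<psi> V
  for r and M :: "('m::{t2_space,second_countable_topology}, 'e::euclidean_space) chart set" and P
    and B :: "('n::{t2_space,second_countable_topology}, 'd::euclidean_space) chart set" and \<pi> \<phi> F
    and U :: "'m set" and \<psi> :: "'m \<Rightarrow> 'e" and V +
  fixes W :: "'m set" and f :: "nat \<Rightarrow> 'm \<Rightarrow> real"
  assumes open_W: "open W"
    and integral: "\<And>i. i < r \<Longrightarrow> first_integral M F W (f i)"
    and tangent_span: "\<And>q. q \<in> W \<Longrightarrow>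
      tangent_in M (fibre q) q = {lin_comb r c (\<lambda>i. hamiltonian M P (f i) q) | c. True}"
begin

abbreviation coordinate where "coordinate i \<equiv> \<lambda>q. \<psi> q \<bullet> i"

lemma smooth_integral: "i < r \<Longrightarrow> smooth_fun_on M W (f i)"
  using integral by (simp add: first_integral_def)

lemma hamiltonian_integral_tangent:
  assumes "q \<in> W" "i < r"
  shows "hamiltonian M P (f i) q \<in> tangent_in M (fibre q) q"
proof -
  have "hamiltonian M P (f i) q = lin_comb r (\<lambda>j. if j = i then 1 else 0) (\<lambda>i. hamiltonian M P (f i) q)"
    using assms(2) by (simp add: lin_comb_def if_distrib[of "\<lambda>x. x * _"] cong: if_cong)
  then show ?thesis using tangent_span[OF assms(1)] by blast
qed

text \<open>The field \<open>X\<^bsub>f\<^sub>j\<^esub>\<close> is tangent to the fibres, on which \<open>f\<^sub>i\<close> is locally constant.\<close>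
lemma integrals_commute:
  assumes "q \<in> W" "i < r" "j < r"
  shows "bracket M P (f i) (f j) q = 0"
  using first_integral_tangent[OF integral assms(1) hamiltonian_integral_tangent[OF assms(1,3)], of i]
    hamiltonian_apply[OF smooth_atI[OF smooth_integral assms(1)], of i "f j"] assms(2) by simp

lemma pullback_integral_commute:
  assumes "smooth_fun_on B Y h" "\<phi> q \<in> Y" "q \<in> W" "j < r"
  shows "bracket M P (h \<circ> \<phi>) (f j) q = 0"
proof -
  have "smooth_at M q (h \<circ> \<phi>)" by (rule smooth_atI[OF smooth_pullback[OF assms(1)]]) (use assms(2) in simp)
  moreover have "smooth_at B (\<phi> q) h" by (rule base.smooth_atI[OF assms(1,2)])
  ultimately show ?thesis
    using tangent_in_fibre_kernel[OF hamiltonian_integral_tangent[OF assms(3,4)], THEN fun_cong, of h]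
    by (simp add: tangent_map_def hamiltonian_apply)
qed

text \<open>
  If \<open>u\<close> commutes with the integrals, then by the Jacobi identity its brackets with the coordinates
  satisfy a linear system along the slices, so that they vanish on a slice if they vanish at one point.
\<close>
lemma propagate_zero:
  assumes p: "p \<in> W'" "W' \<subseteq> U \<inter> W" and u: "smooth_fun_on M W' u"
    and comm: "\<And>q j. q \<in> W' \<Longrightarrow> j < r \<Longrightarrow> bracket M P u (f j) q = 0"
    and zero: "\<And>i. i \<in> Basis \<Longrightarrow> bracket M P u (coordinate i) p = 0"
  obtains W'' where "open W''" "p \<in> W''" "W'' \<subseteq> W'"
    "\<And>q i. q \<in> W'' \<Longrightarrow> \<psi> q - \<psi> p \<in> V \<Longrightarrow> i \<in> Basis \<Longrightarrow> bracket M P u (coordinate i) q = 0"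
proof -
  have oW': "open W'" using u by (rule smooth_fun_on_open)
  have x: "smooth_fun_on M W' (coordinate i)" for i
    by (rule smooth_fun_on_subset[OF smooth_coordinate oW']) (use p in auto)
  have f: "smooth_fun_on M W' (f j)" if "j < r" for j
    by (rule smooth_fun_on_subset[OF smooth_integral[OF that] oW']) (use p in auto)
  define S where "S = \<psi> ` (U \<inter> W')"
  have S: "open S" unfolding S_def by (rule open_chart_image[OF oW'])
  have invS: "inv_chart y \<in> U" "inv_chart y \<in> W'" "\<psi> (inv_chart y) = y" if "y \<in> S" for y
    using that by (auto simp: S_def)
  define G where "G i j = bracket M P (coordinate i) (f j)" for i j
  have G: "smooth_fun_on M W' (G i j)" if "j < r" for i j
    unfolding G_def by (rule bracket_smooth[OF x f[OF that]])
  define b where "b i = bracket M P u (coordinate i)" for i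
  have b: "smooth_fun_on M W' (b i)" for i unfolding b_def by (rule bracket_smooth[OF u x])
  \<comment> \<open>In coordinates, \<open>v\<close> is the vector of the brackets of \<open>u\<close>, and \<open>Y j\<close> is the Hamiltonian field of \<open>f j\<close>.\<close>
  define v where "v y = (\<Sum>i\<in>Basis. (b i \<circ> inv_chart) y *\<^sub>R i)" for y
  define Y where "Y j y = (\<Sum>i\<in>Basis. (G i j \<circ> inv_chart) y *\<^sub>R i)" for j y
  have sm: "smooth_on (\<lambda>y. \<Sum>i\<in>Basis. (g i \<circ> inv_chart) y *\<^sub>R i) S"
    if "\<And>i. smooth_fun_on M W' (g i)" for g :: "'e \<Rightarrow> 'm \<Rightarrow> real"
    unfolding S_def
    by (intro smooth_on_sum S[unfolded S_def] smooth_fun_in_chart[OF that]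
        smooth_on_bounded_linear[OF S[unfolded S_def] bounded_linear_scaleR_left])
  have ham: "hamiltonian M P (f j) q = chart_vec q (Y j (\<psi> q))" if "q \<in> U" for j q
    using that by (simp add: hamiltonian_in_chart[OF manifold_chart_axioms that] Y_def G_def)
  have dv: "(v has_derivative (\<lambda>w. \<Sum>i\<in>Basis. chart_vec (inv_chart y) w (b i) *\<^sub>R i)) (at y)" if "y \<in> S" for y
  proof -
    have "(b i \<circ> inv_chart has_derivative (\<lambda>w. chart_vec (inv_chart y) w (b i))) (at y)" for i
      using has_derivative_in_chart[OF smooth_atI[OF b invS(2)[OF that]] invS(1)[OF that]]
        smooth_atI[OF b invS(2)[OF that]] invS(3)[OF that] by (simp add: chart_vec_def)
    then show ?thesis unfolding v_def by (intro has_derivative_sum has_derivative_scaleR_left)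
  qed
  define C where "C j y = (\<Sum>i\<in>Basis. \<Sum>l\<in>Basis. \<bar>frechet_derivative (G i j \<circ> inv_chart) (at y) l\<bar>)"
    for j and y :: 'e
  \<comment> \<open>\<open>{{u, x\<^sub>i}, f\<^sub>j} = {u, {x\<^sub>i, f\<^sub>j}}\<close> as \<open>{f\<^sub>j, u}\<close> vanishes near \<open>q\<close>; the right-hand side is linear in the \<open>{u, x\<^sub>l}\<close>.\<close>
  have key: "bracket M P (b i) (f j) q = (\<Sum>l\<in>Basis. chart_vec q l (G i j) * b l q)"
    if "q \<in> W'" "j < r" for i j q
  proof -
    have qU: "q \<in> U" using that p by auto
    have "bracket M P (bracket M P (f j) u) (coordinate i) q = 0"
      by (rule bracket_zero[OF oW' that(1)]) (simp add: bracket_skew[of "f j" u] comm that(2))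
    then have "bracket M P (coordinate i) (bracket M P (f j) u) q = 0"
      by (simp add: bracket_skew[of "coordinate i"])
    then have "bracket M P (b i) (f j) q = bracket M P u (G i j) q"
      using jacobi[OF u x f[OF that(2)] that(1), of i]
      by (simp add: b_def G_def bracket_skew[of "bracket M P u (coordinate i)" "f j"])
    also have "\<dots> = P q (differential M q u) (\<lambda>v. \<Sum>l\<in>Basis. chart_vec q l (G i j) * differential M q (coordinate l) v)"
      unfolding bracket_def by (subst differential_expand[OF qU smooth_atI[OF G[OF that(2)] that(1)]]) simp
    also have "\<dots> = (\<Sum>l\<in>Basis. chart_vec q l (G i j) * b l q)"
      using differential_cotangent by (subst bivec_sum_right) (auto simp: b_def bracket_def)
    finally show ?thesis .
  qed
  have bound: "norm (\<Sum>i\<in>Basis. chart_vec (inv_chart y) (Y j y) (b i) *\<^sub>R i) \<le> C j y * norm (v y)"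
    if j: "j < r" and y: "y \<in> S" for j y
  proof -
    let ?q = "inv_chart y"
    note q = invS[OF y]
    have vl: "v y \<bullet> l = b l ?q" if "l \<in> Basis" for l using that by (simp add: v_def)
    have comp: "\<bar>chart_vec ?q (Y j y) (b i)\<bar> \<le>
        (\<Sum>l\<in>Basis. \<bar>frechet_derivative (G i j \<circ> inv_chart) (at y) l\<bar>) * norm (v y)" for i
    proof -
      have "chart_vec ?q (Y j y) (b i) = bracket M P (b i) (f j) ?q"
        using ham[OF q(1)] q(3) hamiltonian_apply[OF smooth_atI[OF b q(2)]] by metis
      also have "\<dots> = (\<Sum>l\<in>Basis. frechet_derivative (G i j \<circ> inv_chart) (at y) l * (v y \<bullet> l))"
        using key[OF q(2) j] vl smooth_atI[OF G[OF j] q(2)] by (simp add: chart_vec_def q(3))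
      finally have "\<bar>chart_vec ?q (Y j y) (b i)\<bar> \<le>
          (\<Sum>l\<in>Basis. \<bar>frechet_derivative (G i j \<circ> inv_chart) (at y) l * (v y \<bullet> l)\<bar>)" by simp
      also have "\<dots> \<le> (\<Sum>l\<in>Basis. \<bar>frechet_derivative (G i j \<circ> inv_chart) (at y) l\<bar> * norm (v y))"
        by (intro sum_mono) (simp add: abs_mult mult_left_mono Basis_le_norm)
      finally show ?thesis by (simp add: sum_distrib_right)
    qed
    have "norm (\<Sum>i\<in>Basis. chart_vec ?q (Y j y) (b i) *\<^sub>R i) \<le> (\<Sum>i\<in>Basis. \<bar>chart_vec ?q (Y j y) (b i)\<bar>)"
      by (rule order_trans[OF norm_le_l1]) (simp add: sum_mono)
    also have "\<dots> \<le> C j y * norm (v y)"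
      unfolding C_def sum_distrib_right by (intro sum_mono comp[unfolded sum_distrib_right])
    finally show ?thesis .
  qed
  have contC: "continuous_on S (C j)" if "j < r" for j
    unfolding C_def S_def
    by (intro continuous_intros smooth_on_imp_continuous_on smooth_on_derivative
        smooth_fun_in_chart[OF G[OF that]])
  have pU: "p \<in> U" "p \<in> W" using p by auto
  have spanV: "\<exists>c. w = (\<Sum>j<r. c j *\<^sub>R Y j (\<psi> p))" if "w \<in> V" for w
  proof -
    have "chart_vec p w \<in> tangent_in M (fibre p) p" using tangent_in_fibre_iff[OF pU(1)] that by simp
    then obtain c where "chart_vec p w = lin_comb r c (\<lambda>i. hamiltonian M P (f i) p)"
      using tangent_span[OF pU(2)] by blast
    also have "\<dots> = chart_vec p (\<Sum>j<r. c j *\<^sub>R Y j (\<psi> p))"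
      by (simp add: lin_comb_def ham[OF pU(1)] chart_vec_sum[OF pU(1)])
    finally show ?thesis using chart_vec_eq_iff[OF pU(1)] by blast
  qed
  have YV: "Y j y \<in> V" if "j < r" "y \<in> S" for j y
  proof -
    have "chart_vec (inv_chart y) (Y j y) \<in> tangent_in M (fibre (inv_chart y)) (inv_chart y)"
      using hamiltonian_integral_tangent[OF _ that(1), of "inv_chart y"] ham[of "inv_chart y" j] invS[OF that(2)] p
      by auto
    then show ?thesis using tangent_in_fibre_iff invS[OF that(2)] by blast
  qed
  have contY: "continuous_on S (Y j)" if "j < r" for j
    unfolding Y_def by (intro smooth_on_imp_continuous_on sm G that)
  have "v (\<psi> p) = 0" using zero pU by (simp add: v_def b_def)
  moreover have "\<psi> p \<in> S" using p pU by (auto simp: S_def)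
  ultimately obtain d where d: "d > 0" "ball (\<psi> p) d \<subseteq> S"
    "\<And>y. y \<in> ball (\<psi> p) d \<Longrightarrow> y - \<psi> p \<in> V \<Longrightarrow> v y = 0"
    using vanish_along_subspace[OF S _ subspace dv contY YV spanV bound contC] by metis
  show ?thesis
  proof
    show "open (U \<inter> \<psi> -` ball (\<psi> p) d)" by (intro open_chart_vimage) simp
    show "p \<in> U \<inter> \<psi> -` ball (\<psi> p) d" using pU d(1) by simp
    show "U \<inter> \<psi> -` ball (\<psi> p) d \<subseteq> W'"
    proof
      fix q assume q: "q \<in> U \<inter> \<psi> -` ball (\<psi> p) d"
      then have "\<psi> q \<in> S" using d(2) by auto
      then show "q \<in> W'" using invS(2)[of "\<psi> q"] q by simp
    qed
    fix q and i :: 'e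
    assume q: "q \<in> U \<inter> \<psi> -` ball (\<psi> p) d" "\<psi> q - \<psi> p \<in> V" and i: "i \<in> Basis"
    have "v (\<psi> q) \<bullet> i = 0" using d(3) q by simp
    then show "bracket M P u (coordinate i) q = 0" using q i by (simp add: v_def b_def)
  qed
qed

end

section \<open>Action vector fields\<close>

context nci
begin

text \<open>The vector field on the fibre over \<open>b\<close> defined by a covector \<open>\<xi>\<close> at \<open>b\<close>.\<close>
definition covector_field :: "'n covec \<Rightarrow> 'm \<Rightarrow> 'm tvec" where
  "covector_field \<xi> p = sharp M P p (pullback M B \<phi> p \<xi>)"

text \<open>
  Along the fibre over \<open>b\<close> the field of \<open>dh\<close> at \<open>b\<close> is \<open>-X\<^bsub>h \<circ> \<phi>\<^esub>\<close>; off this fibre the two are unrelated.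
\<close>
lemma covector_field_apply:
  assumes "smooth_fun_on B Y h" "b \<in> Y" "\<phi> q = b" "smooth_at M q g"
  shows "covector_field (differential B b h) q g = bracket M P (h \<circ> \<phi>) g q"
  using pullback_differential[of q h] base.smooth_atI[OF assms(1,2)] assms(3,4)
  by (simp add: covector_field_def sharp_def bracket_def)

lemma covector_field_not_smooth: "\<not> smooth_at M q g \<Longrightarrow> covector_field \<xi> q g = 0"
  by (simp add: covector_field_def sharp_def)

lemma action_ker_cotangent: "\<xi> \<in> action_ker B \<pi> b \<Longrightarrow> \<xi> \<in> cotangent_space B b"
  by (simp add: action_ker_def)

text \<open>For \<open>\<xi>\<close> in the kernel the field lies in the kernel of \<open>d\<phi>\<close>, since \<open>d\<phi>(X\<^sub>\<xi>) = \<pi>\<^sup>\<sharp>\<xi>\<close>.\<close>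
lemma covector_field_tangent:
  assumes "\<xi> \<in> action_ker B \<pi> (\<phi> p)"
  shows "covector_field \<xi> p \<in> tangent_in M (fibre p) p"
  unfolding tangent_in_fibre_iff_kernel
proof
  note \<xi> = action_ker_cotangent[OF assms]
  show "covector_field \<xi> p \<in> tangent_space M p"
    unfolding covector_field_def by (intro sharp_tangent pullback_cotangent \<xi>)
  show "tangent_map B \<phi> p (covector_field \<xi> p) = (\<lambda>_. 0)"
  proof
    fix g
    show "tangent_map B \<phi> p (covector_field \<xi> p) g = 0"
    proof (cases "smooth_at B (\<phi> p) g")
      case True
      then obtain Y where "\<phi> p \<in> Y" "smooth_fun_on B Y g" by (auto simp: smooth_at_def)
      then have "smooth_at M p (g \<circ> \<phi>)" using smooth_atI[OF smooth_pullback] by auto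
      then have "tangent_map B \<phi> p (covector_field \<xi> p) g = \<pi> (\<phi> p) \<xi> (differential B (\<phi> p) g)"
        using True bivec_pullback[OF \<xi> base.differential_cotangent, of g]
        by (simp add: tangent_map_def covector_field_def sharp_def pullback_differential)
      also have "\<dots> = sharp B \<pi> (\<phi> p) \<xi> g" using True by (simp add: sharp_def)
      also have "\<dots> = 0" using assms by (simp add: action_ker_def)
      finally show ?thesis .
    qed (simp add: tangent_map_def)
  qed
qed

lemma obtain_foliated_integrals:
  obtains U \<psi> V W f where "foliated_integrals r M P B \<pi> \<phi> F U \<psi> V W f" "p \<in> U" "p \<in> W"
proof -
  obtain U \<psi> V where U: "foliated_chart r M P B \<pi> \<phi> F U \<psi> V" "p \<in> U" by (rule obtain_foliated_chart)
  have "abstract_nci r M P F" using nci unfolding nci_system_def by blast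
  then obtain W f where W: "open W" "p \<in> W" "\<forall>i<r. first_integral M F W (f i)"
    "\<forall>q\<in>W. foliation_tangent M F q = {lin_comb r c (\<lambda>i. hamiltonian M P (f i) q) | c. True}"
    unfolding abstract_nci_def by blast
  have "foliated_integrals r M P B \<pi> \<phi> F U \<psi> V W f"
    by (intro foliated_integrals.intro U foliated_integrals_axioms.intro)
      (use W in \<open>auto simp: foliation_tangent_eq\<close>)
  then show ?thesis using that U(2) W(2) by blast
qed

end

context foliated_integrals
begin

text \<open>
  Near \<open>p\<close> a covector field of the kernel is a combination, with constant coefficients along the
  fibre, of the Hamiltonian vector fields of the integrals.
\<close>
lemma covector_field_constant_coefficients:
  assumes p: "p \<in> U" "p \<in> W" and \<xi>: "\<xi> \<in> cotangent_space B (\<phi> p)"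
    and c: "covector_field \<xi> p = lin_comb r c (\<lambda>j. hamiltonian M P (f j) p)"
  obtains W' where "open W'" "p \<in> W'" "W' \<subseteq> U \<inter> W"
    "\<And>q. q \<in> W' \<Longrightarrow> \<psi> q - \<psi> p \<in> V \<Longrightarrow> covector_field \<xi> q = lin_comb r c (\<lambda>j. hamiltonian M P (f j) q)"
proof -
  obtain Y h where h: "\<phi> p \<in> Y" "smooth_fun_on B Y h" "\<xi> = differential B (\<phi> p) h"
    using covector_is_differential[OF \<xi>] .
  define W' where "W' = U \<inter> W \<inter> \<phi> -` Y"
  have oW': "open W'"
    unfolding W'_def using smooth_fun_on_open[OF smooth_pullback[OF h(2)]] open_W open_domain by auto
  have pW': "p \<in> W'" using p h(1) by (simp add: W'_def)
  have sh: "smooth_fun_on M W' (h \<circ> \<phi>)"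
    by (rule smooth_fun_on_subset[OF smooth_pullback[OF h(2)] oW']) (auto simp: W'_def)
  have sf: "smooth_fun_on M W' (f j)" if "j < r" for j
    by (rule smooth_fun_on_subset[OF smooth_integral[OF that] oW']) (auto simp: W'_def)
  \<comment> \<open>The sign is a plus because \<open>X\<^sub>\<xi>(g) = {h \<circ> \<phi>, g}\<close> on the fibre, while \<open>X\<^bsub>f\<^sub>j\<^esub>(g) = {g, f\<^sub>j}\<close>.\<close>
  define s where "s q = (\<Sum>j<r. c j * f j q)" for q
  define u where "u q = (h \<circ> \<phi>) q + s q" for q
  have ss: "smooth_fun_on M W' s" unfolding s_def by (intro smooth_fun_on_sum oW' sf) simp
  have su: "smooth_fun_on M W' u" unfolding u_def by (intro smooth_fun_on_add sh ss)
  have u: "bracket M P u g q = bracket M P (h \<circ> \<phi>) g q + (\<Sum>j<r. c j * bracket M P (f j) g q)"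
    if "q \<in> W'" for g q
  proof -
    have f: "smooth_at M q (f j)" if "j < r" for j using smooth_atI[OF sf[OF that] \<open>q \<in> W'\<close>] .
    note t = hamiltonian_tangent[of g q]
    have "hamiltonian M P g q u = hamiltonian M P g q (h \<circ> \<phi>) + hamiltonian M P g q s"
      unfolding u_def by (rule tangent_add[OF t smooth_atI[OF sh that] smooth_atI[OF ss that]])
    also have "hamiltonian M P g q s = (\<Sum>j<r. c j * hamiltonian M P g q (f j))"
      unfolding s_def by (rule tangent_sum[OF t]) (use f in auto)
    also have "\<dots> = (\<Sum>j<r. c j * bracket M P (f j) g q)"
      using f by (simp add: hamiltonian_apply)
    finally show ?thesis
      by (simp only: hamiltonian_apply[OF smooth_atI[OF sh that]] hamiltonian_apply[OF smooth_atI[OF su that]])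
  qed
  have field: "covector_field \<xi> q g - lin_comb r c (\<lambda>j. hamiltonian M P (f j) q) g = bracket M P u g q"
    if "q \<in> W'" "\<phi> q = \<phi> p" "smooth_at M q g" for q g
    using covector_field_apply[OF h(2,1) that(2,3)] that(3)
    by (simp add: h(3) u[OF that(1)] lin_comb_def hamiltonian_apply bracket_skew[of g] sum_negf)
  have "bracket M P u (coordinate i) p = 0" for i
    using field[OF pW' refl smooth_atI[OF smooth_coordinate p(1)]] c by simp
  moreover have "bracket M P u (f j) q = 0" if "q \<in> W'" "j < r" for q j
  proof -
    have "bracket M P (h \<circ> \<phi>) (f j) q = 0"
      using that by (intro pullback_integral_commute[OF h(2)]) (auto simp: W'_def)
    then show ?thesis using that integrals_commute[of q _ j] by (simp add: u W'_def)
  qed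
  ultimately obtain W'' where W'': "open W''" "p \<in> W''" "W'' \<subseteq> W'"
    "\<And>q i. q \<in> W'' \<Longrightarrow> \<psi> q - \<psi> p \<in> V \<Longrightarrow> i \<in> Basis \<Longrightarrow> bracket M P u (coordinate i) q = 0"
    using propagate_zero[OF pW' _ su, of thesis] by (auto simp: W'_def)
  show ?thesis
  proof
    show "open W''" "p \<in> W''" "W'' \<subseteq> U \<inter> W" using W'' by (auto simp: W'_def)
    fix q assume q: "q \<in> W''" "\<psi> q - \<psi> p \<in> V"
    have qW': "q \<in> W'" and qU: "q \<in> U" using q W''(3) by (auto simp: W'_def)
    show "covector_field \<xi> q = lin_comb r c (\<lambda>j. hamiltonian M P (f j) q)"
    proof
      fix g
      show "covector_field \<xi> q g = lin_comb r c (\<lambda>j. hamiltonian M P (f j) q) g"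
      proof (cases "smooth_at M q g")
        case True
        have "bracket M P u g q = sharp M P q (differential M q u) g"
          using True by (simp add: sharp_def bracket_def)
        also have "\<dots> = chart_vec q 0 g"
          using W''(4)[OF q]
          by (simp add: sharp_in_chart[OF manifold_chart_axioms qU differential_cotangent] bracket_def)
        also have "\<dots> = 0"
          using chart_vec_comb[OF qU, of 0 0 0 0] by simp
        finally show ?thesis
          using field[OF qW' slice_in_fibre[OF p(1) qU q(2)] True] by simp
      qed (simp add: covector_field_not_smooth lin_comb_def hamiltonian_def)
    qed
  qed
qed

end

context nci
begin

text \<open>
  The zero set of a covector field on a fibre is closed, and it is open by propagation; the fibre is
  connected.
\<close>
lemma covector_field_zero_on_fibre:
  assumes \<xi>: "\<xi> \<in> cotangent_space B b" and b: "\<phi> p = b" "\<phi> q = b"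
    and zero: "covector_field \<xi> p = (\<lambda>_. 0)"
  shows "covector_field \<xi> q = (\<lambda>_. 0)"
proof -
  obtain Y h where h: "b \<in> Y" "smooth_fun_on B Y h" "\<xi> = differential B b h"
    using covector_is_differential[OF \<xi>] .
  obtain \<gamma> where g: "path \<gamma>" "path_image \<gamma> \<subseteq> fibre p" "pathstart \<gamma> = p" "pathfinish \<gamma> = q"
    using path_connected_fibre[of p] b unfolding path_connected_def by (metis vimage_singleton_eq)
  have contg: "continuous_on {0..1} \<gamma>" using g(1) by (simp add: path_def)
  have gb: "\<phi> (\<gamma> t) = b" if "t \<in> {0..1}" for t
    using subsetD[OF g(2), of "\<gamma> t"] b that by (simp add: path_image_def)
  have "covector_field \<xi> (\<gamma> 1) = (\<lambda>_. 0)"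
  proof (rule connected_induction_simple[of "{0..1::real}" 0 1 "\<lambda>t. covector_field \<xi> (\<gamma> t) = (\<lambda>_. 0)"])
    show "covector_field \<xi> (\<gamma> 0) = (\<lambda>_. 0)" using zero g(3) by (simp add: pathstart_def)
    fix t :: real assume t: "t \<in> {0..1}"
    show "\<exists>T. openin (top_of_set {0..1}) T \<and> t \<in> T \<and> (\<forall>x\<in>T. \<forall>y\<in>T.
        covector_field \<xi> (\<gamma> x) = (\<lambda>_. 0) \<longrightarrow> covector_field \<xi> (\<gamma> y) = (\<lambda>_. 0))"
    proof (cases "covector_field \<xi> (\<gamma> t) = (\<lambda>_. 0)")
      case True
      obtain U \<psi> V W f where U: "foliated_integrals r M P B \<pi> \<phi> F U \<psi> V W f" "\<gamma> t \<in> U" "\<gamma> t \<in> W"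
        by (rule obtain_foliated_integrals)
      interpret U: foliated_integrals r M P B \<pi> \<phi> F U \<psi> V W f by fact
      have \<xi>': "\<xi> \<in> cotangent_space B (\<phi> (\<gamma> t))" using \<xi> by (simp add: gb[OF t])
      have c0: "covector_field \<xi> (\<gamma> t) = lin_comb r (\<lambda>_. 0) (\<lambda>j. hamiltonian M P (f j) (\<gamma> t))"
        by (simp add: True lin_comb_def)
      obtain W' where W': "open W'" "\<gamma> t \<in> W'" "W' \<subseteq> U \<inter> W"
        "\<And>q. q \<in> W' \<Longrightarrow> \<psi> q - \<psi> (\<gamma> t) \<in> V \<Longrightarrow>
          covector_field \<xi> q = lin_comb r (\<lambda>_. 0) (\<lambda>j. hamiltonian M P (f j) q)"
        by (rule U.covector_field_constant_coefficients[OF U(2,3) \<xi>' c0]) blast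
      have "openin (top_of_set {0..1}) ({0..1} \<inter> \<gamma> -` W')"
        using continuous_openin_preimage_gen[OF contg W'(1)] .
      then obtain e where e: "e > 0" "ball t e \<inter> {0..1} \<subseteq> {0..1} \<inter> \<gamma> -` W'"
        using t W'(2) unfolding openin_contains_ball by (metis IntI vimageI)
      define T where "T = {0..1} \<inter> ball t e"
      have "connected (\<gamma> ` T)"
        using contg by (intro connected_continuous_image convex_connected)
          (auto simp: T_def intro: continuous_on_subset convex_Int)
      have "covector_field \<xi> (\<gamma> s) = (\<lambda>_. 0)" if "s \<in> T" for s
      proof -
        have "\<psi> (\<gamma> s) - \<psi> (\<gamma> t) \<in> V"
        proof (rule U.connected_in_slice[OF \<open>connected (\<gamma> ` T)\<close>])
          show "\<gamma> ` T \<subseteq> U" using e(2) W'(3) by (auto simp: T_def)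
          show "\<gamma> t \<in> \<gamma> ` T" "\<gamma> s \<in> \<gamma> ` T" using t e(1) that by (auto simp: T_def)
          show "\<phi> x = \<phi> (\<gamma> t)" if "x \<in> \<gamma> ` T" for x using gb t that by (auto simp: T_def)
        qed
        then show ?thesis using W'(4)[of "\<gamma> s"] e(2) that by (auto simp: T_def lin_comb_def)
      qed
      then show ?thesis
        using t e(1) by (intro exI[of _ T]) (auto simp: T_def intro: openin_open_Int)
    next
      case False
      then obtain g where g: "covector_field \<xi> (\<gamma> t) g \<noteq> 0" by auto
      then have "smooth_at M (\<gamma> t) g" using covector_field_not_smooth by blast
      then obtain W where W: "\<gamma> t \<in> W" "smooth_fun_on M W g" by (auto simp: smooth_at_def)
      define D where "D = W \<inter> \<phi> -` Y"
      have oD: "open D"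
        unfolding D_def using smooth_fun_on_open W(2) smooth_pullback[OF h(2)] by blast
      have "smooth_fun_on M D (h \<circ> \<phi>)"
        by (rule smooth_fun_on_subset[OF smooth_pullback[OF h(2)] oD]) (simp add: D_def)
      moreover have "smooth_fun_on M D g"
        by (rule smooth_fun_on_subset[OF W(2) oD]) (simp add: D_def)
      ultimately have "continuous_on D (bracket M P (h \<circ> \<phi>) g)"
        by (intro smooth_fun_continuous_on bracket_smooth)
      then have oO: "open (D \<inter> bracket M P (h \<circ> \<phi>) g -` (- {0}))"
        using oD by (rule continuous_open_preimage) auto
      have eq: "covector_field \<xi> q g = bracket M P (h \<circ> \<phi>) g q" if "q \<in> D" "\<phi> q = b" for q
        using covector_field_apply[OF h(2,1) that(2)] smooth_atI[OF W(2)] that(1) h(3) by (auto simp: D_def)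
      define T where "T = {0..1} \<inter> \<gamma> -` (D \<inter> bracket M P (h \<circ> \<phi>) g -` (- {0}))"
      have "\<gamma> t \<in> D" using W(1) gb[OF t] h(1) by (simp add: D_def)
      then have "t \<in> T" using t g eq[OF _ gb[OF t]] by (simp add: T_def)
      moreover have "covector_field \<xi> (\<gamma> s) \<noteq> (\<lambda>_. 0)" if "s \<in> T" for s
      proof -
        have "covector_field \<xi> (\<gamma> s) g \<noteq> 0" using that eq[of "\<gamma> s"] gb[of s] by (simp add: T_def)
        then show ?thesis by auto
      qed
      moreover have "openin (top_of_set {0..1}) T"
        unfolding T_def using continuous_openin_preimage_gen[OF contg oO] .
      ultimately show ?thesis by blast
    qed
  qed auto
  then show ?thesis using g(4) by (simp add: pathfinish_def)
qed

section \<open>The fibres of the action bundle\<close>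

lemma covector_field_comb:
  assumes "\<xi> \<in> cotangent_space B (\<phi> p)" "\<eta> \<in> cotangent_space B (\<phi> p)"
  shows "covector_field (\<lambda>v. a * \<xi> v + b * \<eta> v) p = (\<lambda>g. a * covector_field \<xi> p g + b * covector_field \<eta> p g)"
proof -
  have "pullback M B \<phi> p (\<lambda>v. a * \<xi> v + b * \<eta> v) =
      (\<lambda>v. a * pullback M B \<phi> p \<xi> v + b * pullback M B \<phi> p \<eta> v)"
    by (auto simp: pullback_def)
  then show ?thesis
    using bivec_comb[OF pullback_cotangent[OF assms(1)] pullback_cotangent[OF assms(2)] differential_cotangent]
    by (auto simp: covector_field_def sharp_def)
qed

lemma action_ker_comb:
  assumes "\<xi> \<in> action_ker B \<pi> b" "\<eta> \<in> action_ker B \<pi> b"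
  shows "(\<lambda>v. a * \<xi> v + c * \<eta> v) \<in> action_ker B \<pi> b"
proof -
  note cot = assms[THEN action_ker_cotangent]
  have "sharp B \<pi> b (\<lambda>v. a * \<xi> v + c * \<eta> v) g = a * sharp B \<pi> b \<xi> g + c * sharp B \<pi> b \<eta> g" for g
    using base.bivec_comb[OF cot base.differential_cotangent] by (simp add: sharp_def)
  then show ?thesis
    using assms base.cotangent_comb[OF cot] by (simp add: action_ker_def fun_eq_iff)
qed

lemma action_ker_zero: "(\<lambda>_. 0) \<in> action_ker B \<pi> b"
  by (auto simp: action_ker_def base.cotangent_zero sharp_def base.bivec_zero base.differential_cotangent)

lemma covector_field_zero: "covector_field (\<lambda>_. 0) p = (\<lambda>_. 0)"
  using covector_field_comb[of "\<lambda>_. 0" p "\<lambda>_. 0" 0 0] by (simp add: base.cotangent_zero)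

lemma lin_comb_action_ker:
  assumes "\<And>i. i < k \<Longrightarrow> \<xi> i \<in> action_ker B \<pi> (\<phi> p)"
  shows "lin_comb k c \<xi> \<in> action_ker B \<pi> (\<phi> p) \<and>
    covector_field (lin_comb k c \<xi>) p = lin_comb k c (\<lambda>i. covector_field (\<xi> i) p)"
  using assms
proof (induction k)
  case 0
  then show ?case by (simp add: lin_comb_def action_ker_zero covector_field_zero)
next
  case (Suc k)
  have eq: "lin_comb (Suc k) c \<xi> = (\<lambda>v. 1 * lin_comb k c \<xi> v + c k * \<xi> k v)"
    by (simp add: lin_comb_def)
  note IH = Suc.IH[OF Suc.prems[OF less_SucI]]
  note k = Suc.prems[of k, OF lessI]
  have "covector_field (lin_comb (Suc k) c \<xi>) p =
      (\<lambda>g. 1 * covector_field (lin_comb k c \<xi>) p g + c k * covector_field (\<xi> k) p g)"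
    unfolding eq using IH k by (intro covector_field_comb action_ker_cotangent) auto
  then show ?case
    using action_ker_comb[of "lin_comb k c \<xi>" "\<phi> p" "\<xi> k" 1 "c k"] IH k by (simp add: lin_comb_def)
qed

text \<open>
  Two covectors of the kernel define the same element of the fibre of the action bundle as soon as
  their vector fields agree at one point of the fibre of \<open>\<phi>\<close>.
\<close>
lemma action_rel_iff:
  assumes "\<phi> p = b"
  shows "(\<xi>, \<eta>) \<in> action_rel M P B \<pi> \<phi> b \<longleftrightarrow>
    \<xi> \<in> action_ker B \<pi> b \<and> \<eta> \<in> action_ker B \<pi> b \<and> covector_field \<xi> p = covector_field \<eta> p"
proof (cases "\<xi> \<in> action_ker B \<pi> b \<and> \<eta> \<in> action_ker B \<pi> b")
  case True
  then have ker: "\<xi> \<in> action_ker B \<pi> b" "\<eta> \<in> action_ker B \<pi> b" by auto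
  have diff: "(\<lambda>v. \<eta> v - \<xi> v) = (\<lambda>v. 1 * \<eta> v + (-1) * \<xi> v)" by simp
  have cot: "(\<lambda>v. \<eta> v - \<xi> v) \<in> cotangent_space B b"
    unfolding diff by (intro base.cotangent_comb action_ker_cotangent ker)
  have "(\<lambda>v. \<eta> v - \<xi> v) \<in> action_null M P B \<phi> b \<longleftrightarrow>
      (\<forall>q\<in>\<phi> -` {b}. covector_field (\<lambda>v. \<eta> v - \<xi> v) q = (\<lambda>_. 0))"
    using cot by (simp add: action_null_def covector_field_def)
  also have "\<dots> \<longleftrightarrow> covector_field (\<lambda>v. \<eta> v - \<xi> v) p = (\<lambda>_. 0)"
    using covector_field_zero_on_fibre[OF cot assms] assms by blast
  also have "covector_field (\<lambda>v. \<eta> v - \<xi> v) p = (\<lambda>g. covector_field \<eta> p g - covector_field \<xi> p g)"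
    unfolding diff using covector_field_comb[of \<eta> p \<xi> 1 "-1"] ker[THEN action_ker_cotangent] assms by simp
  also have "\<dots> = (\<lambda>_. 0) \<longleftrightarrow> covector_field \<xi> p = covector_field \<eta> p"
    by (metis (no_types, lifting) eq_iff_diff_eq_0 ext)
  finally have "(\<lambda>v. \<eta> v - \<xi> v) \<in> action_null M P B \<phi> b \<longleftrightarrow> covector_field \<xi> p = covector_field \<eta> p" .
  then show ?thesis using True by (auto simp: action_rel_def)
qed (auto simp: action_rel_def)

lemma action_class_eq:
  assumes "\<phi> p = b" "\<xi> \<in> action_ker B \<pi> b"
  shows "action_rel M P B \<pi> \<phi> b `` {\<xi>} = {\<eta> \<in> action_ker B \<pi> b. covector_field \<eta> p = covector_field \<xi> p}"
proof (rule set_eqI)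
  fix \<eta>
  show "\<eta> \<in> action_rel M P B \<pi> \<phi> b `` {\<xi>} \<longleftrightarrow>
      \<eta> \<in> {\<eta> \<in> action_ker B \<pi> b. covector_field \<eta> p = covector_field \<xi> p}"
    unfolding Image_singleton_iff action_rel_iff[OF assms(1)] mem_Collect_eq using assms(2) by metis
qed

text \<open>A representative \<open>\<xi>\<close> of \<open>\<alpha>\<close> that computes the action field at all points of the fibre.\<close>
lemma action_fiber_cases:
  assumes "\<alpha> \<in> action_fiber M P B \<pi> \<phi> b"
  obtains \<xi> where "\<xi> \<in> action_ker B \<pi> b" "\<alpha> = action_rel M P B \<pi> \<phi> b `` {\<xi>}"
    "\<And>p. \<phi> p = b \<Longrightarrow> action_field M P B \<phi> \<alpha> p = covector_field \<xi> p"
proof -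
  obtain \<xi> where \<xi>: "\<xi> \<in> action_ker B \<pi> b" "\<alpha> = action_rel M P B \<pi> \<phi> b `` {\<xi>}"
    using assms by (auto simp: action_fiber_def elim: quotientE)
  have "action_field M P B \<phi> \<alpha> p = covector_field \<xi> p" if "\<phi> p = b" for p
  proof -
    have \<alpha>: "\<alpha> = {\<eta> \<in> action_ker B \<pi> b. covector_field \<eta> p = covector_field \<xi> p}"
      using \<xi> action_class_eq[OF that] by simp
    then have "\<xi> \<in> \<alpha>" using \<xi>(1) by simp
    then have "(SOME \<xi>. \<xi> \<in> \<alpha>) \<in> \<alpha>" by (rule someI[of "\<lambda>\<xi>. \<xi> \<in> \<alpha>"])
    then show ?thesis using \<alpha> by (auto simp: action_field_def covector_field_def)
  qed
  then show ?thesis using that \<xi> by blast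
qed

text \<open>An element of \<open>E\<^sub>b\<close> is determined by the value of its action field at one point.\<close>
lemma action_field_class:
  assumes "\<alpha> \<in> action_fiber M P B \<pi> \<phi> b" "\<phi> p = b"
  shows "\<alpha> = {\<eta> \<in> action_ker B \<pi> b. covector_field \<eta> p = action_field M P B \<phi> \<alpha> p}"
proof -
  obtain \<xi> where \<xi>: "\<xi> \<in> action_ker B \<pi> b" "\<alpha> = action_rel M P B \<pi> \<phi> b `` {\<xi>}"
    "\<And>p. \<phi> p = b \<Longrightarrow> action_field M P B \<phi> \<alpha> p = covector_field \<xi> p"
    by (rule action_fiber_cases[OF assms(1)]) blast
  show ?thesis
    unfolding \<xi>(3)[OF assms(2)] using \<xi>(2) action_class_eq[OF assms(2) \<xi>(1)] by (rule trans)
qed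

lemma action_zero_eq:
  assumes "\<phi> p = b"
  shows "action_zero M P B \<pi> \<phi> b = {\<eta> \<in> action_ker B \<pi> b. covector_field \<eta> p = (\<lambda>_. 0)}"
  unfolding action_zero_def using action_class_eq[OF assms action_ker_zero] unfolding covector_field_zero .

lemma action_comb_eq:
  assumes "\<phi> p = b" "\<And>i. i < k \<Longrightarrow> \<alpha> i \<in> action_fiber M P B \<pi> \<phi> b"
  shows "action_comb M P B \<pi> \<phi> b k c \<alpha> =
    {\<eta> \<in> action_ker B \<pi> b. covector_field \<eta> p = lin_comb k c (\<lambda>i. action_field M P B \<phi> (\<alpha> i) p)}"
proof -
  have \<alpha>: "\<alpha> i = {\<eta> \<in> action_ker B \<pi> b. covector_field \<eta> p = action_field M P B \<phi> (\<alpha> i) p}" if "i < k" for i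
    using action_field_class[OF assms(2)[OF that] assms(1)] .
  have *: "lin_comb k c \<xi> \<in> action_ker B \<pi> b \<and>
      covector_field (lin_comb k c \<xi>) p = lin_comb k c (\<lambda>i. action_field M P B \<phi> (\<alpha> i) p)"
    if "\<forall>i<k. \<xi> i \<in> \<alpha> i" for \<xi>
  proof -
    have \<xi>: "\<xi> i \<in> action_ker B \<pi> (\<phi> p)" "covector_field (\<xi> i) p = action_field M P B \<phi> (\<alpha> i) p" if "i < k" for i
      using \<alpha>[OF that] \<open>\<forall>i<k. \<xi> i \<in> \<alpha> i\<close> that assms(1) by auto
    show ?thesis
      using lin_comb_action_ker[OF \<xi>(1)] \<xi>(2) assms(1) by (simp add: lin_comb_def)
  qed
  have "\<exists>\<xi>. \<forall>i<k. \<xi> i \<in> \<alpha> i"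
  proof -
    have "\<exists>\<eta>. \<eta> \<in> \<alpha> i" if "i < k" for i
      using action_fiber_cases[OF assms(2)[OF that]] action_class_eq[OF assms(1)] by (metis (mono_tags, lifting) mem_Collect_eq)
    then show ?thesis by metis
  qed
  then obtain \<xi> where \<xi>: "\<forall>i<k. \<xi> i \<in> \<alpha> i" ..
  show ?thesis
  proof (intro equalityI subsetI)
    fix \<eta> assume "\<eta> \<in> action_comb M P B \<pi> \<phi> b k c \<alpha>"
    then obtain \<xi> where "\<forall>i<k. \<xi> i \<in> \<alpha> i" "(lin_comb k c \<xi>, \<eta>) \<in> action_rel M P B \<pi> \<phi> b"
      by (auto simp: action_comb_def)
    then show "\<eta> \<in> {\<eta> \<in> action_ker B \<pi> b. covector_field \<eta> p = lin_comb k c (\<lambda>i. action_field M P B \<phi> (\<alpha> i) p)}"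
      using * action_rel_iff[OF assms(1)] by auto
  next
    fix \<eta> assume "\<eta> \<in> {\<eta> \<in> action_ker B \<pi> b. covector_field \<eta> p = lin_comb k c (\<lambda>i. action_field M P B \<phi> (\<alpha> i) p)}"
    then have "(lin_comb k c \<xi>, \<eta>) \<in> action_rel M P B \<pi> \<phi> b"
      using *[OF \<xi>] action_rel_iff[OF assms(1)] by auto
    then show "\<eta> \<in> action_comb M P B \<pi> \<phi> b k c \<alpha>"
      using \<xi> by (auto simp: action_comb_def)
  qed
qed

text \<open>
  The annihilator of the tangent space of the fibre consists of pullbacks, by the surjectivity of \<open>d\<phi>\<close>
  and because \<open>d\<phi>\<close> has no larger kernel.
\<close>
lemma covector_of_annihilator:
  assumes \<eta>: "\<eta> \<in> cotangent_space M p" and ann: "\<And>v. v \<in> tangent_in M (fibre p) p \<Longrightarrow> \<eta> v = 0"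
  obtains \<zeta> where "\<zeta> \<in> cotangent_space B (\<phi> p)" "pullback M B \<phi> p \<zeta> = \<eta>"
proof -
  let ?T = "tangent_map B \<phi> p"
  define \<zeta> where "\<zeta> v' = (if v' \<in> tangent_space B (\<phi> p)
      then \<eta> (SOME v. v \<in> tangent_space M p \<and> ?T v = v') else 0)" for v'
  have comb: "\<eta> (\<lambda>f. a * v f + b * w f) = a * \<eta> v + b * \<eta> w"
    if "v \<in> tangent_space M p" "w \<in> tangent_space M p" for a b v w
    using \<eta> that by (simp add: cotangent_space_def)
  have \<zeta>: "\<zeta> (?T v) = \<eta> v" if v: "v \<in> tangent_space M p" for v
  proof -
    define w where "w = (SOME w. w \<in> tangent_space M p \<and> ?T w = ?T v)"
    have w: "w \<in> tangent_space M p" "?T w = ?T v"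
      using someI[of "\<lambda>w. w \<in> tangent_space M p \<and> ?T w = ?T v" v] v by (auto simp: w_def)
    have "(\<lambda>f. 1 * v f + (-1) * w f) \<in> tangent_in M (fibre p) p"
      unfolding tangent_in_fibre_iff_kernel tangent_map_comb using tangent_space_comb[OF v w(1), of 1 "-1"] w(2) by simp
    then have "\<eta> v = \<eta> w" using ann comb[OF v w(1), of 1 "-1"] by simp
    then show ?thesis using tangent_map_tangent[OF v] by (simp add: \<zeta>_def w_def)
  qed
  have "\<zeta> \<in> cotangent_space B (\<phi> p)"
    unfolding cotangent_space_def
  proof (intro CollectI conjI ballI allI impI)
    fix v' w' and a b :: real
    assume "v' \<in> tangent_space B (\<phi> p)" "w' \<in> tangent_space B (\<phi> p)"
    then obtain v w where vw: "v \<in> tangent_space M p" "v' = ?T v" "w \<in> tangent_space M p" "w' = ?T w"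
      using tangent_map_image by blast
    show "\<zeta> (\<lambda>f. a * v' f + b * w' f) = a * \<zeta> v' + b * \<zeta> w'"
      unfolding vw tangent_map_comb[symmetric]
      using \<zeta>[OF tangent_space_comb[OF vw(1,3)]] \<zeta> vw comb by simp
  qed (simp add: \<zeta>_def)
  moreover have "pullback M B \<phi> p \<zeta> = \<eta>"
    using \<zeta> \<eta> by (auto simp: pullback_def cotangent_space_def)
  ultimately show ?thesis using that by blast
qed

text \<open>
  The Hamiltonian fields of the integrals span the tangent space of the fibre, and the differentials of
  the integrals are pullbacks of covectors in \<open>Ker \<pi>\<^sup>\<sharp>\<close>.
\<close>
lemma covector_field_surj:
  assumes v: "v \<in> tangent_in M (fibre p) p"
  obtains \<xi> where "\<xi> \<in> action_ker B \<pi> (\<phi> p)" "covector_field \<xi> p = v"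
proof -
  obtain U \<psi> V W f where U: "foliated_integrals r M P B \<pi> \<phi> F U \<psi> V W f" "p \<in> U" "p \<in> W"
    by (rule obtain_foliated_integrals)
  interpret U: foliated_integrals r M P B \<pi> \<phi> F U \<psi> V W f by fact
  obtain c where c: "v = lin_comb r c (\<lambda>i. hamiltonian M P (f i) p)"
    using U.tangent_span[OF U(3)] v by blast
  \<comment> \<open>The sign comes from \<open>P\<^sup>\<sharp>(df) = -X\<^sub>f\<close>.\<close>
  define \<eta> where "\<eta> = (\<lambda>w. \<Sum>j<r. - c j * differential M p (f j) w)"
  have \<eta>: "\<eta> \<in> cotangent_space M p"
    unfolding \<eta>_def by (intro cotangent_sum differential_cotangent) simp
  have sharp: "sharp M P p \<eta> = v"
  proof
    fix g
    show "sharp M P p \<eta> g = v g"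
      using bivec_sum[of "{..<r}" "\<lambda>j. differential M p (f j)" p "differential M p g" "\<lambda>j. - c j"]
        bracket_skew[of g _ p]
      by (simp add: sharp_def \<eta>_def differential_cotangent c lin_comb_def hamiltonian_def bracket_def sum_negf)
  qed
  have "\<eta> w = 0" if "w \<in> tangent_in M (fibre p) p" for w
    using first_integral_tangent[OF U.integral U(3) that]
    by (auto simp: \<eta>_def differential_def intro!: sum.neutral)
  then obtain \<zeta> where \<zeta>: "\<zeta> \<in> cotangent_space B (\<phi> p)" "pullback M B \<phi> p \<zeta> = \<eta>"
    using covector_of_annihilator[OF \<eta>] by blast
  have "sharp B \<pi> (\<phi> p) \<zeta> g = 0" for g
  proof (cases "smooth_at B (\<phi> p) g")
    case True
    then obtain Y where "\<phi> p \<in> Y" "smooth_fun_on B Y g" by (auto simp: smooth_at_def)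
    then have "smooth_at M p (g \<circ> \<phi>)" using smooth_atI[OF smooth_pullback] by auto
    then have "sharp B \<pi> (\<phi> p) \<zeta> g = sharp M P p \<eta> (g \<circ> \<phi>)"
      using bivec_pullback[OF \<zeta>(1) base.differential_cotangent, of g] True
      by (simp add: sharp_def \<zeta>(2) pullback_differential)
    also have "\<dots> = tangent_map B \<phi> p v g" using True by (simp add: sharp tangent_map_def)
    finally show ?thesis by (simp add: tangent_in_fibre_kernel[OF v])
  qed (simp add: sharp_def)
  then have "\<zeta> \<in> action_ker B \<pi> (\<phi> p)" using \<zeta>(1) by (auto simp: action_ker_def)
  then show ?thesis using that by (simp add: covector_field_def \<zeta>(2) sharp)
qed

lemma action_fields_basis:
  assumes "is_basis (action_fiber M P B \<pi> \<phi> (\<phi> m)) (action_zero M P B \<pi> \<phi> (\<phi> m))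
    (action_comb M P B \<pi> \<phi> (\<phi> m)) k \<alpha>"
  shows "is_basis (tangent_in M (fibre m) m) (\<lambda>_. 0) lin_comb k (\<lambda>i. action_field M P B \<phi> (\<alpha> i) m)"
proof -
  let ?b = "\<phi> m"
  let ?X = "\<lambda>i. action_field M P B \<phi> (\<alpha> i) m"
  have \<alpha>: "\<And>i. i < k \<Longrightarrow> \<alpha> i \<in> action_fiber M P B \<pi> \<phi> ?b"
    and ind: "\<And>c. action_comb M P B \<pi> \<phi> ?b k c \<alpha> = action_zero M P B \<pi> \<phi> ?b \<Longrightarrow> \<forall>i<k. c i = 0"
    and span: "\<And>x. x \<in> action_fiber M P B \<pi> \<phi> ?b \<Longrightarrow> \<exists>c. x = action_comb M P B \<pi> \<phi> ?b k c \<alpha>"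
    using assms by (auto simp: is_basis_def)
  note comb = action_comb_eq[where p = m, OF refl \<alpha>]
  show ?thesis
    unfolding is_basis_def
  proof (intro conjI allI ballI impI)
    fix i assume "i < k"
    then show "?X i \<in> tangent_in M (fibre m) m"
      using action_fiber_cases[OF \<alpha>] covector_field_tangent by (metis refl)
  next
    fix c i assume "lin_comb k c ?X = (\<lambda>_. 0)" "i < k"
    then show "c i = 0" using ind[of c] comb action_zero_eq[of m ?b] by simp
  next
    fix v assume "v \<in> tangent_in M (fibre m) m"
    then obtain \<xi> where \<xi>: "\<xi> \<in> action_ker B \<pi> ?b" "covector_field \<xi> m = v"
      by (rule covector_field_surj)
    let ?x = "action_rel M P B \<pi> \<phi> ?b `` {\<xi>}"
    have "?x \<in> action_fiber M P B \<pi> \<phi> ?b" using \<xi>(1) by (simp add: action_fiber_def quotientI)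
    then obtain c where "?x = action_comb M P B \<pi> \<phi> ?b k c \<alpha>" using span by blast
    moreover have "\<xi> \<in> ?x" using action_class_eq[OF refl \<xi>(1)] \<xi>(1) by simp
    ultimately show "\<exists>c. v = lin_comb k c ?X" using comb \<xi>(2) by auto
  qed
qed

lemma action_field_nonzero:
  assumes "\<alpha> \<in> action_fiber M P B \<pi> \<phi> b" "\<alpha> \<noteq> action_zero M P B \<pi> \<phi> b" "\<phi> p = b"
  shows "action_field M P B \<phi> \<alpha> p \<noteq> (\<lambda>_. 0)"
  using action_field_class[OF assms(1,3)] action_zero_eq[OF assms(3)] assms(2) by metis

section \<open>Action vector fields commute\<close>

text \<open>
  The value of a tangent field on a function of the fibre does not depend on the extension chosen in
  \<open>field_apply\<close>.
\<close>
lemma field_apply_extension: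
  assumes "X p \<in> tangent_in M (fibre p) p" "extends_at M (fibre p) p f g"
  shows "field_apply M (fibre p) X f p = X p g"
proof -
  define g' where "g' = (SOME g. extends_at M (fibre p) p f g)"
  have g': "extends_at M (fibre p) p f g'" unfolding g'_def using assms(2) by (rule someI[of "extends_at M (fibre p) p f"])
  obtain S S' where S: "open S" "p \<in> S" "\<forall>q\<in>S \<inter> fibre p. g q = f q"
    "open S'" "p \<in> S'" "\<forall>q\<in>S' \<inter> fibre p. g' q = f q"
    using assms(2) g' unfolding extends_at_def by blast
  obtain U \<psi> V where U: "foliated_chart r M P B \<pi> \<phi> F U \<psi> V" "p \<in> U" by (rule obtain_foliated_chart)
  interpret U: foliated_chart r M P B \<pi> \<phi> F U \<psi> V by fact
  have "X p g' = X p g"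
  proof (rule U.tangent_slice_cong[OF U(2) assms(1)])
    show "open (S \<inter> S')" "p \<in> S \<inter> S'" using S by auto
    show "smooth_at M p g'" "smooth_at M p g" using assms(2) g' by (auto simp: extends_at_def)
    show "g' q = g q" if "q \<in> S \<inter> S'" "q \<in> U" "\<psi> q - \<psi> p \<in> V" for q
      using S that U.slice_in_fibre[OF U(2) that(2,3)] by auto
  qed
  then show ?thesis by (simp add: field_apply_def g'_def)
qed

text \<open>
  The derivative of \<open>f\<close> along the covector field is again extended by a smooth function, the bracket of
  \<open>h \<circ> \<phi>\<close> with an extension \<open>g\<close> of \<open>f\<close>. This bracket is evaluated away from the fibre too, where it has no
  relation to \<open>X\<close>.
\<close>
lemma field_apply_covector_field:
  assumes \<xi>: "\<xi> = differential B b h" "smooth_fun_on B Y h" "b \<in> Y" "\<xi> \<in> action_ker B \<pi> b"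
    and X: "\<And>q. \<phi> q = b \<Longrightarrow> X q = covector_field \<xi> q"
    and g: "extends_at M (\<phi> -` {b}) p f g" and p: "\<phi> p = b"
  shows "extends_at M (\<phi> -` {b}) p (field_apply M (\<phi> -` {b}) X f) (bracket M P (h \<circ> \<phi>) g)"
proof -
  obtain W S where W: "p \<in> W" "smooth_fun_on M W g" "open S" "p \<in> S" "\<forall>q\<in>S \<inter> \<phi> -` {b}. g q = f q"
    using g by (auto simp: extends_at_def smooth_at_def)
  define D where "D = W \<inter> \<phi> -` Y"
  have oD: "open D"
    unfolding D_def using smooth_fun_on_open W(2) smooth_pullback[OF \<xi>(2)] by blast
  have sh: "smooth_fun_on M D (h \<circ> \<phi>)"
    by (rule smooth_fun_on_subset[OF smooth_pullback[OF \<xi>(2)] oD]) (simp add: D_def)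
  have sg: "smooth_fun_on M D g"
    by (rule smooth_fun_on_subset[OF W(2) oD]) (simp add: D_def)
  have "smooth_at M p (bracket M P (h \<circ> \<phi>) g)"
    by (rule smooth_atI[OF bracket_smooth[OF sh sg]]) (use W(1) p \<xi>(3) in \<open>auto simp: D_def\<close>)
  moreover have "field_apply M (\<phi> -` {b}) X f q = bracket M P (h \<circ> \<phi>) g q"
    if "q \<in> W \<inter> S" "\<phi> q = b" for q
  proof -
    have sg: "smooth_at M q g" using smooth_atI[OF W(2)] that(1) by blast
    have "extends_at M (fibre q) q f g"
      using sg W(3,5) that by (auto simp: extends_at_def)
    then have "field_apply M (\<phi> -` {b}) X f q = X q g"
      using field_apply_extension[of X q f g] covector_field_tangent[of \<xi> q] X[OF that(2)] \<xi>(4) that(2) by simp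
    also have "\<dots> = bracket M P (h \<circ> \<phi>) g q"
      using covector_field_apply[OF \<xi>(2,3) that(2) sg] X[OF that(2)] \<xi>(1) by simp
    finally show ?thesis .
  qed
  moreover have "open (W \<inter> S)" "p \<in> W \<inter> S" using smooth_fun_on_open[OF W(2)] W by auto
  ultimately show ?thesis unfolding extends_at_def by fastforce
qed

end

context foliated_integrals
begin

text \<open>
  A second derivative of \<open>k\<close> in terms of the integrals: \<open>X\<close> is tangent to the slice, so that inside it the
  field \<open>Y\<close> may be replaced by its expansion with constant coefficients along the slice.
\<close>
lemma iterated_field_apply:
  assumes p: "p \<in> U" "p \<in> W" "\<phi> p = b"
    and \<xi>: "\<xi> \<in> action_ker B \<pi> b" "\<And>q. \<phi> q = b \<Longrightarrow> X q = covector_field \<xi> q"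
      "covector_field \<xi> p = lin_comb r c (\<lambda>j. hamiltonian M P (f j) p)"
    and \<xi>': "\<xi>' \<in> action_ker B \<pi> b" "\<And>q. \<phi> q = b \<Longrightarrow> Y q = covector_field \<xi>' q"
      "covector_field \<xi>' p = lin_comb r c' (\<lambda>j. hamiltonian M P (f j) p)"
    and g: "extends_at M (\<phi> -` {b}) p k g"
  shows "field_apply M (\<phi> -` {b}) X (field_apply M (\<phi> -` {b}) Y k) p =
    (\<Sum>i<r. c i * (\<Sum>j<r. c' j * bracket M P (bracket M P g (f j)) (f i) p))"
proof -
  obtain Z h where h: "b \<in> Z" "smooth_fun_on B Z h" "\<xi>' = differential B b h"
    using covector_is_differential[OF action_ker_cotangent[OF \<xi>'(1)]] .
  obtain D where D: "p \<in> D" "smooth_fun_on M D g" using g by (auto simp: extends_at_def smooth_at_def)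
  obtain W' where W': "open W'" "p \<in> W'" "W' \<subseteq> U \<inter> W"
    "\<And>q. q \<in> W' \<Longrightarrow> \<psi> q - \<psi> p \<in> V \<Longrightarrow> covector_field \<xi>' q = lin_comb r c' (\<lambda>j. hamiltonian M P (f j) q)"
    using covector_field_constant_coefficients[OF p(1,2) _ \<xi>'(3)] action_ker_cotangent[OF \<xi>'(1)] p(3) by metis
  have oDW: "open (D \<inter> W)" using smooth_fun_on_open[OF D(2)] open_W by blast
  have sD: "smooth_fun_on M (D \<inter> W) g" by (rule smooth_fun_on_subset[OF D(2) oDW]) auto
  have sG: "smooth_fun_on M (D \<inter> W) (bracket M P g (f j))" if "j < r" for j
    by (rule bracket_smooth[OF sD smooth_fun_on_subset[OF smooth_integral[OF that] oDW]]) auto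
  define G where "G q = (\<Sum>j<r. c' j * bracket M P g (f j) q)" for q
  have sG': "smooth_at M p G"
    unfolding G_def by (rule smooth_atI[OF smooth_fun_on_sum[OF oDW sG]]) (use p D in auto)
  note ext = field_apply_covector_field[OF h(3,2,1) \<xi>'(1) \<xi>'(2) g p(3)]
  have Xp: "X p \<in> tangent_in M (fibre p) p"
    using covector_field_tangent[of \<xi> p] \<xi> p(3) by simp
  have "field_apply M (\<phi> -` {b}) X (field_apply M (\<phi> -` {b}) Y k) p = X p (bracket M P (h \<circ> \<phi>) g)"
    using field_apply_extension[of X p, OF Xp] ext p(3) by simp
  also have "\<dots> = X p G"
  proof (rule tangent_slice_cong[OF p(1) Xp])
    show "open (D \<inter> W')" "p \<in> D \<inter> W'" using smooth_fun_on_open[OF D(2)] W' D by auto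
    show "smooth_at M p (bracket M P (h \<circ> \<phi>) g)" using ext by (simp add: extends_at_def)
    show "smooth_at M p G" by (rule sG')
    fix q assume q: "q \<in> D \<inter> W'" "q \<in> U" "\<psi> q - \<psi> p \<in> V"
    have sg: "smooth_at M q g" using smooth_atI[OF D(2)] q(1) by blast
    have "\<phi> q = b" using slice_in_fibre[OF p(1) q(2,3)] p(3) by simp
    then have "bracket M P (h \<circ> \<phi>) g q = covector_field \<xi>' q g"
      using covector_field_apply[OF h(2,1) _ sg] h(3) by simp
    also have "\<dots> = G q"
      using W'(4)[of q] q sg by (simp add: G_def lin_comb_def hamiltonian_apply)
    finally show "bracket M P (h \<circ> \<phi>) g q = G q" .
  qed
  also have "\<dots> = (\<Sum>i<r. c i * hamiltonian M P (f i) p G)"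
    using \<xi>(2)[OF p(3)] \<xi>(3) by (simp add: lin_comb_def)
  also have "\<dots> = (\<Sum>i<r. c i * (\<Sum>j<r. c' j * bracket M P (bracket M P g (f j)) (f i) p))"
  proof (intro sum.cong refl)
    fix i
    have "smooth_at M p (bracket M P g (f j))" if "j < r" for j
      using smooth_atI[OF sG[OF that]] D(1) p(2) by blast
    then have "hamiltonian M P (f i) p G = (\<Sum>j<r. c' j * bracket M P (bracket M P g (f j)) (f i) p)"
      unfolding G_def using tangent_sum[OF hamiltonian_tangent, of "{..<r}" p "\<lambda>j. bracket M P g (f j)"]
      by (simp add: hamiltonian_apply)
    then show "c i * hamiltonian M P (f i) p G =
        c i * (\<Sum>j<r. c' j * bracket M P (bracket M P g (f j)) (f i) p)" by simp
  qed
  finally show ?thesis .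
qed

text \<open>The fields \<open>X\<^bsub>f\<^sub>i\<^esub>\<close> and \<open>X\<^bsub>f\<^sub>j\<^esub>\<close> commute: the Jacobi identity with \<open>{f\<^sub>i, f\<^sub>j} = 0\<close>.\<close>
lemma double_bracket_commute:
  assumes "smooth_at M p g" "p \<in> W" "i < r" "j < r"
  shows "bracket M P (bracket M P g (f j)) (f i) p = bracket M P (bracket M P g (f i)) (f j) p"
proof -
  obtain D where D: "p \<in> D" "smooth_fun_on M D g" using assms(1) by (auto simp: smooth_at_def)
  have o: "open (D \<inter> W)" using smooth_fun_on_open[OF D(2)] open_W by blast
  have g: "smooth_fun_on M (D \<inter> W) g" by (rule smooth_fun_on_subset[OF D(2) o]) auto
  have f: "smooth_fun_on M (D \<inter> W) (f i)" if "i < r" for i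
    by (rule smooth_fun_on_subset[OF smooth_integral[OF that] o]) auto
  have pD: "p \<in> D \<inter> W" using D assms by auto
  have J: "bracket M P g (bracket M P (f i) (f j)) p + bracket M P (f i) (bracket M P (f j) g) p
      + bracket M P (f j) (bracket M P g (f i)) p = 0"
    by (rule jacobi[OF g f[OF assms(3)] f[OF assms(4)] pD])
  have "bracket M P (bracket M P (f i) (f j)) g p = 0"
    by (rule bracket_zero[OF open_W assms(2)]) (rule integrals_commute[OF _ assms(3,4)])
  then have 1: "bracket M P g (bracket M P (f i) (f j)) p = 0"
    using bracket_skew[of g "bracket M P (f i) (f j)" p] by simp
  have eq: "bracket M P (f j) g = (\<lambda>q. - bracket M P g (f j) q)"
    by (rule ext) (rule bracket_skew)
  have "bracket M P (f i) (bracket M P (f j) g) p = bracket M P (bracket M P g (f j)) (f i) p"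
    using bracket_skew[of "f i" "bracket M P (f j) g" p]
      bracket_uminus[OF smooth_atI[OF bracket_smooth[OF g f[OF assms(4)]] pD], of "f i"]
    unfolding eq by linarith
  then show ?thesis using J 1 bracket_skew[of "f j" "bracket M P g (f i)" p] by linarith
qed

end

context nci
begin

lemma covector_fields_commute:
  assumes \<xi>: "\<xi> \<in> action_ker B \<pi> b" "\<And>q. \<phi> q = b \<Longrightarrow> X q = covector_field \<xi> q"
    and \<xi>': "\<xi>' \<in> action_ker B \<pi> b" "\<And>q. \<phi> q = b \<Longrightarrow> Y q = covector_field \<xi>' q"
  shows "commuting_fields M (\<phi> -` {b}) X Y"
proof -
  have vf: "vector_field_on M (\<phi> -` {b}) X"
    if \<xi>: "\<xi> \<in> action_ker B \<pi> b" "\<And>q. \<phi> q = b \<Longrightarrow> X q = covector_field \<xi> q" for \<xi> X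
    unfolding vector_field_on_def
  proof (intro conjI ballI allI impI)
    fix p assume "p \<in> \<phi> -` {b}"
    then show "X p \<in> tangent_in M (\<phi> -` {b}) p" using covector_field_tangent[of \<xi> p] \<xi> by auto
  next
    fix k assume k: "smooth_on_submanifold M (\<phi> -` {b}) k"
    obtain Z h where h: "b \<in> Z" "smooth_fun_on B Z h" "\<xi> = differential B b h"
      using covector_is_differential[OF action_ker_cotangent[OF \<xi>(1)]] .
    show "smooth_on_submanifold M (\<phi> -` {b}) (field_apply M (\<phi> -` {b}) X k)"
      unfolding smooth_on_submanifold_def
    proof
      fix p assume p: "p \<in> \<phi> -` {b}"
      then obtain g where "extends_at M (\<phi> -` {b}) p k g" using k by (auto simp: smooth_on_submanifold_def)
      then show "\<exists>g. extends_at M (\<phi> -` {b}) p (field_apply M (\<phi> -` {b}) X k) g"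
        using field_apply_covector_field[OF h(3,2,1) \<xi>] p by blast
    qed
  qed
  have "lie_bracket M (\<phi> -` {b}) X Y k p = 0"
    if k: "smooth_on_submanifold M (\<phi> -` {b}) k" and p: "p \<in> \<phi> -` {b}" for k p
  proof -
    obtain g where g: "extends_at M (\<phi> -` {b}) p k g" using k p by (auto simp: smooth_on_submanifold_def)
    obtain U \<psi> V W f where U: "foliated_integrals r M P B \<pi> \<phi> F U \<psi> V W f" "p \<in> U" "p \<in> W"
      by (rule obtain_foliated_integrals)
    interpret U: foliated_integrals r M P B \<pi> \<phi> F U \<psi> V W f by fact
    have pb: "\<phi> p = b" using p by simp
    have "covector_field \<xi> p \<in> tangent_in M (fibre p) p" "covector_field \<xi>' p \<in> tangent_in M (fibre p) p"
      using \<xi>(1) \<xi>'(1) pb by (auto intro!: covector_field_tangent)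
    then obtain c c' where c: "covector_field \<xi> p = lin_comb r c (\<lambda>j. hamiltonian M P (f j) p)"
      "covector_field \<xi>' p = lin_comb r c' (\<lambda>j. hamiltonian M P (f j) p)"
      using U.tangent_span[OF U(3)] by blast
    note it = U.iterated_field_apply[OF U(2,3) pb _ _ _ _ _ _ g]
    have sg: "smooth_at M p g" using g by (simp add: extends_at_def)
    have "field_apply M (\<phi> -` {b}) X (field_apply M (\<phi> -` {b}) Y k) p =
        (\<Sum>i<r. \<Sum>j<r. c i * c' j * bracket M P (bracket M P g (f j)) (f i) p)"
      using it[OF \<xi> c(1) \<xi>' c(2)] by (simp add: sum_distrib_left mult.assoc)
    also have "\<dots> = (\<Sum>j<r. \<Sum>i<r. c i * c' j * bracket M P (bracket M P g (f i)) (f j) p)"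
      by (subst sum.swap) (simp add: U.double_bracket_commute[OF sg U(3)])
    also have "\<dots> = field_apply M (\<phi> -` {b}) Y (field_apply M (\<phi> -` {b}) X k) p"
      using it[OF \<xi>' c(2) \<xi> c(1)] by (simp add: sum_distrib_left mult.assoc mult.left_commute)
    finally show ?thesis by (simp add: lie_bracket_def)
  qed
  then show ?thesis using vf[OF \<xi>] vf[OF \<xi>'] by (simp add: commuting_fields_def)
qed

lemma action_fields_commute:
  assumes "\<alpha> \<in> action_fiber M P B \<pi> \<phi> b" "\<alpha>' \<in> action_fiber M P B \<pi> \<phi> b"
  shows "commuting_fields M (\<phi> -` {b}) (action_field M P B \<phi> \<alpha>) (action_field M P B \<phi> \<alpha>')"
proof -
  obtain \<xi> where "\<xi> \<in> action_ker B \<pi> b" "\<And>p. \<phi> p = b \<Longrightarrow> action_field M P B \<phi> \<alpha> p = covector_field \<xi> p"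
    using action_fiber_cases[OF assms(1)] by blast
  moreover obtain \<xi>' where "\<xi>' \<in> action_ker B \<pi> b" "\<And>p. \<phi> p = b \<Longrightarrow> action_field M P B \<phi> \<alpha>' p = covector_field \<xi>' p"
    using action_fiber_cases[OF assms(2)] by blast
  ultimately show ?thesis by (rule covector_fields_commute)
qed

end

theorem lemma3p2:
  fixes M :: "('m::{t2_space,second_countable_topology}, 'e::euclidean_space) chart set"
    and B :: "('n::{t2_space,second_countable_topology}, 'd::euclidean_space) chart set"
    and P :: "'m bivec" and \<pi> :: "'n bivec"
    and \<phi> :: "'m \<Rightarrow> 'n" and F :: "'m set set" and r :: nat and m :: 'm and b :: 'n
  assumes "nci_system r M P B \<pi> \<phi> F"
    and "b = \<phi> m"
  shows "(\<forall>\<alpha>\<in>action_fiber M P B \<pi> \<phi> b. \<forall>\<alpha>'\<in>action_fiber M P B \<pi> \<phi> b.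
            commuting_fields M (\<phi> -` {b}) (action_field M P B \<phi> \<alpha>) (action_field M P B \<phi> \<alpha>'))
       \<and> (\<forall>\<alpha>. is_basis (action_fiber M P B \<pi> \<phi> b) (action_zero M P B \<pi> \<phi> b)
                 (action_comb M P B \<pi> \<phi> b) r \<alpha> \<longrightarrow>
            is_basis (foliation_tangent M F m) (\<lambda>_. 0) lin_comb r
                 (\<lambda>i. action_field M P B \<phi> (\<alpha> i) m))
       \<and> (\<forall>\<alpha>\<in>action_fiber M P B \<pi> \<phi> b. \<alpha> \<noteq> action_zero M P B \<pi> \<phi> b \<longrightarrow>
            (\<forall>p\<in>\<phi> -` {b}. action_field M P B \<phi> \<alpha> p \<noteq> (\<lambda>_. 0)))"
proof -
  interpret nci r M P B \<pi> \<phi> F by standard (rule assms(1))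
  show ?thesis
    unfolding foliation_tangent_eq assms(2)
  proof (intro conjI ballI allI impI)
    show "commuting_fields M (fibre m) (action_field M P B \<phi> \<alpha>) (action_field M P B \<phi> \<alpha>')"
      if "\<alpha> \<in> action_fiber M P B \<pi> \<phi> (\<phi> m)" "\<alpha>' \<in> action_fiber M P B \<pi> \<phi> (\<phi> m)" for \<alpha> \<alpha>'
      using that by (rule action_fields_commute)
    show "is_basis (tangent_in M (fibre m) m) (\<lambda>_. 0) lin_comb r (\<lambda>i. action_field M P B \<phi> (\<alpha> i) m)"
      if "is_basis (action_fiber M P B \<pi> \<phi> (\<phi> m)) (action_zero M P B \<pi> \<phi> (\<phi> m))
        (action_comb M P B \<pi> \<phi> (\<phi> m)) r \<alpha>" for \<alpha>
      using that by (rule action_fields_basis)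
    show "action_field M P B \<phi> \<alpha> p \<noteq> (\<lambda>_. 0)"
      if "\<alpha> \<in> action_fiber M P B \<pi> \<phi> (\<phi> m)" "\<alpha> \<noteq> action_zero M P B \<pi> \<phi> (\<phi> m)" "p \<in> fibre m" for \<alpha> p
      using that by (intro action_field_nonzero[of \<alpha> "\<phi> m"]) auto
  qed
qed

end
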